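(* Let $K$ be a finite, nonempty simplicial complex with at most $7$ vertices. If $K$ is $\mathbb{Z}_2$-acyclic, then $K$ is collapsible.
   Context: All simplicial complexes are finite; faces are nonempty sets of vertices. $K$ is $\mathbb{Z}_2$-acyclic if $\widetilde{H}_q(|K|,\mathbb{Z}_2)=0$ for all $q\ge 0$ (reduced homology of the geometric carrier $|K|$). If $\tau\subset\sigma$ are faces of $K$ such that $\sigma$ is the only face of $K$ properly containing $\tau$, then $\tau$ is called a free face of $\sigma$ (so $\sigma$ is maximal and $\dim\sigma-\dim\tau=1$), and $K':=K\setminus\{\tau,\sigma\}$ is a simplicial complex; one says there is an elementary collapse of $K$ to $K'$. $K$ is collapsible if there is a finite sequence of elementary collapses (possibly of length zero) from $K$ to a complex consisting of a single vertex. *)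

theory Defs
  imports "HOL-Homology.Homology" "HOL-Library.Z2"
begin

section \<open>Abstract simplicial complexes and collapsibility\<close>

text \<open>A complex is the set of its faces; the empty set is not a face. (The library's
  \<open>simplicial_complex\<close> is about geometric complexes in a Euclidean space.)\<close>

definition finite_complex :: "'v set set \<Rightarrow> bool" where
  "finite_complex K \<longleftrightarrow>
     finite K \<and> (\<forall>\<sigma>\<in>K. finite \<sigma> \<and> \<sigma> \<noteq> {}) \<and>
     (\<forall>\<sigma>\<in>K. \<forall>\<tau>. \<tau> \<subseteq> \<sigma> \<and> \<tau> \<noteq> {} \<longrightarrow> \<tau> \<in> K)"

definition vertices :: "'v set set \<Rightarrow> 'v set" where
  "vertices K = \<Union>K"

definition free_face_of :: "'v set set \<Rightarrow> 'v set \<Rightarrow> 'v set \<Rightarrow> bool" where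
  "free_face_of K \<tau> \<sigma> \<longleftrightarrow>
     \<tau> \<in> K \<and> \<sigma> \<in> K \<and> \<tau> \<subset> \<sigma> \<and> (\<forall>\<rho>\<in>K. \<tau> \<subset> \<rho> \<longrightarrow> \<rho> = \<sigma>)"

definition elementary_collapse :: "'v set set \<Rightarrow> 'v set set \<Rightarrow> bool" where
  "elementary_collapse K K' \<longleftrightarrow> (\<exists>\<tau> \<sigma>. free_face_of K \<tau> \<sigma> \<and> K' = K - {\<tau>, \<sigma>})"

definition collapsible :: "'v set set \<Rightarrow> bool" where
  "collapsible K \<longleftrightarrow> (\<exists>v. elementary_collapse\<^sup>*\<^sup>* K {{v}})"

section \<open>The geometric carrier\<close>

text \<open>Points are given by barycentric coordinates, with value 0 off the vertex set. For a finite
  complex the product topology induces the usual topology on the carrier.\<close>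

definition carrier_points :: "'v set set \<Rightarrow> ('v \<Rightarrow> real) set" where
  "carrier_points K =
     {x. (\<forall>v. 0 \<le> x v) \<and> {v. x v \<noteq> 0} \<in> K \<and> (\<Sum>v | x v \<noteq> 0. x v) = 1}"

definition geometric_carrier :: "'v set set \<Rightarrow> ('v \<Rightarrow> real) topology" where
  "geometric_carrier K = subtopology (powertop_real UNIV) (carrier_points K)"

section \<open>Reduced singular homology with coefficients in the field of two elements\<close>

text \<open>This follows the library's construction of integral singular homology with coefficients
  in \<open>bit\<close>. A nonzero coefficient is 1 and signs are irrelevant, so the boundary
  and the augmentation are plain sums over the support of a chain.\<close>

type_synonym 'a z2_chain = "((nat \<Rightarrow> real) \<Rightarrow> 'a) \<Rightarrow>\<^sub>0 bit"

definition z2_chain_group :: "nat \<Rightarrow> 'a topology \<Rightarrow> 'a z2_chain monoid" where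
  "z2_chain_group p X =
     \<lparr>carrier = {c. Poly_Mapping.keys c \<subseteq> singular_simplex_set p X},
      monoid.mult = (+), one = 0\<rparr>"

definition z2_boundary :: "nat \<Rightarrow> 'a z2_chain \<Rightarrow> 'a z2_chain" where
  "z2_boundary p c =
     (if p = 0 then 0
      else \<Sum>f\<in>Poly_Mapping.keys c. \<Sum>k\<le>p. Poly_Mapping.single (singular_face p k f) 1)"

definition z2_augmentation :: "'a z2_chain \<Rightarrow> bit" where
  "z2_augmentation c = (\<Sum>f\<in>Poly_Mapping.keys c. Poly_Mapping.lookup c f)"

definition z2_reduced_cycles :: "nat \<Rightarrow> 'a topology \<Rightarrow> 'a z2_chain set" where
  "z2_reduced_cycles p X =
     {c \<in> carrier (z2_chain_group p X).
        if p = 0 then z2_augmentation c = 0 else z2_boundary p c = 0}"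

definition z2_boundaries :: "nat \<Rightarrow> 'a topology \<Rightarrow> 'a z2_chain set" where
  "z2_boundaries p X = z2_boundary (Suc p) ` carrier (z2_chain_group (Suc p) X)"

definition z2_reduced_homology_group :: "nat \<Rightarrow> 'a topology \<Rightarrow> 'a z2_chain set monoid" where
  "z2_reduced_homology_group p X =
     subgroup_generated (z2_chain_group p X) (z2_reduced_cycles p X) Mod z2_boundaries p X"

definition z2_acyclic :: "'v set set \<Rightarrow> bool" where
  "z2_acyclic K \<longleftrightarrow> (\<forall>q. trivial_group (z2_reduced_homology_group q (geometric_carrier K)))"

end

theory Submission
  imports Defs
begin

text \<open>
  The proof has a topological and a combinatorial half, which meet in the notion
  \<open>simplicially_acyclic\<close>: every simplicial cycle mod 2 of \<open>K\<close> bounds in \<open>K\<close>.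

  Topology. Realise a simplicial cycle \<open>z\<close> by ordered simplices. The hypothesis gives a singular
  chain \<open>c\<close> with boundary \<open>z\<close> mod 2; lift it to integer coefficients and subdivide it until its
  simplices are small. Now round every point of the carrier to a vertex at which it has coordinate
  at least \<open>1/n\<close>, where \<open>n\<close> is the number of vertices. The corners of a small simplex round to the
  vertices of a common face (\<open>subdivision_rounds_into_complex\<close>), rounding commutes with the
  boundary mod 2 (\<open>round_chain_boundary\<close>), and a subdivided face rounds back to itself, which is
  Sperner's lemma (\<open>round_subdivided_face\<close>). So the rounded subdivision of \<open>c\<close> is a simplicial
  chain in \<open>K\<close> with boundary \<open>z\<close>.

  Combinatorics. Elementary collapses preserve acyclicity, so it suffices that an acyclic \<open>K\<close>
  without free faces is a single vertex. Let \<open>T\<close> be the family of faces of top dimension \<open>d \<ge> 1\<close>. No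
  nonempty part of \<open>T\<close> is a cycle, as it could bound only in dimension \<open>d + 1\<close>. Call the number of
  members of \<open>T\<close> around a facet its degree; no degree is 1. For \<open>n \<le> 7\<close> these two
  properties of \<open>T\<close> contradict each other, except that for \<open>d = 2\<close> and \<open>n = 7\<close> acyclicity of \<open>K\<close> in
  dimension 1 also enters. Passing to complements in the vertex set turns cycles into cocycles,
  and the facets of degree 0 are controlled by a rank inequality: if \<open>X\<close> is a cycle-free family of
  sets of size \<open>m + 1\<close>, \<open>Y\<close> a cocycle-free family of sets of size \<open>m\<close>, and no member of \<open>X\<close> contains
  one of \<open>Y\<close>, then \<open>|X| + |Y| \<le> (n - 1 choose m)\<close>. Comparing this with the sum of all degrees
  leaves little room.

  \<^item> If \<open>n \<le> d + 3\<close>, the complements of the members of \<open>T\<close> have at most two elements, and a cut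
    of a complete multipartite graph gives a cycle in \<open>T\<close>.
  \<^item> If \<open>d = 1\<close>, or \<open>d = 2\<close> and \<open>n = 6\<close>, the two counts contradict each other, unless the pairs of
    degree 0 contain a cut and \<open>T\<close> splits into families on fewer vertices.
  \<^item> If \<open>d = 2\<close> and \<open>n = 7\<close>, they force degree 3 on the edges of one triangle and degree 2 on all
    other pairs. Such a \<open>T\<close> has a vertex whose link is disconnected, and then a cycle of three edges
    does not bound.
  \<^item> If \<open>d = 3\<close> and \<open>n = 7\<close>, every vertex is the apex of a four-set containing exactly three of
    the complementary triples (\<open>tripod\<close>), so there are at least seven such four-sets; double
    counting together with the rank inequality allows at most six.
\<close>

section \<open>Chains mod 2 as families of finite sets\<close>

text \<open>A chain mod 2 is the family of its faces, and addition is symmetric difference. The boundary is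
  determined by the apexes over each facet. The empty set counts as a face, so the boundary of a
  family of singletons records its augmentation.\<close>

definition apexes :: "'a set set \<Rightarrow> 'a set \<Rightarrow> 'a set" where
  "apexes Z \<tau> = {v. v \<notin> \<tau> \<and> insert v \<tau> \<in> Z}"

definition bd :: "'a set set \<Rightarrow> 'a set set" where
  "bd Z = {\<tau>. odd (card (apexes Z \<tau>))}"

text \<open>Dual to the apexes: the vertices of \<open>\<rho>\<close> whose opposite facet belongs to \<open>D\<close>. Their parity is the
  value of the coboundary of \<open>D\<close> at \<open>\<rho>\<close>.\<close>

definition opposite :: "'a set set \<Rightarrow> 'a set \<Rightarrow> 'a set" where
  "opposite D \<rho> = {v\<in>\<rho>. \<rho> - {v} \<in> D}"

definition cocycle :: "'a set \<Rightarrow> 'a set set \<Rightarrow> bool" where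
  "cocycle V D \<longleftrightarrow> (\<forall>\<rho>\<subseteq>V. even (card (opposite D \<rho>)))"

lemma even_card_sym_diff:
  assumes "finite A" "finite B"
  shows "even (card (sym_diff A B)) \<longleftrightarrow> (even (card A) \<longleftrightarrow> even (card B))"
proof -
  have 1: "card (sym_diff A B) = card (A - B) + card (B - A)"
    using assms by (intro card_Un_disjoint) auto
  have 2: "card A = card (A \<inter> B) + card (A - B)" and 3: "card B = card (A \<inter> B) + card (B - A)"
    using assms card_Int_Diff[of A B] card_Int_Diff[of B A] by (simp_all add: Int_commute)
  show ?thesis using 1 2 3 by presburger
qed

lemma finite_apexes: "finite Z \<Longrightarrow> finite (apexes Z \<tau>)"
proof -
  assume "finite Z"
  have "inj_on (\<lambda>v. insert v \<tau>) (apexes Z \<tau>)"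
    by (auto simp: inj_on_def apexes_def)
  moreover have "(\<lambda>v. insert v \<tau>) ` apexes Z \<tau> \<subseteq> Z"
    by (auto simp: apexes_def)
  ultimately show ?thesis using \<open>finite Z\<close> by (meson inj_on_finite)
qed

lemma bd_empty [simp]: "bd {} = {}"
  by (simp add: bd_def apexes_def)

lemma bd_sym_diff:
  assumes "finite Y" "finite Z"
  shows "bd (sym_diff Y Z) = sym_diff (bd Y) (bd Z)"
proof -
  have "apexes (sym_diff Y Z) \<tau> = sym_diff (apexes Y \<tau>) (apexes Z \<tau>)" for \<tau>
    by (auto simp: apexes_def)
  then have "\<tau> \<in> bd (sym_diff Y Z) \<longleftrightarrow> \<tau> \<in> sym_diff (bd Y) (bd Z)" for \<tau>
    using even_card_sym_diff[OF finite_apexes[OF assms(1)] finite_apexes[OF assms(2)], of \<tau> \<tau>]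
    by (simp add: bd_def) blast
  then show ?thesis by blast
qed

lemma bd_singleton: "bd {\<sigma>} = (\<lambda>v. \<sigma> - {v}) ` \<sigma>"
proof -
  have "apexes {\<sigma>} \<tau> = {v}" if "\<tau> = \<sigma> - {v}" "v \<in> \<sigma>" for \<tau> v
    using that by (auto simp: apexes_def)
  moreover have "apexes {\<sigma>} \<tau> = {}" if "\<tau> \<notin> (\<lambda>v. \<sigma> - {v}) ` \<sigma>" for \<tau>
    using that by (auto simp: apexes_def image_iff)
  ultimately have "\<tau> \<in> bd {\<sigma>} \<longleftrightarrow> \<tau> \<in> (\<lambda>v. \<sigma> - {v}) ` \<sigma>" for \<tau>
    by (cases "\<tau> \<in> (\<lambda>v. \<sigma> - {v}) ` \<sigma>") (auto simp: bd_def)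
  then show ?thesis by blast
qed

lemma finite_bd:
  assumes "finite Z" "\<And>\<sigma>. \<sigma> \<in> Z \<Longrightarrow> finite \<sigma>"
  shows "finite (bd Z)"
proof (rule finite_subset)
  show "bd Z \<subseteq> (\<Union>\<sigma>\<in>Z. (\<lambda>v. \<sigma> - {v}) ` \<sigma>)"
  proof
    fix \<tau> assume "\<tau> \<in> bd Z"
    then have "apexes Z \<tau> \<noteq> {}" by (auto simp: bd_def)
    then obtain v where "v \<notin> \<tau>" "insert v \<tau> \<in> Z" by (auto simp: apexes_def)
    then have "\<tau> = insert v \<tau> - {v}" by simp
    then show "\<tau> \<in> (\<Union>\<sigma>\<in>Z. (\<lambda>v. \<sigma> - {v}) ` \<sigma>)"
      using \<open>insert v \<tau> \<in> Z\<close> by (intro UN_I[of "insert v \<tau>"] image_eqI[where x = v]) auto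
  qed
  show "finite (\<Union>\<sigma>\<in>Z. (\<lambda>v. \<sigma> - {v}) ` \<sigma>)" using assms by auto
qed

lemma bd_bd:
  assumes "finite Z" "\<And>\<sigma>. \<sigma> \<in> Z \<Longrightarrow> finite \<sigma>"
  shows "bd (bd Z) = {}"
  using assms
proof (induction Z rule: finite_induct)
  case (insert \<sigma> Z)
  have "bd (bd {\<sigma>}) = {}"
  proof -
    have "even (card (apexes (bd {\<sigma>}) \<tau>))" for \<tau>
    proof (cases "apexes (bd {\<sigma>}) \<tau> = {}")
      case False
      then obtain v where "v \<notin> \<tau>" "insert v \<tau> \<in> (\<lambda>v. \<sigma> - {v}) ` \<sigma>"
        unfolding apexes_def bd_singleton by blast
      then obtain w where v: "v \<notin> \<tau>" "insert v \<tau> = \<sigma> - {w}" "w \<in> \<sigma>" by blast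
      have "v \<noteq> w" and w: "w \<notin> \<tau>" using v by auto
      have \<sigma>: "\<sigma> = insert w (insert v \<tau>)" using v by auto
      have eq: "insert v \<tau> = \<sigma> - {w}" "insert w \<tau> = \<sigma> - {v}" and "v \<in> \<sigma>"
        using \<sigma> v(1) w \<open>v \<noteq> w\<close> by blast+
      have iff: "x \<in> apexes (bd {\<sigma>}) \<tau> \<longleftrightarrow> x \<notin> \<tau> \<and> (\<exists>y\<in>\<sigma>. insert x \<tau> = \<sigma> - {y})" for x
        unfolding apexes_def bd_singleton by blast
      have "x \<in> {v, w}" if "x \<in> apexes (bd {\<sigma>}) \<tau>" for x
        using that \<sigma> unfolding iff by blast
      moreover have "v \<in> apexes (bd {\<sigma>}) \<tau>" "w \<in> apexes (bd {\<sigma>}) \<tau>"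
        unfolding iff using eq v(1,3) w \<open>v \<in> \<sigma>\<close> by blast+
      ultimately have "apexes (bd {\<sigma>}) \<tau> = {v, w}" by blast
      moreover note \<open>v \<noteq> w\<close>
      ultimately show ?thesis by simp
    qed simp
    then show ?thesis by (auto simp: bd_def)
  qed
  moreover have "bd (bd Z) = {}" using insert by simp
  moreover have "finite (bd {\<sigma>})" "finite (bd Z)" using insert by (auto intro: finite_bd)
  moreover have "bd (insert \<sigma> Z) = sym_diff (bd {\<sigma>}) (bd Z)"
  proof -
    have "bd (insert \<sigma> Z) = bd (sym_diff {\<sigma>} Z)"
      by (rule arg_cong[where f = bd]) (use insert in auto)
    also have "\<dots> = sym_diff (bd {\<sigma>}) (bd Z)"
      by (rule bd_sym_diff) (use insert in auto)
    finally show ?thesis .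
  qed
  ultimately show ?case
    by (simp add: bd_sym_diff)
qed simp

lemma bd_face:
  assumes "\<tau> \<in> bd Z"
  obtains v where "v \<notin> \<tau>" "insert v \<tau> \<in> Z"
proof -
  have "apexes Z \<tau> \<noteq> {}" using assms by (auto simp: bd_def)
  then show thesis using that by (auto simp: apexes_def)
qed

lemma bd_card:
  assumes "Z \<subseteq> {\<sigma>. \<sigma> \<subseteq> V \<and> card \<sigma> = Suc m}" "finite V"
  shows "bd Z \<subseteq> {\<sigma>. \<sigma> \<subseteq> V \<and> card \<sigma> = m}"
proof
  fix \<tau> assume "\<tau> \<in> bd Z"
  then obtain v where v: "v \<notin> \<tau>" "insert v \<tau> \<in> Z" by (rule bd_face)
  then have "insert v \<tau> \<subseteq> V" "card (insert v \<tau>) = Suc m" using assms by auto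
  moreover then have "finite \<tau>" using assms(2) finite_subset by auto
  ultimately show "\<tau> \<in> {\<sigma>. \<sigma> \<subseteq> V \<and> card \<sigma> = m}" using v by auto
qed

text \<open>Both sides count the pairs of a member \<open>\<tau>\<close> of \<open>D\<close> and a vertex \<open>v\<close> outside it with
  \<open>insert v \<tau>\<close> in \<open>W\<close>. Mod 2 this is the adjointness of boundary and coboundary; it also yields
  every degree sum used below.\<close>

lemma sum_apexes_eq_sum_opposite:
  assumes "finite W" "finite D" "\<And>w. w \<in> W \<Longrightarrow> finite w"
  shows "(\<Sum>\<tau>\<in>D. card (apexes W \<tau>)) = (\<Sum>w\<in>W. card (opposite D w))"
proof -
  have "bij_betw (\<lambda>(\<tau>, v). (insert v \<tau>, v)) (SIGMA \<tau>:D. apexes W \<tau>) (SIGMA w:W. opposite D w)"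
    by (rule bij_betwI[where g = "\<lambda>(w, v). (w - {v}, v)"])
       (auto simp: apexes_def opposite_def insert_absorb insert_Diff_if)
  then have "card (SIGMA \<tau>:D. apexes W \<tau>) = card (SIGMA w:W. opposite D w)"
    by (rule bij_betw_same_card)
  moreover have "finite (opposite D w)" if "w \<in> W" for w
    using that assms by (auto simp: opposite_def)
  ultimately show ?thesis
    using assms by (simp add: finite_apexes)
qed

section \<open>A rank inequality for cycles and cocycles\<close>

text \<open>Adding \<open>s0\<close> permutes \<open>S\<close> and reverses the sign of every term.\<close>

lemma sum_character_eq_0:
  assumes "finite S" and closed: "\<And>s t. s \<in> S \<Longrightarrow> t \<in> S \<Longrightarrow> sym_diff s t \<in> S"
    and "s0 \<in> S" "finite D" and odd: "odd (card (D \<inter> s0))"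
  shows "(\<Sum>s\<in>S. (-1) ^ card (D \<inter> s)) = (0::int)"
proof -
  let ?f = "\<lambda>s. (-1) ^ card (D \<inter> s) :: int"
  have bij: "bij_betw (\<lambda>s. sym_diff s s0) S S"
    by (rule bij_betwI[where g = "\<lambda>s. sym_diff s s0"]) (use closed \<open>s0 \<in> S\<close> in auto)
  have "?f (sym_diff s s0) = - ?f s" for s
  proof -
    have "D \<inter> sym_diff s s0 = sym_diff (D \<inter> s) (D \<inter> s0)" by auto
    then have "even (card (D \<inter> sym_diff s s0)) \<longleftrightarrow> \<not> even (card (D \<inter> s))"
      using even_card_sym_diff[of "D \<inter> s" "D \<inter> s0"] odd \<open>finite D\<close> by simp
    then show ?thesis by (auto simp: minus_one_power_iff)
  qed
  then have "(\<Sum>s\<in>S. ?f s) = - (\<Sum>s\<in>S. ?f s)"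
    using sum.reindex_bij_betw[OF bij, of ?f] by (simp add: sum_negf)
  then show ?thesis by simp
qed

text \<open>A space of functionals that separates points is the full dual. The proof sums the sign
  \<open>(-1)\<close> to the power \<open>card (D \<inter> s)\<close> over all subsets \<open>D\<close> of \<open>M\<close> and all \<open>s\<close> in \<open>S\<close>: in one order only
  \<open>D = {}\<close> contributes, in the other only \<open>s = {}\<close>, so \<open>S\<close> has as many members as \<open>Pow M\<close>.\<close>

lemma separating_subspace_full:
  assumes "finite M" "S \<subseteq> Pow M" "{} \<in> S"
    and closed: "\<And>s t. s \<in> S \<Longrightarrow> t \<in> S \<Longrightarrow> sym_diff s t \<in> S"
    and sep: "\<And>D. D \<subseteq> M \<Longrightarrow> D \<noteq> {} \<Longrightarrow> \<exists>s\<in>S. odd (card (D \<inter> s))"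
  shows "S = Pow M"
proof -
  let ?f = "\<lambda>D s. (-1) ^ card (D \<inter> s) :: int"
  have fS: "finite S" using assms(1,2) finite_subset[of S "Pow M"] by simp
  have s0: "(\<Sum>s\<in>S. ?f D s) = 0" if D: "D \<subseteq> M" "D \<noteq> {}" for D
  proof -
    obtain s0 where s0: "s0 \<in> S" "odd (card (D \<inter> s0))" using sep D by blast
    show ?thesis
      by (rule sum_character_eq_0[OF fS closed s0(1) _ s0(2)])
         (use D(1) \<open>finite M\<close> finite_subset in blast)+
  qed
  have t0: "(\<Sum>D\<in>Pow M. ?f D s) = 0" if "s \<in> S" "s \<noteq> {}" for s
  proof -
    obtain x where x: "x \<in> s" using \<open>s \<noteq> {}\<close> by auto
    have "s \<subseteq> M" using that assms(2) by auto
    have "(\<Sum>D\<in>Pow M. ?f s D) = 0"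
    proof (rule sum_character_eq_0[where ?s0.0 = "{x}"])
      show "odd (card (s \<inter> {x}))" using x by simp
      show "{x} \<in> Pow M" using x \<open>s \<subseteq> M\<close> by blast
      show "finite s" using \<open>s \<subseteq> M\<close> \<open>finite M\<close> finite_subset by blast
    qed (use \<open>finite M\<close> in auto)
    then show ?thesis by (simp only: Int_commute)
  qed
  have "int (card S) = (\<Sum>s\<in>S. ?f {} s)" by simp
  also have "\<dots> = (\<Sum>D\<in>Pow M. \<Sum>s\<in>S. ?f D s)"
    using s0 \<open>finite M\<close> sum.mono_neutral_left[of "Pow M" "{{}}" "\<lambda>D. \<Sum>s\<in>S. ?f D s"] by auto
  also have "\<dots> = (\<Sum>s\<in>S. \<Sum>D\<in>Pow M. ?f D s)" by (rule sum.swap)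
  also have "\<dots> = (\<Sum>D\<in>Pow M. ?f D {})"
    using t0 fS \<open>{} \<in> S\<close> sum.mono_neutral_left[of S "{{}}" "\<lambda>s. \<Sum>D\<in>Pow M. ?f D s"] by auto
  also have "\<dots> = int (card (Pow M))" by simp
  finally have "card S = card (Pow M)" by linarith
  then show ?thesis
    using assms(1,2) card_subset_eq[of "Pow M" S] by simp
qed

text \<open>Since \<open>Y\<close> contains no cocycle, boundaries separate its subsets, so every subset \<open>\<mu>\<close> of \<open>Y\<close> is
  the trace on \<open>Y\<close> of the boundary of some chain \<open>c \<mu>\<close>. Boundaries of subsets of \<open>X\<close> have empty
  trace on \<open>Y\<close> and determine the subset. So the boundary of \<open>Z + c \<mu>\<close> determines the pair \<open>(Z, \<mu>)\<close>,
  and the left-hand side is at most the dimension of the space of boundaries. A boundary is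
  determined by its members avoiding \<open>v0\<close>, which bounds that dimension by the right-hand side.\<close>

theorem card_cycle_free_add_card_cocycle_free_le:
  assumes V: "finite V" "v0 \<in> V" and m: "0 < m"
    and X: "X \<subseteq> {\<sigma>. \<sigma> \<subseteq> V \<and> card \<sigma> = Suc m}" and Y: "Y \<subseteq> {\<tau>. \<tau> \<subseteq> V \<and> card \<tau> = m}"
    and X0: "\<And>Z. Z \<subseteq> X \<Longrightarrow> Z \<noteq> {} \<Longrightarrow> bd Z \<noteq> {}"
    and Y0: "\<And>D. D \<subseteq> Y \<Longrightarrow> D \<noteq> {} \<Longrightarrow> \<not> cocycle V D"
    and XY: "\<And>\<tau>. \<tau> \<in> Y \<Longrightarrow> apexes X \<tau> = {}"
  shows "card X + card Y \<le> (card V - 1) choose m"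
proof -
  define C where "C = {\<sigma>. \<sigma> \<subseteq> V \<and> card \<sigma> = Suc m}"
  have fC: "finite C" using V by (simp add: C_def)
  have fX: "finite X" using X fC C_def finite_subset by blast
  have fY: "finite Y" using Y V(1) by (rule_tac finite_subset[of _ "Pow V"]) auto
  have finC: "finite \<sigma>" if "\<sigma> \<in> C" for \<sigma> using that V C_def finite_subset by blast
  have sub_fin: "finite Z" if "Z \<subseteq> C" for Z using that fC finite_subset by blast
  define S where "S = (\<lambda>c. bd c \<inter> Y) ` Pow C"
  have "S = Pow Y"
  proof (rule separating_subspace_full)
    show "{} \<in> S" by (force simp: S_def)
    fix s t assume "s \<in> S" "t \<in> S"
    then obtain c d where cd: "c \<subseteq> C" "d \<subseteq> C" "s = bd c \<inter> Y" "t = bd d \<inter> Y"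
      by (auto simp: S_def)
    then have "sym_diff s t = bd (sym_diff c d) \<inter> Y"
      by (simp add: bd_sym_diff sub_fin) blast
    moreover have "sym_diff c d \<subseteq> C" using cd by auto
    ultimately show "sym_diff s t \<in> S" unfolding S_def by blast
  next
    fix D assume D: "D \<subseteq> Y" "D \<noteq> {}"
    then obtain \<rho> where \<rho>: "\<rho> \<subseteq> V" "odd (card (opposite D \<rho>))"
      using Y0 unfolding cocycle_def by blast
    have "opposite D \<rho> \<noteq> {}" using \<rho> by auto
    then obtain v where "v \<in> \<rho>" "\<rho> - {v} \<in> D" by (auto simp: opposite_def)
    then have "card (\<rho> - {v}) = m" using D Y by blast
    moreover have "finite \<rho>" using \<rho>(1) V(1) finite_subset by blast
    ultimately have "card \<rho> = Suc m" using card_Suc_Diff1[OF _ \<open>v \<in> \<rho>\<close>] by simp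
    then have C: "\<rho> \<in> C" using \<rho> by (simp add: C_def)
    have "D \<inter> (bd {\<rho>} \<inter> Y) = (\<lambda>v. \<rho> - {v}) ` opposite D \<rho>"
      using D by (auto simp: bd_singleton opposite_def)
    moreover have "inj_on (\<lambda>v. \<rho> - {v}) (opposite D \<rho>)"
      by (auto simp: inj_on_def opposite_def)
    ultimately have "odd (card (D \<inter> (bd {\<rho>} \<inter> Y)))"
      using \<rho> by (simp add: card_image)
    then show "\<exists>s\<in>S. odd (card (D \<inter> s))" using C unfolding S_def by blast
  qed (auto simp: S_def fY)
  have "\<exists>c. c \<subseteq> C \<and> bd c \<inter> Y = \<mu>" if "\<mu> \<subseteq> Y" for \<mu>
  proof -
    have "\<mu> \<in> S" using \<open>S = Pow Y\<close> that by blast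
    then show ?thesis unfolding S_def by blast
  qed
  then obtain c where c: "\<And>\<mu>. \<mu> \<subseteq> Y \<Longrightarrow> c \<mu> \<subseteq> C \<and> bd (c \<mu>) \<inter> Y = \<mu>"
    by metis
  define Q where "Q = {\<tau>. \<tau> \<subseteq> V - {v0} \<and> card \<tau> = m}"
  define F where "F = (\<lambda>(Z, \<mu>). bd (sym_diff Z (c \<mu>)) \<inter> Q)"
  have XC: "X \<subseteq> C" using X by (simp add: C_def)
  have bdX: "bd Z \<inter> Y = {}" if "Z \<subseteq> X" for Z
  proof -
    have "apexes Z \<tau> = {}" if "\<tau> \<in> Y" for \<tau> using XY[OF that] \<open>Z \<subseteq> X\<close> by (auto simp: apexes_def)
    then show ?thesis by (auto simp: bd_def)
  qed
  \<comment> \<open>A cycle \<open>b\<close> all of whose members contain \<open>v0\<close> is empty: over \<open>\<beta> - {v0}\<close> the only apex is \<open>v0\<close>.\<close>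
  have cone: "bd d1 = bd d2" if d: "d1 \<subseteq> C" "d2 \<subseteq> C" "bd d1 \<inter> Q = bd d2 \<inter> Q" for d1 d2
  proof -
    define b where "b = bd (sym_diff d1 d2)"
    have dC: "sym_diff d1 d2 \<subseteq> C" using d by auto
    then have "bd b = {}" unfolding b_def by (intro bd_bd) (auto intro: sub_fin finC)
    have b_eq: "b = sym_diff (bd d1) (bd d2)" using d sub_fin by (simp add: b_def bd_sym_diff)
    have bC: "b \<subseteq> {\<tau>. \<tau> \<subseteq> V \<and> card \<tau> = m}"
      unfolding b_def by (rule bd_card) (use dC V C_def in auto)
    have v0: "v0 \<in> \<beta>" if "\<beta> \<in> b" for \<beta>
    proof (rule ccontr)
      assume "v0 \<notin> \<beta>"
      then have "\<beta> \<in> Q" using that bC by (auto simp: Q_def)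
      then show False using that b_eq d(3) by blast
    qed
    have "b = {}"
    proof (rule ccontr)
      assume "b \<noteq> {}"
      then obtain \<beta> where \<beta>: "\<beta> \<in> b" by auto
      have "apexes b (\<beta> - {v0}) = {v0}"
      proof -
        have "v = v0" if "insert v (\<beta> - {v0}) \<in> b" for v
          using v0[OF that] by auto
        moreover have "insert v0 (\<beta> - {v0}) = \<beta>" using v0[OF \<beta>] by auto
        ultimately show ?thesis using \<beta> by (auto simp: apexes_def)
      qed
      then have "\<beta> - {v0} \<in> bd b" by (simp add: bd_def)
      then show False using \<open>bd b = {}\<close> by simp
    qed
    then show ?thesis using b_eq by blast
  qed
  have "inj_on F (Pow X \<times> Pow Y)"
  proof (rule inj_onI)
    fix p q assume p: "p \<in> Pow X \<times> Pow Y" and q: "q \<in> Pow X \<times> Pow Y" and eq: "F p = F q"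
    obtain Z1 \<mu>1 where p': "p = (Z1, \<mu>1)" by fastforce
    obtain Z2 \<mu>2 where q': "q = (Z2, \<mu>2)" by fastforce
    have sub: "Z1 \<subseteq> X" "\<mu>1 \<subseteq> Y" "Z2 \<subseteq> X" "\<mu>2 \<subseteq> Y" using p q p' q' by auto
    note c1 = c[OF sub(2)] and c2 = c[OF sub(4)]
    have inC: "Z1 \<subseteq> C" "Z2 \<subseteq> C" using sub XC by auto
    have fin: "finite Z1" "finite Z2" "finite (c \<mu>1)" "finite (c \<mu>2)"
      using inC c1 c2 sub_fin by auto
    have "bd (sym_diff Z1 (c \<mu>1)) = bd (sym_diff Z2 (c \<mu>2))"
    proof (rule cone)
      show "bd (sym_diff Z1 (c \<mu>1)) \<inter> Q = bd (sym_diff Z2 (c \<mu>2)) \<inter> Q"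
        using eq p' q' by (simp add: F_def)
    qed (use inC c1 c2 in blast)+
    then have e: "sym_diff (bd Z1) (bd (c \<mu>1)) = sym_diff (bd Z2) (bd (c \<mu>2))"
      using fin by (simp add: bd_sym_diff)
    have "sym_diff (bd Z) B \<inter> Y = B \<inter> Y" if "Z \<subseteq> X" for Z B
      using bdX[OF that] by blast
    from this[OF sub(1), of "bd (c \<mu>1)"] this[OF sub(3), of "bd (c \<mu>2)"]
    have \<mu>: "\<mu>1 = \<mu>2" using e c1 c2 by simp
    with e have "bd Z1 = bd Z2" by blast
    then have "bd (sym_diff Z1 Z2) = {}" using fin by (simp add: bd_sym_diff)
    then have "sym_diff Z1 Z2 = {}" using X0[of "sym_diff Z1 Z2"] sub by blast
    then show "p = q" using \<mu> p' q' by auto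
  qed
  moreover have "F ` (Pow X \<times> Pow Y) \<subseteq> Pow Q" by (auto simp: F_def)
  moreover have fQ: "finite Q" using V by (simp add: Q_def)
  ultimately have "card (Pow X \<times> Pow Y) \<le> card (Pow Q)"
    using card_inj_on_le[of F "Pow X \<times> Pow Y" "Pow Q"] by simp
  then have "(2::nat) ^ (card X + card Y) \<le> 2 ^ card Q"
    using fX fY fQ by (simp add: card_cartesian_product card_Pow power_add)
  then have "card X + card Y \<le> card Q" by simp
  also have "card Q = (card V - 1) choose m"
    using n_subsets[of "V - {v0}" m] V by (simp add: Q_def)
  finally show ?thesis .
qed

section \<open>Duality between cycles and cocycles\<close>

abbreviation ksubsets :: "'a set \<Rightarrow> nat \<Rightarrow> 'a set set" where
  "ksubsets V m \<equiv> {\<sigma>. \<sigma> \<subseteq> V \<and> card \<sigma> = m}"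

lemma pairE:
  assumes "e \<in> ksubsets V 2"
  obtains x y where "e = {x, y}" "x \<noteq> y" "x \<in> V" "y \<in> V"
proof -
  have "card e = 2" "e \<subseteq> V" using assms by simp_all
  then show thesis using that by (auto simp: card_2_iff)
qed

lemma singletonE:
  assumes "e \<in> ksubsets V 1"
  obtains x where "e = {x}" "x \<in> V"
proof -
  have "card e = 1" "e \<subseteq> V" using assms by simp_all
  then show thesis using that by (auto simp: card_1_singleton_iff)
qed

text \<open>For the family of all top-dimensional faces of a complex this says that none of them has a free
  facet.\<close>

definition no_free :: "'a set set \<Rightarrow> bool" where
  "no_free T \<longleftrightarrow> (\<forall>\<tau>. card (apexes T \<tau>) \<noteq> 1)"

definition cobd :: "'a set \<Rightarrow> 'a set set \<Rightarrow> 'a set set" where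
  "cobd V \<Gamma> = {\<rho>. \<rho> \<subseteq> V \<and> odd (card (opposite \<Gamma> \<rho>))}"

abbreviation compl :: "'a set \<Rightarrow> 'a set set \<Rightarrow> 'a set set" where
  "compl V D \<equiv> (\<lambda>\<sigma>. V - \<sigma>) ` D"

lemma compl_compl: "D \<subseteq> Pow V \<Longrightarrow> compl V (compl V D) = D"
  by (auto simp: image_image double_diff)

lemma mem_compl:
  assumes "D \<subseteq> Pow V" "\<sigma> \<subseteq> V"
  shows "\<sigma> \<in> compl V D \<longleftrightarrow> V - \<sigma> \<in> D"
proof
  assume "\<sigma> \<in> compl V D"
  then obtain \<delta> where "\<sigma> = V - \<delta>" "\<delta> \<in> D" by auto
  moreover then have "V - \<sigma> = \<delta>" using assms by blast
  ultimately show "V - \<sigma> \<in> D" by simp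
next
  assume "V - \<sigma> \<in> D"
  moreover have "\<sigma> = V - (V - \<sigma>)" using assms by blast
  ultimately show "\<sigma> \<in> compl V D" by (rule rev_image_eqI)
qed

text \<open>Complementation in \<open>V\<close> exchanges adding and removing a vertex, hence boundary and coboundary.\<close>

lemma apexes_compl:
  assumes "D \<subseteq> Pow V" "\<tau> \<subseteq> V"
  shows "apexes (compl V D) \<tau> = opposite D (V - \<tau>)"
proof -
  have "v \<in> apexes (compl V D) \<tau> \<longleftrightarrow> v \<in> opposite D (V - \<tau>)" for v
  proof (cases "v \<in> V - \<tau>")
    case True
    then have "insert v \<tau> \<subseteq> V" "V - insert v \<tau> = V - \<tau> - {v}" using assms by auto
    then show ?thesis
      using True mem_compl[OF assms(1), of "insert v \<tau>"] by (simp add: apexes_def opposite_def)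
  next
    case False
    then show ?thesis by (auto simp: apexes_def opposite_def)
  qed
  then show ?thesis by blast
qed

lemma apexes_outside: "D \<subseteq> Pow V \<Longrightarrow> \<not> \<tau> \<subseteq> V \<Longrightarrow> apexes D \<tau> = {}"
  unfolding apexes_def by blast

lemma bd_compl_eq_empty_iff:
  assumes "D \<subseteq> Pow V"
  shows "bd (compl V D) = {} \<longleftrightarrow> cocycle V D"
proof
  assume L: "bd (compl V D) = {}"
  show "cocycle V D" unfolding cocycle_def
  proof (intro allI impI)
    fix \<rho> assume \<rho>: "\<rho> \<subseteq> V"
    have "V - \<rho> \<notin> bd (compl V D)" using L by simp
    moreover have "V - (V - \<rho>) = \<rho>" using \<rho> by blast
    ultimately show "even (card (opposite D \<rho>))"
      using apexes_compl[OF assms, of "V - \<rho>"] by (simp add: bd_def)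
  qed
next
  assume R: "cocycle V D"
  have "\<tau> \<notin> bd (compl V D)" for \<tau>
  proof (cases "\<tau> \<subseteq> V")
    case True
    then show ?thesis using R apexes_compl[OF assms True] by (simp add: bd_def cocycle_def)
  next
    case False
    have "compl V D \<subseteq> Pow V" by auto
    then show ?thesis using apexes_outside[OF _ False] by (simp add: bd_def)
  qed
  then show "bd (compl V D) = {}" by blast
qed

lemma cocycle_cobd:
  assumes "finite V" "\<Gamma> \<subseteq> Pow V"
  shows "cocycle V (cobd V \<Gamma>)"
proof -
  have sub: "bd (compl V \<Gamma>) \<subseteq> Pow V"
  proof
    fix \<tau> assume "\<tau> \<in> bd (compl V \<Gamma>)"
    then obtain v where "insert v \<tau> \<in> compl V \<Gamma>" by (rule bd_face)
    then show "\<tau> \<in> Pow V" by blast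
  qed
  have fin: "finite (compl V \<Gamma>)" using assms finite_subset[OF assms(2)] by simp
  have "\<rho> \<in> cobd V \<Gamma> \<longleftrightarrow> \<rho> \<in> compl V (bd (compl V \<Gamma>))" for \<rho>
  proof (cases "\<rho> \<subseteq> V")
    case True
    have "V - (V - \<rho>) = \<rho>" using True by blast
    then show ?thesis
      using True mem_compl[OF sub True] apexes_compl[OF assms(2), of "V - \<rho>"]
      by (simp add: cobd_def bd_def)
  next
    case False
    then show ?thesis by (auto simp: cobd_def)
  qed
  then have eq: "cobd V \<Gamma> = compl V (bd (compl V \<Gamma>))" by blast
  have "bd (bd (compl V \<Gamma>)) = {}"
    by (rule bd_bd[OF fin]) (use assms(1) in auto)
  then have "bd (compl V (cobd V \<Gamma>)) = {}"
    unfolding eq compl_compl[OF sub] .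
  moreover have "cobd V \<Gamma> \<subseteq> Pow V" by (auto simp: cobd_def)
  ultimately show ?thesis using bd_compl_eq_empty_iff by blast
qed

lemma card_cobd:
  assumes "finite V" "\<Gamma> \<subseteq> ksubsets V m"
  shows "cobd V \<Gamma> \<subseteq> ksubsets V (Suc m)"
proof
  fix \<rho> assume \<rho>: "\<rho> \<in> cobd V \<Gamma>"
  then have "opposite \<Gamma> \<rho> \<noteq> {}" "\<rho> \<subseteq> V" by (auto simp: cobd_def)
  then obtain v where "v \<in> \<rho>" "\<rho> - {v} \<in> \<Gamma>" by (auto simp: opposite_def)
  moreover then have "card (\<rho> - {v}) = m" using assms by blast
  moreover have "finite \<rho>" using \<open>\<rho> \<subseteq> V\<close> assms(1) finite_subset by blast
  ultimately show "\<rho> \<in> ksubsets V (Suc m)" using card_Suc_Diff1[of \<rho> v] \<open>\<rho> \<subseteq> V\<close> by simp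
qed

text \<open>The dual form of \<open>no_free\<close>: no set contains exactly one complement as a facet.\<close>

lemma no_free_compl:
  assumes "no_free T" "T \<subseteq> Pow V" "Q \<subseteq> V"
  shows "card (opposite (compl V T) Q) \<noteq> 1"
proof -
  have "compl V T \<subseteq> Pow V" by auto
  then have "apexes (compl V (compl V T)) (V - Q) = opposite (compl V T) (V - (V - Q))"
    by (intro apexes_compl) auto
  moreover have "V - (V - Q) = Q" using assms by blast
  ultimately have "opposite (compl V T) Q = apexes T (V - Q)"
    using compl_compl[OF assms(2)] by simp
  then show ?thesis using assms(1) by (simp add: no_free_def)
qed

lemma cycle_of_cocycle_in_compl:
  assumes "T \<subseteq> Pow V" "D \<subseteq> compl V T" "D \<noteq> {}" "cocycle V D"
  obtains Z where "Z \<subseteq> T" "Z \<noteq> {}" "bd Z = {}"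
proof
  have "D \<subseteq> Pow V" using assms(2) by auto
  then show "bd (compl V D) = {}" using bd_compl_eq_empty_iff[of D V] assms(4) by simp
  show "compl V D \<noteq> {}" using assms(3) by simp
  have "compl V D \<subseteq> compl V (compl V T)" by (rule image_mono[OF assms(2)])
  then show "compl V D \<subseteq> T" unfolding compl_compl[OF assms(1)] .
qed

lemma opposite_2: "x \<noteq> y \<Longrightarrow>
  opposite U {x, y} = (if {y} \<in> U then {x} else {}) \<union> (if {x} \<in> U then {y} else {})"
  by (auto simp: opposite_def insert_Diff_if)

lemma opposite_3: "x \<noteq> y \<Longrightarrow> x \<noteq> z \<Longrightarrow> y \<noteq> z \<Longrightarrow>
  opposite U {x, y, z} = (if {y, z} \<in> U then {x} else {}) \<union> (if {x, z} \<in> U then {y} else {}) \<union>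
    (if {x, y} \<in> U then {z} else {})"
  by (auto simp: opposite_def insert_Diff_if)

lemma opposite_4: "w \<noteq> x \<Longrightarrow> w \<noteq> y \<Longrightarrow> w \<noteq> z \<Longrightarrow> x \<noteq> y \<Longrightarrow> x \<noteq> z \<Longrightarrow> y \<noteq> z \<Longrightarrow>
  opposite U {w, x, y, z} = (if {x, y, z} \<in> U then {w} else {}) \<union> (if {w, y, z} \<in> U then {x} else {}) \<union>
    (if {w, x, z} \<in> U then {y} else {}) \<union> (if {w, x, y} \<in> U then {z} else {})"
  by (auto simp: opposite_def insert_Diff_if)

lemma odd_opposite_2: "x \<noteq> y \<Longrightarrow> odd (card (opposite U {x, y})) \<longleftrightarrow> ({x} \<in> U) \<noteq> ({y} \<in> U)"
  by (simp add: opposite_2)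

lemma odd_opposite_3: "x \<noteq> y \<Longrightarrow> x \<noteq> z \<Longrightarrow> y \<noteq> z \<Longrightarrow>
  odd (card (opposite U {x, y, z})) \<longleftrightarrow> (({x, y} \<in> U) \<noteq> (({x, z} \<in> U) \<noteq> ({y, z} \<in> U)))"
  by (simp add: opposite_3)

lemma odd_opposite_4: "w \<noteq> x \<Longrightarrow> w \<noteq> y \<Longrightarrow> w \<noteq> z \<Longrightarrow> x \<noteq> y \<Longrightarrow> x \<noteq> z \<Longrightarrow> y \<noteq> z \<Longrightarrow>
  odd (card (opposite U {w, x, y, z})) \<longleftrightarrow>
    ((({w, x, y} \<in> U) \<noteq> ({w, x, z} \<in> U)) \<noteq> (({w, y, z} \<in> U) \<noteq> ({x, y, z} \<in> U)))"
  by (simp add: opposite_4)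

text \<open>In sets of two, three and four points: if \<open>Q\<close> does not have exactly one facet in \<open>U\<close>, then one
  facet in \<open>U\<close> forces a second.\<close>

lemma second_opposite_2: "card (opposite U {x, y}) \<noteq> 1 \<Longrightarrow> x \<noteq> y \<Longrightarrow> {x} \<in> U \<Longrightarrow> {y} \<in> U"
  by (auto simp: opposite_2 split: if_splits)

lemma second_opposite_3: "card (opposite U {x, y, z}) \<noteq> 1 \<Longrightarrow> x \<noteq> y \<Longrightarrow> x \<noteq> z \<Longrightarrow> y \<noteq> z \<Longrightarrow>
  {x, y} \<in> U \<Longrightarrow> {x, z} \<in> U \<or> {y, z} \<in> U"
  by (auto simp: opposite_3 split: if_splits)

lemma second_opposite_4: "card (opposite U {w, x, y, z}) \<noteq> 1 \<Longrightarrow>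
  w \<noteq> x \<Longrightarrow> w \<noteq> y \<Longrightarrow> w \<noteq> z \<Longrightarrow> x \<noteq> y \<Longrightarrow> x \<noteq> z \<Longrightarrow> y \<noteq> z \<Longrightarrow>
  {x, y, z} \<in> U \<Longrightarrow> {w, x, y} \<in> U \<or> {w, x, z} \<in> U \<or> {w, y, z} \<in> U"
  by (auto simp: opposite_4 split: if_splits)

section \<open>Few vertices and low dimension\<close>

text \<open>If no three points span exactly one edge, then non-adjacency is an equivalence relation. So the
  class \<open>A\<close> of an endpoint \<open>p\<close> of an edge is joined to its complement by all possible edges, and
  these form a cocycle.\<close>

lemma cut_in_graph:
  assumes V: "finite V" and U: "U \<subseteq> ksubsets V 2" "U \<noteq> {}"
    and one: "\<And>Q. Q \<subseteq> V \<Longrightarrow> card (opposite U Q) \<noteq> 1"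
  obtains D where "D \<subseteq> U" "D \<noteq> {}" "cocycle V D"
proof -
  obtain e where e: "e \<in> U" using U(2) by blast
  then have "e \<in> ksubsets V 2" using U(1) by blast
  then obtain p q where ab: "e = {p, q}" "p \<noteq> q" by (rule pairE)
  then have pq: "{p, q} \<in> U" "p \<noteq> q" using e by simp_all
  have V_pq: "p \<in> V" "q \<in> V" using pq U by auto
  define A where "A = {y \<in> V. {p, y} \<notin> U}"
  have "p \<in> A" using U V_pq by (auto simp: A_def)
  define D where "D = cobd V ((\<lambda>a. {a}) ` A)"
  have "A \<subseteq> V" by (auto simp: A_def)
  have D2: "D \<subseteq> ksubsets V 2"
  proof -
    have "(\<lambda>a. {a}) ` A \<subseteq> ksubsets V 1" using \<open>A \<subseteq> V\<close> by auto
    then show ?thesis using card_cobd[OF V, of _ 1] by (simp add: D_def numeral_2_eq_2)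
  qed
  have D_iff: "{x, y} \<in> D \<longleftrightarrow> (x \<in> A) \<noteq> (y \<in> A)" if "x \<in> V" "y \<in> V" "x \<noteq> y" for x y
    using that odd_opposite_2[OF that(3), of "(\<lambda>a. {a}) ` A"] by (auto simp: D_def cobd_def)
  have AU: "{x, y} \<in> U" if "x \<in> A" "y \<in> V" "y \<notin> A" for x y
  proof (cases "x = p")
    case True then show ?thesis using that by (auto simp: A_def)
  next
    case False
    have py: "{p, y} \<in> U" "{p, x} \<notin> U" using that by (auto simp: A_def)
    have "p \<noteq> y" using that \<open>p \<in> A\<close> by auto
    moreover have "x \<noteq> y" using that by auto
    moreover have "{p, y, x} \<subseteq> V" using that V_pq \<open>A \<subseteq> V\<close> by auto
    ultimately have "{p, x} \<in> U \<or> {y, x} \<in> U"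
      using second_opposite_3[OF one, of p y x] False py by blast
    then show ?thesis using py by (simp add: insert_commute)
  qed
  show thesis
  proof
    show "D \<subseteq> U"
    proof
      fix e assume e: "e \<in> D"
      then have "e \<in> ksubsets V 2" using D2 by blast
      then obtain x y where xy: "e = {x, y}" "x \<noteq> y" "x \<in> V" "y \<in> V" by (rule pairE)
      then have "x \<in> A \<and> y \<notin> A \<or> y \<in> A \<and> x \<notin> A" using D_iff[OF xy(3,4,2)] e by blast
      moreover have "{y, x} = {x, y}" by blast
      ultimately show "e \<in> U" using AU[of x y] AU[of y x] xy by metis
    qed
    have "q \<notin> A" using pq by (simp add: A_def)
    then show "D \<noteq> {}" using D_iff[OF V_pq pq(2)] \<open>p \<in> A\<close> by blast
    show "cocycle V D" unfolding D_def
      by (rule cocycle_cobd[OF V]) (use \<open>A \<subseteq> V\<close> in auto)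
  qed
qed

text \<open>The complements have 0, 1 or 2 elements. In the first case \<open>T = {V}\<close>, and all facets of \<open>V\<close> are
  free; in the second case all facets of \<open>V\<close> are in \<open>T\<close> and form a cycle; the third case is that of
  graphs.\<close>

lemma cycle_if_few_vertices:
  assumes V: "finite V" and T: "T \<subseteq> ksubsets V (Suc d)" "T \<noteq> {}" "no_free T"
    and few: "card V \<le> d + 3"
  obtains Z where "Z \<subseteq> T" "Z \<noteq> {}" "bd Z = {}"
proof -
  have TV: "T \<subseteq> Pow V" using T by auto
  define U where "U = compl V T"
  define k where "k = card V - Suc d"
  have U: "U \<subseteq> ksubsets V k"
    unfolding U_def k_def using T V by (auto simp: card_Diff_subset finite_subset)
  have "U \<noteq> {}" using T by (simp add: U_def)
  note one = no_free_compl[OF T(3) TV, folded U_def]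
  obtain \<sigma> where "\<sigma> \<in> T" using T by auto
  then have "Suc d \<le> card V" using T V card_mono[OF V, of \<sigma>] by auto
  then have "k \<le> 2" using few by (simp add: k_def)
  then consider "k = 0" | "k = 1" | "k = 2" by linarith
  then have "\<exists>D\<subseteq>U. D \<noteq> {} \<and> cocycle V D"
  proof cases
    case 1
    then have "{} \<in> U" using U \<open>U \<noteq> {}\<close> V by (auto simp: finite_subset)
    obtain v where v: "v \<in> V" using \<open>Suc d \<le> card V\<close> by fastforce
    have "opposite U {v} = {v}" using \<open>{} \<in> U\<close> by (auto simp: opposite_def)
    then show ?thesis using one[of "{v}"] v by simp
  next
    case 2
    obtain e where e: "e \<in> U" using \<open>U \<noteq> {}\<close> by blast
    then have "e \<in> ksubsets V 1" using U 2 by blast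
    then obtain a where "e = {a}" by (rule singletonE)
    then have a: "{a} \<in> U" using e by simp
    then have "a \<in> V" using U by auto
    have all: "{b} \<in> U" if "b \<in> V" for b
      using second_opposite_2[OF one, of a b] a that \<open>a \<in> V\<close> by (cases "a = b") auto
    have "cobd V {{}} \<subseteq> U"
    proof
      fix \<rho> assume "\<rho> \<in> cobd V {{}}"
      then have "card \<rho> = 1" "\<rho> \<subseteq> V" using card_cobd[OF V, of "{{}}" 0] by auto
      then show "\<rho> \<in> U" using all by (auto simp: card_1_singleton_iff)
    qed
    moreover have "opposite {{}} {a} = {a}" by (auto simp: opposite_def)
    then have "{a} \<in> cobd V {{}}" using \<open>a \<in> V\<close> by (simp add: cobd_def)
    moreover have "cocycle V (cobd V {{}})" by (rule cocycle_cobd[OF V]) simp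
    ultimately show ?thesis by blast
  next
    case 3
    then obtain D where "D \<subseteq> U" "D \<noteq> {}" "cocycle V D"
      using cut_in_graph[OF V _ \<open>U \<noteq> {}\<close> one] U by metis
    then show ?thesis by blast
  qed
  then obtain D where "D \<subseteq> compl V T" "D \<noteq> {}" "cocycle V D" unfolding U_def by blast
  then show thesis using cycle_of_cocycle_in_compl[OF TV] that by metis
qed

lemma sum_card_apexes:
  assumes V: "finite V" and T: "T \<subseteq> ksubsets V (Suc m)"
  shows "(\<Sum>\<tau>\<in>ksubsets V m. card (apexes T \<tau>)) = Suc m * card T"
proof -
  have fin: "finite T" using finite_subset[OF T] V by simp
  have finT: "finite t" if "t \<in> T" for t using that T V finite_subset by blast
  have "(\<Sum>\<tau>\<in>ksubsets V m. card (apexes T \<tau>)) = (\<Sum>t\<in>T. card (opposite (ksubsets V m) t))"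
    by (rule sum_apexes_eq_sum_opposite) (use fin finT V in auto)
  also have "\<dots> = (\<Sum>t\<in>T. Suc m)"
  proof (rule sum.cong)
    fix t assume t: "t \<in> T"
    then have "t \<subseteq> V" "card t = Suc m" using T by auto
    then have "opposite (ksubsets V m) t = t" by (auto simp: opposite_def)
    then show "card (opposite (ksubsets V m) t) = Suc m" using \<open>card t = Suc m\<close> by simp
  qed simp
  finally show ?thesis by simp
qed

text \<open>As no degree is 1, every degree is at least 2 up to two corrections: odd degrees are at least 3,
  and degree 0 falls short by 2.\<close>

lemma degree_bound:
  assumes V: "finite V" and T: "T \<subseteq> ksubsets V (Suc m)" "no_free T"
  shows "2 * (card V choose m) + card (bd T)
    \<le> Suc m * card T + 2 * card {\<tau> \<in> ksubsets V m. apexes T \<tau> = {}}"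
proof -
  let ?P = "ksubsets V m"
  have fin: "finite ?P" using V by simp
  have fT: "finite T" using finite_subset[OF T(1)] V by simp
  have "bd T \<subseteq> ?P" by (rule bd_card[OF T(1) V])
  have "2 + (if \<tau> \<in> bd T then 1 else 0) \<le> card (apexes T \<tau>) + (if apexes T \<tau> = {} then 2 else 0)" for \<tau>
  proof -
    have "card (apexes T \<tau>) \<noteq> 1" using T by (simp add: no_free_def)
    moreover have "card (apexes T \<tau>) = 0 \<longleftrightarrow> apexes T \<tau> = {}" using finite_apexes[OF fT] by simp
    ultimately show ?thesis unfolding bd_def by (auto elim!: oddE)
  qed
  then have "(\<Sum>\<tau>\<in>?P. 2 + (if \<tau> \<in> bd T then 1 else 0))
      \<le> (\<Sum>\<tau>\<in>?P. card (apexes T \<tau>) + (if apexes T \<tau> = {} then 2 else 0))"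
    by (rule sum_mono)
  moreover have "(\<Sum>\<tau>\<in>?P. if \<tau> \<in> bd T then 1 else 0 :: nat) = card (bd T)"
    using fin \<open>bd T \<subseteq> ?P\<close> by (simp add: sum.If_cases Int_absorb1)
  moreover have "(\<Sum>\<tau>\<in>?P. if apexes T \<tau> = {} then 2 else 0 :: nat) = 2 * card {\<tau> \<in> ?P. apexes T \<tau> = {}}"
    using fin by (simp add: sum.If_cases Int_def conj_commute)
  moreover have "card ?P = card V choose m" using n_subsets[OF V] by simp
  ultimately show ?thesis
    using sum_card_apexes[OF V T(1)] by (simp only: sum.distrib) simp
qed

lemma no_free_restrict:
  assumes T: "no_free T" "T \<subseteq> Pow A \<union> Pow B" "A \<inter> B = {}" "apexes T {} = {}"
  shows "no_free (T \<inter> Pow A)"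
proof -
  have "card (apexes (T \<inter> Pow A) \<tau>) \<noteq> 1" for \<tau>
  proof (cases "\<tau> \<subseteq> A \<and> \<tau> \<noteq> {}")
    case True
    then obtain x where x: "x \<in> \<tau>" "x \<in> A" by auto
    have "insert v \<tau> \<in> Pow A" if "insert v \<tau> \<in> T" for v
    proof -
      have "insert v \<tau> \<in> Pow A \<or> insert v \<tau> \<in> Pow B" using that T(2) by blast
      moreover have "x \<notin> B" using x T(3) by blast
      ultimately show ?thesis using x by blast
    qed
    then have "apexes (T \<inter> Pow A) \<tau> = apexes T \<tau>" by (auto simp: apexes_def)
    then show ?thesis using T by (simp add: no_free_def)
  next
    case False
    then have "apexes (T \<inter> Pow A) \<tau> = {}" using T(4) by (auto simp: apexes_def)
    then show ?thesis by simp
  qed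
  then show ?thesis by (simp add: no_free_def)
qed

text \<open>A nonempty cocycle of singletons consists of all singletons, so the vertices of degree 0 contain
  none.\<close>

lemma cycle_in_graph:
  assumes V: "finite V" and T: "T \<subseteq> ksubsets V 2" "T \<noteq> {}" "no_free T"
  shows "\<exists>Z\<subseteq>T. Z \<noteq> {} \<and> bd Z = {}"
proof (rule ccontr)
  assume "\<not> ?thesis"
  then have X0: "bd Z \<noteq> {}" if "Z \<subseteq> T" "Z \<noteq> {}" for Z using that by blast
  define M where "M = {\<tau> \<in> ksubsets V 1. apexes T \<tau> = {}}"
  obtain e where e: "e \<in> T" using T(2) by blast
  then have "e \<in> ksubsets V 2" using T(1) by blast
  then obtain x y where ab: "e = {x, y}" "x \<noteq> y" by (rule pairE)
  then have xy: "{x, y} \<in> T" "x \<noteq> y" using e by simp_all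
  have xV: "x \<in> V" "y \<in> V" using xy T by auto
  have "y \<in> apexes T {x}" using xy by (simp add: apexes_def insert_commute)
  then have xM: "{x} \<notin> M" by (auto simp: M_def)
  have Y0: "\<not> cocycle V D" if D: "D \<subseteq> M" "D \<noteq> {}" for D
  proof
    assume co: "cocycle V D"
    obtain e where e: "e \<in> D" using D(2) by blast
    then have "e \<in> ksubsets V 1" using D(1) by (auto simp: M_def)
    then obtain v where "e = {v}" by (rule singletonE)
    then have v: "{v} \<in> D" using e by simp
    then have "v \<noteq> x" using D xM by auto
    have "v \<in> V" using v D by (auto simp: M_def)
    have "\<not> odd (card (opposite D {v, x}))"
      using co \<open>v \<in> V\<close> xV by (simp add: cocycle_def)
    then show False using odd_opposite_2[OF \<open>v \<noteq> x\<close>] v D xM by auto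
  qed
  have "card T + card M \<le> (card V - 1) choose 1"
    by (rule card_cycle_free_add_card_cocycle_free_le[OF V xV(1) _ _ _ X0 Y0])
       (use T in \<open>auto simp: M_def numeral_2_eq_2\<close>)
  moreover have "2 * (card V choose 1) + card (bd T) \<le> 2 * card T + 2 * card M"
    using degree_bound[OF V _ T(3), of 1] T(1) by (simp add: M_def numeral_2_eq_2)
  moreover have "0 < card V" using xV V by (auto simp: card_gt_0_iff)
  ultimately show False by simp
qed

text \<open>All pairs that cross the cut have degree 0, so every triple of \<open>T\<close> lies on one side.\<close>

lemma split_along_cut:
  assumes V: "finite V" and T: "T \<subseteq> ksubsets V 3" "T \<noteq> {}" "no_free T"
    and D: "D \<noteq> {}" "cocycle V D" "D \<subseteq> {\<tau> \<in> ksubsets V 2. apexes T \<tau> = {}}"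
  obtains V' where "V' \<subset> V" "T \<inter> Pow V' \<noteq> {}" "no_free (T \<inter> Pow V')"
proof -
  obtain e where e: "e \<in> D" using D(1) by blast
  then have "e \<in> ksubsets V 2" using D(3) by blast
  then obtain p q where ab: "e = {p, q}" "p \<noteq> q" by (rule pairE)
  then have pq: "{p, q} \<in> D" "p \<noteq> q" using e by simp_all
  have pqV: "p \<in> V" "q \<in> V" using pq D by auto
  define A where "A = {y \<in> V. {p, y} \<notin> D}"
  have "p \<in> A" using D pqV by (auto simp: A_def)
  have "q \<notin> A" using pq by (simp add: A_def)
  have AD: "{x, y} \<in> D" if "x \<in> A" "y \<in> V" "y \<notin> A" for x y
  proof (cases "x = p")
    case True then show ?thesis using that by (auto simp: A_def)
  next
    case False
    have "p \<noteq> y" "x \<noteq> y" "x \<in> V" using that \<open>p \<in> A\<close> by (auto simp: A_def)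
    then have "\<not> odd (card (opposite D {p, x, y}))"
      using D(2) that pqV by (simp add: cocycle_def)
    then have "\<not> (({p, x} \<in> D) \<noteq> (({p, y} \<in> D) \<noteq> ({x, y} \<in> D)))"
      using odd_opposite_3[of p x y D] False \<open>p \<noteq> y\<close> \<open>x \<noteq> y\<close> by metis
    then show ?thesis using that by (auto simp: A_def)
  qed
  have sub: "T \<subseteq> Pow A \<union> Pow (V - A)"
  proof
    fix t assume t: "t \<in> T"
    show "t \<in> Pow A \<union> Pow (V - A)"
    proof (rule ccontr)
      assume "\<not> ?thesis"
      moreover have "t \<subseteq> V" "card t = 3" using t T by auto
      ultimately obtain x y where xy: "x \<in> t" "x \<in> A" "y \<in> t" "y \<notin> A" "y \<in> V" by blast
      have "x \<noteq> y" using xy by auto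
      have "\<not> t \<subseteq> {x, y}"
      proof
        assume "t \<subseteq> {x, y}"
        then have "card t \<le> card {x, y}" by (intro card_mono) auto
        then show False using \<open>card t = 3\<close> \<open>x \<noteq> y\<close> by simp
      qed
      then obtain z where z: "z \<in> t" "z \<noteq> x" "z \<noteq> y" by blast
      have "card {x, y, z} = card t" using z \<open>x \<noteq> y\<close> \<open>card t = 3\<close> by simp
      then have "t = {z, x, y}"
        using card_subset_eq[of t "{x, y, z}"] xy z \<open>t \<subseteq> V\<close> V finite_subset by blast
      then have "z \<in> apexes T {x, y}" using t z by (auto simp: apexes_def)
      then show False using AD[OF xy(2,5,4)] D(3) by blast
    qed
  qed
  have ap: "apexes T {} = {}" using T(1) by (auto simp: apexes_def)
  have nf: "no_free (T \<inter> Pow A)" "no_free (T \<inter> Pow (V - A))"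
    using no_free_restrict[OF T(3) sub _ ap] no_free_restrict[OF T(3), of "V - A" A] sub ap
    by (auto simp: Un_commute)
  have "A \<subset> V" "V - A \<subset> V" using \<open>p \<in> A\<close> \<open>q \<notin> A\<close> pqV unfolding A_def by blast+
  moreover have "T \<inter> Pow A \<noteq> {} \<or> T \<inter> Pow (V - A) \<noteq> {}" using sub T(2) by blast
  ultimately show thesis using that nf by blast
qed

text \<open>A cut among the pairs of degree 0 leads to at most five vertices. Without such a cut
  \<open>|T| + |M| \<le> 10\<close>, and the degree bound \<open>30 + |bd T| \<le> 3 |T| + 2 |M|\<close> makes \<open>T\<close> itself a cycle.\<close>

lemma cycle_in_dim_2_six_vertices:
  assumes "finite V" "T \<subseteq> ksubsets V 3" "T \<noteq> {}" "no_free T" "card V \<le> 6"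
  shows "\<exists>Z\<subseteq>T. Z \<noteq> {} \<and> bd Z = {}"
proof (cases "card V \<le> 5")
  case True
  have "T \<subseteq> ksubsets V (Suc 2)" "card V \<le> 2 + 3" using assms(2) True by auto
  then show ?thesis
    using cycle_if_few_vertices[OF assms(1) _ assms(3,4), of 2] by metis
next
  case False
  note V = assms(1) and T = assms(2-4)
  show ?thesis
  proof (rule ccontr)
    assume no: "\<not> ?thesis"
    then have X0: "bd Z \<noteq> {}" if "Z \<subseteq> T" "Z \<noteq> {}" for Z using that by blast
    define M where "M = {\<tau> \<in> ksubsets V 2. apexes T \<tau> = {}}"
    have Y0: "\<not> cocycle V D" if D: "D \<subseteq> M" "D \<noteq> {}" for D
    proof
      assume "cocycle V D"
      then obtain V' where V': "V' \<subset> V" "T \<inter> Pow V' \<noteq> {}" "no_free (T \<inter> Pow V')"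
        using split_along_cut[OF V T D(2)] D(1) unfolding M_def by metis
      have "card V' < card V" using V' V psubset_card_mono by blast
      then have "card V' \<le> 2 + 3" using assms by simp
      moreover have "T \<inter> Pow V' \<subseteq> ksubsets V' (Suc 2)" using T by auto
      moreover have "finite V'" using V' V finite_subset by blast
      ultimately obtain Z where "Z \<subseteq> T \<inter> Pow V'" "Z \<noteq> {}" "bd Z = {}"
        using cycle_if_few_vertices V'(2,3) by metis
      then show False using no by blast
    qed
    obtain v where "v \<in> V" using False by fastforce
    have c6: "card V = 6" using False assms by simp
    have "card T + card M \<le> (card V - 1) choose 2"
      by (rule card_cycle_free_add_card_cocycle_free_le[OF V \<open>v \<in> V\<close> _ _ _ X0 Y0])
         (use T in \<open>auto simp: M_def eval_nat_numeral\<close>)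
    then have 1: "card T + card M \<le> 10" using c6 by (simp add: eval_nat_numeral)
    have "2 * (card V choose 2) + card (bd T) \<le> 3 * card T + 2 * card M"
      using degree_bound[OF V _ T(3), of 2] T(1) by (simp add: M_def eval_nat_numeral)
    then have "30 + card (bd T) \<le> 3 * card T + 2 * card M" using c6 by (simp add: choose_two)
    then have "card (bd T) = 0" using 1 by simp
    moreover have "finite T" using finite_subset[OF T(1)] V by simp
    then have "finite (bd T)" by (rule finite_bd) (use T V finite_subset in blast)
    ultimately show False using X0[of T] T by simp
  qed
qed

lemma second_apex:
  assumes "finite G" "bd G = {}" "v \<in> apexes G \<tau>"
  obtains w where "w \<in> apexes G \<tau>" "w \<noteq> v"
proof -
  have "even (card (apexes G \<tau>))" using assms(2) by (auto simp: bd_def)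
  then have "apexes G \<tau> \<noteq> {v}" by auto
  then show thesis using assms(3) that by blast
qed

lemma cycle_with_at_most_3_edges:
  assumes G: "finite G" "G \<noteq> {}" "G \<subseteq> ksubsets V 2" "bd G = {}" "card G \<le> 3"
  obtains a b c where "a \<noteq> b" "a \<noteq> c" "b \<noteq> c" "G = {{a, b}, {a, c}, {b, c}}"
proof -
  obtain e where e: "e \<in> G" using G(2) by blast
  then have "e \<in> ksubsets V 2" using G(3) by blast
  then obtain a b where ab: "e = {a, b}" "a \<noteq> b" by (rule pairE)
  then have ab: "{a, b} \<in> G" "a \<noteq> b" using e by simp_all
  have next_edge: "\<exists>w. w \<noteq> v \<and> w \<noteq> u \<and> {u, w} \<in> G" if uv: "{u, v} \<in> G" "u \<noteq> v" for u v
  proof -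
    have "v \<in> apexes G {u}" using uv by (simp add: apexes_def insert_commute)
    then obtain w where "w \<in> apexes G {u}" "w \<noteq> v" using second_apex[OF G(1,4)] by metis
    then show ?thesis by (auto simp: apexes_def insert_commute)
  qed
  obtain c where c: "c \<noteq> b" "c \<noteq> a" "{a, c} \<in> G" using next_edge[OF ab] by blast
  have ba: "{b, a} \<in> G" using ab by (simp add: insert_commute)
  obtain x where x: "x \<noteq> a" "x \<noteq> b" "{b, x} \<in> G" using next_edge[OF ba] ab by blast
  have "x = c"
  proof (rule ccontr)
    assume "x \<noteq> c"
    have xb: "{x, b} \<in> G" using x by (simp add: insert_commute)
    obtain y where y: "y \<noteq> b" "y \<noteq> x" "{x, y} \<in> G" using next_edge[OF xb] x by blast
    have "card {{a, b}, {a, c}, {b, x}, {x, y}} = 4"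
      using ab c x y \<open>x \<noteq> c\<close> by (simp add: doubleton_eq_iff)
    moreover have "card {{a, b}, {a, c}, {b, x}, {x, y}} \<le> card G"
      by (rule card_mono[OF G(1)]) (use ab c x y in auto)
    ultimately show False using G(5) by simp
  qed
  then have sub: "{{a, b}, {a, c}, {b, c}} \<subseteq> G" using ab c x by auto
  have "card {{a, b}, {a, c}, {b, c}} = 3" using ab c by (simp add: doubleton_eq_iff)
  then have "G = {{a, b}, {a, c}, {b, c}}"
    using card_seteq[OF G(1) sub] G(5) by simp
  then show thesis using that ab c by metis
qed

text \<open>Cuts are excluded as before. Then \<open>|T| + |M| \<le> 15\<close> and \<open>42 + |bd T| \<le> 3 |T| + 2 |M|\<close> give
  \<open>|bd T| + |M| \<le> 3\<close>. As \<open>bd T\<close> is a nonempty cycle of edges, it is a triangle on some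
  \<open>S = {a, b, c}\<close>; its edges have degree 3 and all other pairs degree 2. Counting pairs inside \<open>S\<close>
  and inside the remaining four-set \<open>R\<close> shows that exactly three triples of \<open>R\<close> are in \<open>T\<close>. They share
  a point \<open>d\<close> and exhaust the degrees of the pairs \<open>{d, x}\<close> with \<open>x \<in> R\<close>, so in the link of \<open>d\<close> they
  form a component. Hence every triple in \<open>T\<close> contains an even number of these pairs, whereas the
  cycle on \<open>d\<close>, a point of \<open>R\<close> and a point of \<open>S\<close> contains just one.\<close>

lemma cycle_in_dim_2_seven_vertices:
  assumes V: "finite V" "card V = 7" and T: "T \<subseteq> ksubsets V 3" "T \<noteq> {}" "no_free T"
    and H1: "\<And>x y z. x \<noteq> y \<Longrightarrow> x \<noteq> z \<Longrightarrow> y \<noteq> z \<Longrightarrow>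
      apexes T {x, y} \<noteq> {} \<Longrightarrow> apexes T {x, z} \<noteq> {} \<Longrightarrow> apexes T {y, z} \<noteq> {} \<Longrightarrow>
      \<exists>W\<subseteq>T. bd W = {{x, y}, {x, z}, {y, z}}"
  shows "\<exists>Z\<subseteq>T. Z \<noteq> {} \<and> bd Z = {}"
proof (rule ccontr)
  assume no: "\<not> ?thesis"
  then have X0: "bd Z \<noteq> {}" if "Z \<subseteq> T" "Z \<noteq> {}" for Z using that by blast
  define M where "M = {\<tau> \<in> ksubsets V 2. apexes T \<tau> = {}}"
  have finT: "finite T" using finite_subset[OF T(1)] V by simp
  have fint: "finite t" if "t \<in> T" for t using that T V finite_subset by blast
  have Y0: "\<not> cocycle V D" if D: "D \<subseteq> M" "D \<noteq> {}" for D
  proof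
    assume "cocycle V D"
    then obtain V' where V': "V' \<subset> V" "T \<inter> Pow V' \<noteq> {}" "no_free (T \<inter> Pow V')"
      using split_along_cut[OF V(1) T D(2)] D(1) unfolding M_def by metis
    have "card V' \<le> 6" using V' V psubset_card_mono[of V V'] by simp
    moreover have "T \<inter> Pow V' \<subseteq> ksubsets V' 3" using T by auto
    moreover have "finite V'" using V' V finite_subset by blast
    ultimately obtain Z where "Z \<subseteq> T \<inter> Pow V'" "Z \<noteq> {}" "bd Z = {}"
      using cycle_in_dim_2_six_vertices[of V' "T \<inter> Pow V'"] V'(2,3) by blast
    then show False using no by blast
  qed
  obtain v0 where "v0 \<in> V" using V by fastforce
  have "card T + card M \<le> (card V - 1) choose 2"
    by (rule card_cycle_free_add_card_cocycle_free_le[OF V(1) \<open>v0 \<in> V\<close> _ _ _ X0 Y0])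
       (use T in \<open>auto simp: M_def eval_nat_numeral\<close>)
  then have 1: "card T + card M \<le> 15" using V by (simp add: eval_nat_numeral)
  have "2 * (card V choose 2) + card (bd T) \<le> 3 * card T + 2 * card M"
    using degree_bound[OF V(1) _ T(3), of 2] T(1) by (simp add: M_def eval_nat_numeral)
  then have 2: "42 + card (bd T) \<le> 3 * card T + 2 * card M" using V by (simp add: choose_two)
  have bd2: "bd T \<subseteq> ksubsets V 2"
    using bd_card[OF _ V(1), of T 2] T(1) by (simp add: eval_nat_numeral)
  have finO: "finite (bd T)" using finite_bd[OF finT fint] by simp
  have "bd (bd T) = {}" using bd_bd[OF finT fint] by simp
  moreover have "bd T \<noteq> {}" using X0[of T] T by simp
  moreover have "card (bd T) \<le> 3" using 1 2 by simp
  ultimately obtain a b c where abc: "a \<noteq> b" "a \<noteq> c" "b \<noteq> c" and O: "bd T = {{a, b}, {a, c}, {b, c}}"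
    using cycle_with_at_most_3_edges[OF finO _ bd2] by metis
  have "card (bd T) = 3" using abc by (simp add: O doubleton_eq_iff)
  then have "card M = 0" and cT: "card T = 15" using 1 2 by auto
  then have "M = {}" using V by (simp add: M_def)
  have deg: "card (apexes T \<tau>) = (if \<tau> \<in> bd T then 3 else 2)" if "\<tau> \<in> ksubsets V 2" for \<tau>
  proof -
    have fP: "finite (ksubsets V 2)" using V by simp
    have cP: "card (ksubsets V 2) = 21" using n_subsets[OF V(1), of 2] V by (simp add: choose_two)
    have "(\<Sum>\<tau>\<in>ksubsets V 2. if \<tau> \<in> bd T then 1 else 0 :: nat) = 3"
      using fP bd2 \<open>card (bd T) = 3\<close> by (simp add: sum.If_cases Int_absorb1)
    then have "(\<Sum>\<tau>\<in>ksubsets V 2. 2 + (if \<tau> \<in> bd T then 1 else 0 :: nat)) = 2 * 21 + 3"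
      using cP by (simp only: sum.distrib) simp
    also have "\<dots> = (\<Sum>\<tau>\<in>ksubsets V 2. card (apexes T \<tau>))"
      using sum_card_apexes[OF V(1), of T 2] T(1) cT by (simp add: eval_nat_numeral)
    finally have eq: "(\<Sum>\<tau>\<in>ksubsets V 2. 2 + (if \<tau> \<in> bd T then 1 else 0)) = (\<Sum>\<tau>\<in>ksubsets V 2. card (apexes T \<tau>))" .
    have le: "2 + (if \<tau> \<in> bd T then 1 else 0) \<le> card (apexes T \<tau>)" if "\<tau> \<in> ksubsets V 2" for \<tau>
    proof -
      have "apexes T \<tau> \<noteq> {}" using that \<open>M = {}\<close> by (auto simp: M_def)
      then have "card (apexes T \<tau>) \<noteq> 0" using finite_apexes[OF finT] by simp
      moreover have "card (apexes T \<tau>) \<noteq> 1" using T by (simp add: no_free_def)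
      ultimately show ?thesis unfolding bd_def by (auto elim!: oddE)
    qed
    have "2 + (if \<tau> \<in> bd T then 1 else 0) = card (apexes T \<tau>)"
      by (rule sum_mono_inv[OF eq le that fP])
    then show ?thesis by auto
  qed
  define S where "S = {a, b, c}"
  define R where "R = V - S"
  have SV: "S \<subseteq> V" using bd2 by (auto simp: O S_def)
  have cS: "card S = 3" using abc by (simp add: S_def)
  have cR: "card R = 4" using V SV cS finite_subset[OF SV V(1)] by (simp add: R_def card_Diff_subset)
  have finR: "finite R" using V by (simp add: R_def)
  have SnT: "S \<notin> T"
  proof
    assume "S \<in> T"
    have "bd {S} = bd T" using abc by (auto simp: bd_singleton S_def O insert_Diff_if insert_commute)
    moreover have "bd (sym_diff T {S}) = sym_diff (bd T) (bd {S})" by (rule bd_sym_diff[OF finT]) simp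
    moreover have "sym_diff T {S} = T - {S}" using \<open>S \<in> T\<close> by auto
    ultimately have "bd (T - {S}) = {}" by simp
    moreover have "card (T - {S}) = 14" using cT finT \<open>S \<in> T\<close> by simp
    then have "T - {S} \<noteq> {}" by (metis card.empty zero_neq_numeral)
    ultimately show False using X0[of "T - {S}"] by blast
  qed
  have bd_in_S: "\<tau> \<in> bd T \<longleftrightarrow> \<tau> \<subseteq> S" if \<tau>: "card \<tau> = 2" for \<tau>
  proof
    assume "\<tau> \<subseteq> S"
    moreover obtain x y where "\<tau> = {x, y}" "x \<noteq> y" using \<tau> by (auto simp: card_2_iff)
    ultimately show "\<tau> \<in> bd T" by (auto simp: S_def O insert_commute)
  qed (auto simp: S_def O)
  \<comment> \<open>A triple other than \<open>S\<close> has exactly one pair inside \<open>S\<close> or inside \<open>R\<close>, and two more if it is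
    contained in \<open>R\<close>; the degrees of all pairs inside \<open>S\<close> and \<open>R\<close> sum to \<open>9 + 12 = 21\<close>.\<close>
  have t0: "card (T \<inter> Pow R) = 3"
  proof -
    have sum: "(\<Sum>\<tau>\<in>ksubsets X 2. card (apexes T \<tau>)) = (\<Sum>t\<in>T. card (opposite (ksubsets X 2) t))"
      if "finite X" for X
      by (rule sum_apexes_eq_sum_opposite) (use finT fint that in auto)
    have "(\<Sum>\<tau>\<in>ksubsets S 2. card (apexes T \<tau>)) = (\<Sum>\<tau>\<in>ksubsets S 2. 3)"
      by (rule sum.cong) (use deg bd_in_S SV in auto)
    also have "\<dots> = 9" using n_subsets[of S 2] cS by (simp add: choose_two S_def)
    finally have S9: "(\<Sum>t\<in>T. card (opposite (ksubsets S 2) t)) = 9" using sum[of S] by (simp add: S_def)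
    have "(\<Sum>\<tau>\<in>ksubsets R 2. card (apexes T \<tau>)) = (\<Sum>\<tau>\<in>ksubsets R 2. 2)"
    proof (rule sum.cong)
      fix \<tau> assume \<tau>: "\<tau> \<in> ksubsets R 2"
      then have "\<tau> \<noteq> {}" by auto
      then have "\<not> \<tau> \<subseteq> S" using \<tau> by (auto simp: R_def)
      then show "card (apexes T \<tau>) = 2" using deg[of \<tau>] \<tau> bd_in_S by (auto simp: R_def)
    qed simp
    also have "\<dots> = 12" using n_subsets[of R 2] cR finR by (simp add: choose_two)
    finally have R12: "(\<Sum>t\<in>T. card (opposite (ksubsets R 2) t)) = 12" using sum[OF finR] by simp
    have pt: "card (opposite (ksubsets R 2) t) + card (opposite (ksubsets S 2) t) = 1 + (if t \<in> Pow R then 2 else 0)"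
      if "t \<in> T" for t
    proof -
      have "t \<subseteq> V" "card t = 3" "t \<noteq> S" using that T SnT by auto
      then obtain x y z where t: "t = {x, y, z}" "x \<noteq> y" "x \<noteq> z" "y \<noteq> z"
        by (auto simp: card_3_iff)
      have R: "w \<in> R \<longleftrightarrow> w \<notin> S" if "w \<in> t" for w using that \<open>t \<subseteq> V\<close> by (auto simp: R_def)
      have "\<not> t \<subseteq> S" using card_subset_eq[of S t] \<open>t \<noteq> S\<close> \<open>card t = 3\<close> cS by (auto simp: S_def)
      then show ?thesis
        using R[of x] R[of y] R[of z] t(2-4) unfolding t(1)
        by (simp add: opposite_3)
    qed
    have "(\<Sum>t\<in>T. 1 + (if t \<in> Pow R then 2 else 0)) =
        (\<Sum>t\<in>T. card (opposite (ksubsets R 2) t) + card (opposite (ksubsets S 2) t))"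
      by (rule sum.cong) (use pt in auto)
    also have "\<dots> = 21" using S9 R12 by (simp add: sum.distrib)
    finally have "(\<Sum>t\<in>T. 1) + (\<Sum>t\<in>T. if t \<in> Pow R then 2 else 0) = (21 :: nat)"
      by (simp only: sum.distrib)
    moreover have "(\<Sum>t\<in>T. if t \<in> Pow R then 2 else 0 :: nat) = 2 * card (T \<inter> Pow R)"
      using finT by (simp add: sum.If_cases Pow_def)
    ultimately have "card T + 2 * card (T \<inter> Pow R) = 21" by simp
    then show ?thesis using cT by simp
  qed
  have "card (ksubsets R 3) = 4" using n_subsets[OF finR, of 3] cR by (simp add: eval_nat_numeral)
  moreover have "T \<inter> Pow R \<subseteq> ksubsets R 3" using T by auto
  ultimately have "card (ksubsets R 3 - (T \<inter> Pow R)) = 1"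
    using t0 finR finT by (simp add: card_Diff_subset)
  then obtain t where t: "ksubsets R 3 - (T \<inter> Pow R) = {t}" by (auto simp: card_1_singleton_iff)
  then have "t \<subseteq> R" "card t = 3" by auto
  then have "card (R - t) = 1" using cR finR by (simp add: card_Diff_subset finite_subset)
  then obtain d where d: "R - t = {d}" by (auto simp: card_1_singleton_iff)
  have "d \<in> R" "d \<notin> t" using d by auto
  have inT: "s \<in> T" if "s \<in> ksubsets R 3" "d \<in> s" for s
    using that t \<open>d \<notin> t\<close> by blast
  have ap: "apexes T {d, e} = R - {d, e}" if e: "e \<in> R" "e \<noteq> d" for e
  proof -
    have pair: "{d, e} \<in> ksubsets V 2" using e \<open>d \<in> R\<close> by (auto simp: R_def)
    moreover have "{d, e} \<notin> bd T" using bd_in_S[of "{d, e}"] e \<open>d \<in> R\<close> by (auto simp: R_def)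
    ultimately have c2: "card (apexes T {d, e}) = 2" using deg by simp
    have "R - {d, e} \<subseteq> apexes T {d, e}"
    proof
      fix v assume v: "v \<in> R - {d, e}"
      have "card {v, d, e} = 3" using v e by auto
      then have "{v, d, e} \<in> T" using v e \<open>d \<in> R\<close> by (intro inT) auto
      then show "v \<in> apexes T {d, e}" using v by (auto simp: apexes_def)
    qed
    moreover have "card (R - {d, e}) = 2" using cR finR e \<open>d \<in> R\<close> by simp
    ultimately show ?thesis
      using card_subset_eq[OF finite_apexes[OF finT]] c2 by metis
  qed
  have "t \<noteq> {}" using \<open>card t = 3\<close> by auto
  then obtain e where e: "e \<in> R" "e \<noteq> d" using \<open>t \<subseteq> R\<close> \<open>d \<notin> t\<close> by blast
  have aS: "a \<in> S" "a \<notin> R" "a \<in> V" using SV by (auto simp: S_def R_def)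
  have ne: "apexes T {x, y} \<noteq> {}" if "x \<in> V" "y \<in> V" "x \<noteq> y" for x y
    using \<open>M = {}\<close> that by (auto simp: M_def)
  have deV: "d \<in> V" "e \<in> V" "d \<noteq> a" "e \<noteq> a" using \<open>d \<in> R\<close> e aS by (auto simp: R_def)
  then obtain W where W: "W \<subseteq> T" "bd W = {{d, e}, {d, a}, {e, a}}"
    using H1[of d e a] ne e aS by metis
  \<comment> \<open>A triple of \<open>T\<close> through one of these pairs lies in \<open>R\<close>, so it contains a second one.\<close>
  define D where "D = (\<lambda>x. {d, x}) ` (R - {d})"
  have "(\<Sum>\<tau>\<in>D. card (apexes W \<tau>)) = (\<Sum>w\<in>W. card (opposite D w))"
    by (rule sum_apexes_eq_sum_opposite) (use W finT fint finR finite_subset in \<open>auto simp: D_def\<close>)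
  moreover have "even (\<Sum>w\<in>W. card (opposite D w))"
  proof (rule dvd_sum)
    fix w assume w: "w \<in> W"
    show "even (card (opposite D w))"
    proof (cases "opposite D w = {}")
      case False
      then obtain v x where v: "v \<in> w" "w - {v} = {d, x}" "x \<in> R" "x \<noteq> d"
        by (auto simp: opposite_def D_def)
      have wv: "w = {v, d, x}" and "v \<noteq> d" "v \<noteq> x" using v by blast+
      then have "v \<in> apexes T {d, x}" using w W by (auto simp: apexes_def)
      then have "v \<in> R" using ap[OF v(3,4)] by blast
      then have "{d, x} \<in> D" "{v, d} \<in> D" using v(3,4) \<open>v \<noteq> d\<close> by (auto simp: D_def insert_commute)
      moreover have "{v, x} \<notin> D" using \<open>v \<noteq> d\<close> v(4) by (auto simp: D_def doubleton_eq_iff)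
      ultimately have "opposite D w = {v, x}"
        unfolding wv using \<open>v \<noteq> d\<close> \<open>v \<noteq> x\<close> v(4) by (subst opposite_3) auto
      then show ?thesis using \<open>v \<noteq> x\<close> by simp
    qed simp
  qed
  moreover have "{\<tau> \<in> D. odd (card (apexes W \<tau>))} = {{d, e}}"
  proof -
    have "\<tau> \<in> D \<and> \<tau> \<in> bd W \<longleftrightarrow> \<tau> = {d, e}" for \<tau>
      unfolding W(2) using e aS deV by (auto simp: D_def doubleton_eq_iff)
    then show ?thesis by (auto simp: bd_def)
  qed
  moreover have "even (\<Sum>\<tau>\<in>D. card (apexes W \<tau>)) \<longleftrightarrow> even (card {\<tau> \<in> D. odd (card (apexes W \<tau>))})"
    by (rule even_sum_iff) (simp add: D_def finR)
  ultimately show False by simp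
qed

section \<open>Triples on seven points\<close>

text \<open>The members of \<open>U\<close> are the complements of the tetrahedra of a three-dimensional complex on
  seven vertices without free faces and without 3-cycles. The goal is a contradiction.\<close>

locale triples_on_seven_points =
  fixes V :: "'a set" and U :: "'a set set"
  assumes V: "finite V" "card V = 7"
    and U: "U \<subseteq> ksubsets V 3" "U \<noteq> {}"
    and one: "\<And>Q. Q \<subseteq> V \<Longrightarrow> card (opposite U Q) \<noteq> 1"
    and no_co: "\<And>D. D \<subseteq> U \<Longrightarrow> D \<noteq> {} \<Longrightarrow> \<not> cocycle V D"
begin

lemma second:
  assumes "w \<in> V" "{x, y, z} \<in> U" "x \<noteq> y" "x \<noteq> z" "y \<noteq> z" "w \<noteq> x" "w \<noteq> y" "w \<noteq> z"
  shows "{w, x, y} \<in> U \<or> {w, x, z} \<in> U \<or> {w, y, z} \<in> U"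
proof -
  have "{w, x, y, z} \<subseteq> V" using assms(1,2) U by blast
  from second_opposite_4[OF one[OF this]] show ?thesis using assms by blast
qed

lemma mem_cobd_pairs:
  assumes "x \<in> V" "y \<in> V" "z \<in> V" "x \<noteq> y" "x \<noteq> z" "y \<noteq> z"
  shows "{x, y, z} \<in> cobd V \<Gamma> \<longleftrightarrow> (({x, y} \<in> \<Gamma>) \<noteq> (({x, z} \<in> \<Gamma>) \<noteq> ({y, z} \<in> \<Gamma>)))"
  using odd_opposite_3[OF assms(4-6), of \<Gamma>] assms(1-3) by (simp add: cobd_def)

lemma triple_cases:
  assumes "t \<in> ksubsets V 3"
  obtains x y z where "t = {x, y, z}" "x \<noteq> y" "x \<noteq> z" "y \<noteq> z" "x \<in> V" "y \<in> V" "z \<in> V"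
proof -
  have "card t = 3" "t \<subseteq> V" using assms by auto
  then obtain x y z where "t = {x, y, z}" "x \<noteq> y" "x \<noteq> z" "y \<noteq> z" by (auto simp: card_3_iff)
  then show thesis using that \<open>t \<subseteq> V\<close> by blast
qed

lemma not_cobd:
  assumes "\<Gamma> \<subseteq> ksubsets V 2" "cobd V \<Gamma> \<subseteq> U"
  shows "cobd V \<Gamma> = {}"
  using no_co[OF assms(2)] cocycle_cobd[OF V(1), of \<Gamma>] assms(1) by blast

text \<open>Let \<open>\<Gamma>\<close> be the graph of pairs that form a triple of \<open>U\<close> with \<open>v\<close>, and consider its coboundary.
  Its triples through \<open>v\<close> are in \<open>U\<close> by definition; a triple with exactly one edge of \<open>\<Gamma>\<close> is in \<open>U\<close>
  because the four-set that it spans with \<open>v\<close> contains another triple of \<open>U\<close>. Only a triangle of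
  \<open>\<Gamma>\<close> can keep the coboundary from being a cocycle inside \<open>U\<close>.\<close>

lemma tripod:
  assumes v: "v \<in> V"
  obtains x y z where "distinct [v, x, y, z]" "x \<in> V" "y \<in> V" "z \<in> V"
    "{v, x, y} \<in> U" "{v, x, z} \<in> U" "{v, y, z} \<in> U" "{x, y, z} \<notin> U"
proof (rule ccontr)
  assume "\<not> thesis"
  then have full: "{x, y, z} \<in> U" if "distinct [v, x, y, z]" "x \<in> V" "y \<in> V" "z \<in> V"
    "{v, x, y} \<in> U" "{v, x, z} \<in> U" "{v, y, z} \<in> U" for x y z
    using \<open>\<And>x y z. \<lbrakk>distinct [v, x, y, z]; x \<in> V; y \<in> V; z \<in> V; {v, x, y} \<in> U;
      {v, x, z} \<in> U; {v, y, z} \<in> U; {x, y, z} \<notin> U\<rbrakk> \<Longrightarrow> thesis\<close> that by blast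
  define \<Gamma> where "\<Gamma> = {e \<in> ksubsets V 2. v \<notin> e \<and> insert v e \<in> U}"
  have \<Gamma>: "{x, y} \<in> \<Gamma> \<longleftrightarrow> v \<noteq> x \<and> v \<noteq> y \<and> {v, x, y} \<in> U" if "x \<in> V" "y \<in> V" "x \<noteq> y" for x y
    using that by (auto simp: \<Gamma>_def)
  have sub: "cobd V \<Gamma> \<subseteq> U"
  proof
    fix t assume t: "t \<in> cobd V \<Gamma>"
    have "cobd V \<Gamma> \<subseteq> ksubsets V (Suc 2)" by (rule card_cobd[OF V(1)]) (auto simp: \<Gamma>_def)
    then have "t \<in> ksubsets V 3" using t by auto
    then obtain x y z where xyz: "t = {x, y, z}" "x \<noteq> y" "x \<noteq> z" "y \<noteq> z" "x \<in> V" "y \<in> V" "z \<in> V"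
      by (rule triple_cases)
    have odd: "({x, y} \<in> \<Gamma>) \<noteq> (({x, z} \<in> \<Gamma>) \<noteq> ({y, z} \<in> \<Gamma>))"
      using t mem_cobd_pairs[OF xyz(5-7,2-4)] xyz(1) by simp
    show "t \<in> U"
    proof (cases "v \<in> t")
      case True
      then show ?thesis
        using odd \<Gamma> xyz by (auto simp: insert_commute)
    next
      case False
      then have v': "v \<noteq> x" "v \<noteq> y" "v \<noteq> z" using xyz by auto
      then have \<Gamma>': "{x, y} \<in> \<Gamma> \<longleftrightarrow> {v, x, y} \<in> U" "{x, z} \<in> \<Gamma> \<longleftrightarrow> {v, x, z} \<in> U" "{y, z} \<in> \<Gamma> \<longleftrightarrow> {v, y, z} \<in> U"
        using \<Gamma> xyz by auto
      have "{x, y, z} \<in> U"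
      proof (rule ccontr)
        assume no: "{x, y, z} \<notin> U"
        then have "\<not> ({v, x, y} \<in> U \<and> {v, x, z} \<in> U \<and> {v, y, z} \<in> U)"
          using full[of x y z] xyz v' by auto
        then consider "{v, x, y} \<in> U" "{v, x, z} \<notin> U" "{v, y, z} \<notin> U"
          | "{v, x, y} \<notin> U" "{v, x, z} \<in> U" "{v, y, z} \<notin> U"
          | "{v, x, y} \<notin> U" "{v, x, z} \<notin> U" "{v, y, z} \<in> U"
          using odd unfolding \<Gamma>' by blast
        then show False
        proof cases
          case 1
          then show ?thesis using second[OF xyz(7) 1(1)] no xyz v' by (auto simp: insert_commute)
        next
          case 2
          then show ?thesis using second[OF xyz(6) 2(2)] no xyz v' by (auto simp: insert_commute)
        next
          case 3
          then show ?thesis using second[OF xyz(5) 3(3)] no xyz v' by (auto simp: insert_commute)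
        qed
      qed
      then show ?thesis using xyz by simp
    qed
  qed
  have empty: "cobd V \<Gamma> = {}" by (rule not_cobd[OF _ sub]) (auto simp: \<Gamma>_def)
  have noedge: "{v, x, y} \<notin> U" if "x \<in> V" "y \<in> V" "x \<noteq> y" "v \<noteq> x" "v \<noteq> y" for x y
  proof
    assume xy: "{v, x, y} \<in> U"
    have "{x, y} \<in> \<Gamma>" "{v, x} \<notin> \<Gamma>" "{v, y} \<notin> \<Gamma>" using \<Gamma> that xy by (auto simp: \<Gamma>_def)
    then have "{v, x, y} \<in> cobd V \<Gamma>" using mem_cobd_pairs[of v x y \<Gamma>] that v by simp
    then show False using empty by simp
  qed
  obtain u where u: "u \<in> U" using U by auto
  then have "u \<in> ksubsets V 3" using U by blast
  then obtain x y z where xyz: "u = {x, y, z}" "x \<noteq> y" "x \<noteq> z" "y \<noteq> z" "x \<in> V" "y \<in> V" "z \<in> V"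
    by (rule triple_cases)
  have "v \<notin> u"
  proof
    assume "v \<in> u"
    then show False using noedge[of x y] noedge[of x z] noedge[of y z] u xyz by (auto simp: insert_commute)
  qed
  then show False using second[OF v, of x y z] u xyz noedge by auto
qed

text \<open>Dually: every two vertices of the complex are joined by an edge that lies in a tetrahedron.
  Suppose every member of \<open>U\<close> meets \<open>{v, b}\<close>, and let \<open>A\<close> be the set of the other five points. For
  fixed \<open>c \<in> {v, b}\<close> the pairs of \<open>A\<close> completing \<open>c\<close> to a member of \<open>U\<close> form a complete
  multipartite graph. Joining \<open>b\<close> to a union \<open>P\<close> of classes of one graph and \<open>v\<close> to a union \<open>Q\<close> of
  classes of the other gives a graph whose coboundary is contained in \<open>U\<close> as soon as
  \<open>{v, b, x} \<in> U\<close> for every \<open>x\<close> in exactly one of \<open>P\<close> and \<open>Q\<close>. So such \<open>P\<close> and \<open>Q\<close> are equal, and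
  empty or all of \<open>A\<close>. If \<open>{v, b, z} \<notin> U\<close> for some \<open>z\<close>, the two classes of \<open>z\<close> satisfy the
  condition; they would both be \<open>A\<close>, and then \<open>U\<close> would be empty. If there is no such \<open>z\<close>, any class
  \<open>P\<close> with \<open>Q = {}\<close> satisfies the condition.\<close>

lemma disjoint_member:
  assumes vb: "v \<in> V" "b \<in> V" "v \<noteq> b"
  obtains u where "u \<in> U" "v \<notin> u" "b \<notin> u"
proof (rule ccontr)
  assume "\<not> thesis"
  then have meet: "v \<in> u \<or> b \<in> u" if "u \<in> U" for u
    using \<open>\<And>u. \<lbrakk>u \<in> U; v \<notin> u; b \<notin> u\<rbrakk> \<Longrightarrow> thesis\<close> that by blast
  define A where "A = V - {v, b}"
  have A: "x \<in> V" "x \<noteq> v" "x \<noteq> b" if "x \<in> A" for x using that by (auto simp: A_def)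
  have A3: "{x, y, z} \<notin> U" if "x \<in> A" "y \<in> A" "z \<in> A" for x y z using meet[of "{x, y, z}"] that A by blast
  have cl: "{c, x, y} \<in> U" if "{c, z, x} \<notin> U" "{c, z, y} \<in> U" "x \<in> A" "y \<in> A" "z \<in> A" "x \<noteq> y" "c \<in> {v, b}" for c x y z
  proof (cases "x = z")
    case True then show ?thesis using that by simp
  next
    case False
    have "c \<noteq> z" using that A by blast
    then have "{c, z, z} \<notin> U" using U by auto
    then have "y \<noteq> z" using that by auto
    then show ?thesis
      using second[of x c z y] that False A A3[of x y z] by (auto simp: insert_commute)
  qed
  \<comment> \<open>The candidate cocycle is empty only in the trivial cases.\<close>
  have key: "P = Q \<and> (P = {} \<or> P = A)"
    if P: "P \<subseteq> A" "\<And>x y. x \<in> P \<Longrightarrow> y \<in> A - P \<Longrightarrow> {b, x, y} \<in> U"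
      and Q: "Q \<subseteq> A" "\<And>x y. x \<in> Q \<Longrightarrow> y \<in> A - Q \<Longrightarrow> {v, x, y} \<in> U"
      and w: "\<And>x. x \<in> sym_diff P Q \<Longrightarrow> {v, b, x} \<in> U" for P Q
  proof -
    define \<Gamma> where "\<Gamma> = (\<lambda>x. {b, x}) ` P \<union> (\<lambda>x. {v, x}) ` Q"
    have "card {b, x} = 2" "card {v, x} = 2" if "x \<in> A" for x
      using A(2,3)[OF that] by auto
    then have \<Gamma>2: "\<Gamma> \<subseteq> ksubsets V 2" using P(1) Q(1) A(1) vb(1,2) by (auto simp: \<Gamma>_def)
    have mem: "{b, x} \<in> \<Gamma> \<longleftrightarrow> x \<in> P" "{v, x} \<in> \<Gamma> \<longleftrightarrow> x \<in> Q" if "x \<in> A" for x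
      using A[OF that] vb(3) A P(1) Q(1) by (auto simp: \<Gamma>_def doubleton_eq_iff)
    have "v \<notin> P" "b \<notin> Q" using A P(1) Q(1) by blast+
    then have nmem: "{v, b} \<notin> \<Gamma>" using vb(3) by (auto simp: \<Gamma>_def doubleton_eq_iff)
    have nmem2: "{x, y} \<notin> \<Gamma>" if "x \<in> A" "y \<in> A" for x y
      using A[OF that(1)] A[OF that(2)] by (auto simp: \<Gamma>_def doubleton_eq_iff)
    have b: "{b, x, y} \<in> cobd V \<Gamma> \<longleftrightarrow> (x \<in> P) \<noteq> (y \<in> P)" if "x \<in> A" "y \<in> A" "x \<noteq> y" for x y
      using mem_cobd_pairs[of b x y \<Gamma>] that A[of x] A[of y] vb mem nmem2 by auto
    have v: "{v, x, y} \<in> cobd V \<Gamma> \<longleftrightarrow> (x \<in> Q) \<noteq> (y \<in> Q)" if "x \<in> A" "y \<in> A" "x \<noteq> y" for x y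
      using mem_cobd_pairs[of v x y \<Gamma>] that A[of x] A[of y] vb mem nmem2 by auto
    have vbx: "{v, b, x} \<in> cobd V \<Gamma> \<longleftrightarrow> x \<in> sym_diff P Q" if "x \<in> A" for x
      using mem_cobd_pairs[of v b x \<Gamma>] that A[of x] vb mem nmem by auto
    have "cobd V \<Gamma> \<subseteq> U"
    proof
      fix t assume t: "t \<in> cobd V \<Gamma>"
      then have "t \<in> ksubsets V 3" using card_cobd[OF V(1) \<Gamma>2] by auto
      then have t3: "card t = 3" "t \<subseteq> V" by auto
      consider "v \<in> t" "b \<in> t" | "v \<in> t" "b \<notin> t" | "v \<notin> t" "b \<in> t" | "v \<notin> t" "b \<notin> t" by blast
      then show "t \<in> U"
      proof cases
        case 1
        then have "card (t - {v, b}) = 1" using t3 vb(3) by (simp add: card_Diff_subset)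
        then obtain x where x: "t - {v, b} = {x}" by (auto simp: card_1_singleton_iff)
        then have "t = {v, b, x}" "x \<in> A" using 1 t3 unfolding A_def by blast+
        then show ?thesis using vbx t w by blast
      next
        case 2
        then have "card (t - {v}) = 2" using t3 by simp
        then obtain x y where x: "t - {v} = {x, y}" "x \<noteq> y" by (auto simp: card_2_iff)
        then have txy: "t = {v, x, y}" "x \<in> A" "y \<in> A" using 2 t3 unfolding A_def by blast+
        then have "(x \<in> Q) \<noteq> (y \<in> Q)" using v[OF txy(2,3) x(2)] t by simp
        then show ?thesis using Q(2)[of x y] Q(2)[of y x] txy by (auto simp: insert_commute)
      next
        case 3
        then have "card (t - {b}) = 2" using t3 by simp
        then obtain x y where x: "t - {b} = {x, y}" "x \<noteq> y" by (auto simp: card_2_iff)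
        then have txy: "t = {b, x, y}" "x \<in> A" "y \<in> A" using 3 t3 unfolding A_def by blast+
        then have "(x \<in> P) \<noteq> (y \<in> P)" using b[OF txy(2,3) x(2)] t by simp
        then show ?thesis using P(2)[of x y] P(2)[of y x] txy by (auto simp: insert_commute)
      next
        case 4
        obtain x y z where xyz: "t = {x, y, z}" "x \<noteq> y" "x \<noteq> z" "y \<noteq> z" "x \<in> V" "y \<in> V" "z \<in> V"
          using \<open>t \<in> ksubsets V 3\<close> by (rule triple_cases)
        then have "x \<in> A" "y \<in> A" "z \<in> A" using 4 by (auto simp: A_def)
        then have "t \<notin> cobd V \<Gamma>" using mem_cobd_pairs[OF xyz(5-7,2-4)] nmem2 xyz(1) by simp
        then show ?thesis using t by simp
      qed
    qed
    then have emp: "cobd V \<Gamma> = {}" by (rule not_cobd[OF \<Gamma>2])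
    have "P = Q" using vbx emp P(1) Q(1) by blast
    moreover have "P = {} \<or> P = A"
    proof (rule ccontr)
      assume "\<not> ?thesis"
      then obtain x y where "x \<in> P" "y \<in> A - P" using P(1) by blast
      then show False using b[of x y] emp P(1) by blast
    qed
    ultimately show ?thesis by blast
  qed
  have "card A = 5" using V vb by (simp add: A_def card_Diff_subset)
  then have "A \<noteq> {}" by auto
  show False
  proof (cases "\<exists>z\<in>A. {v, b, z} \<notin> U")
    case False
    obtain z where z: "z \<in> A" using \<open>A \<noteq> {}\<close> by auto
    define P where "P = {x \<in> A. {b, z, x} \<notin> U}"
    have "{b, z, z} \<notin> U" using U A[OF z] by auto
    then have "z \<in> P" using z by (simp add: P_def)
    have "P = {} \<and> (P = {} \<or> P = A)"
    proof (rule key)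
      show "{b, x, y} \<in> U" if "x \<in> P" "y \<in> A - P" for x y
        using cl[of b z x y] that z by (auto simp: P_def)
      show "{v, b, x} \<in> U" if "x \<in> sym_diff P {}" for x
        using False that by (auto simp: P_def)
    qed (simp_all add: P_def)
    then show False using \<open>z \<in> P\<close> by blast
  next
    case True
    then obtain z where z: "z \<in> A" "{v, b, z} \<notin> U" by blast
    define P where "P = {x \<in> A. {b, z, x} \<notin> U}"
    define Q where "Q = {x \<in> A. {v, z, x} \<notin> U}"
    have "{b, z, z} \<notin> U" using U A[OF z(1)] by auto
    then have "z \<in> P" using z by (simp add: P_def)
    have "P = Q \<and> (P = {} \<or> P = A)"
    proof (rule key)
      fix x assume x: "x \<in> sym_diff P Q"
      have "{v, z, z} \<notin> U" using U A[OF z(1)] by auto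
      then have "x \<noteq> z" using x z \<open>z \<in> P\<close> by (auto simp: Q_def)
      have "x \<in> A" using x by (auto simp: P_def Q_def)
      have "{v, z, x} \<in> U \<and> {b, z, x} \<notin> U \<or> {b, z, x} \<in> U \<and> {v, z, x} \<notin> U"
        using x by (auto simp: P_def Q_def)
      then show "{v, b, x} \<in> U"
        using second[of b v z x] second[of v b z x] z A[OF z(1)] A[OF \<open>x \<in> A\<close>] vb \<open>x \<noteq> z\<close>
        by (auto simp: insert_commute)
    next
      show "{b, x, y} \<in> U" if "x \<in> P" "y \<in> A - P" for x y
        using cl[of b z x y] that z by (auto simp: P_def)
      show "{v, x, y} \<in> U" if "x \<in> Q" "y \<in> A - Q" for x y
        using cl[of v z x y] that z by (auto simp: Q_def)
    qed (simp_all add: P_def Q_def subset_iff)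
    then have PA: "P = A" "Q = A" using \<open>z \<in> P\<close> by blast+
    have none: "{b, z, x} \<notin> U" "{v, z, x} \<notin> U" if "x \<in> A" for x
    proof -
      have "x \<in> P" "x \<in> Q" using PA that by auto
      then show "{b, z, x} \<notin> U" "{v, z, x} \<notin> U" by (auto simp: P_def Q_def)
    qed
    have pair: "{c, x, y} \<notin> U" if "x \<in> A" "y \<in> A" "x \<noteq> y" "c \<in> {v, b}" for c x y
    proof
      assume c: "{c, x, y} \<in> U"
      have nz: "{c, z, x} \<notin> U" "{c, z, y} \<notin> U" using none that by auto
      then have "x \<noteq> z" "y \<noteq> z" using c by (auto simp: insert_commute)
      then show False
        using second[of z c x y] c that nz A[of x] A[of y] A[of z] z A3[of z x y] by (auto simp: insert_commute)
    qed
    have vbx: "{v, b, x} \<notin> U" if x: "x \<in> A" for x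
    proof
      assume c: "{v, b, x} \<in> U"
      then have "x \<noteq> z" using z by auto
      then show False
        using second[of z v b x] c z A[OF x] A[OF z(1)] none[OF x] vb by (auto simp: insert_commute)
    qed
    obtain u where u: "u \<in> U" using U by auto
    then have "u \<in> ksubsets V 3" using U by blast
    then obtain x y w where xyw: "u = {x, y, w}" "x \<noteq> y" "x \<noteq> w" "y \<noteq> w" "x \<in> V" "y \<in> V" "w \<in> V"
      by (rule triple_cases)
    have "v \<in> u \<or> b \<in> u" using meet u by blast
    then have "\<exists>c i j. u = {c, i, j} \<and> c \<in> {v, b} \<and> i \<in> V \<and> j \<in> V \<and> i \<noteq> j \<and> c \<noteq> i \<and> c \<noteq> j"
      using xyw by (elim disjE; fastforce simp: insert_commute)
    then obtain c i j where cij: "u = {c, i, j}" "c \<in> {v, b}" "i \<in> V" "j \<in> V" "i \<noteq> j" "c \<noteq> i" "c \<noteq> j"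
      by blast
    show False
    proof (cases "i \<in> A \<and> j \<in> A")
      case True
      then show ?thesis using pair[of i j c] cij u by auto
    next
      case False
      then have "i \<in> {v, b} \<or> j \<in> {v, b}" using cij by (auto simp: A_def)
      then have "\<exists>k\<in>A. u = {v, b, k}" using cij vb by (auto simp: A_def insert_commute)
      then show ?thesis using vbx u by blast
    qed
  qed
qed

text \<open>Dually: the triangles that lie in no tetrahedron contain no nonempty cocycle. Take a tripod with
  apex \<open>v\<close>, feet \<open>x\<close>, \<open>y\<close>, \<open>z\<close> and further points \<open>p\<close>, \<open>q\<close>, \<open>r\<close>. If \<open>D\<close> contains a triple with two feet
  and one of \<open>p\<close>, \<open>q\<close>, \<open>r\<close>, then no member of \<open>U\<close> avoids these two feet. Otherwise all triples of
  \<open>D\<close> contain \<open>v\<close>, and their other two points form the edges of a cut of the six remaining points;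
  then no member of \<open>U\<close> avoids both \<open>v\<close> and a point on the smaller side of the cut. Either way this
  contradicts \<open>disjoint_member\<close>.\<close>

lemma no_transversal_cocycle:
  assumes D: "D \<subseteq> ksubsets V 3" "D \<noteq> {}" "cocycle V D"
    and meet: "\<And>t u. t \<in> D \<Longrightarrow> u \<in> U \<Longrightarrow> t \<inter> u \<noteq> {}"
  shows False
proof -
  have four: "(({a, b, c} \<in> D) \<noteq> ({a, b, d} \<in> D)) = (({a, c, d} \<in> D) \<noteq> ({b, c, d} \<in> D))"
    if "distinct [a, b, c, d]" "{a, b, c, d} \<subseteq> V" for a b c d
  proof -
    have "\<not> odd (card (opposite D {a, b, c, d}))" using D(3) that(2) by (simp add: cocycle_def)
    then show ?thesis using odd_opposite_4[of a b c d D] that(1) by simp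
  qed
  obtain v where v: "v \<in> V" using V by fastforce
  obtain x y z where xyz: "distinct [v, x, y, z]" "x \<in> V" "y \<in> V" "z \<in> V"
    and tri: "{v, x, y} \<in> U" "{v, x, z} \<in> U" "{v, y, z} \<in> U"
    by (rule tripod[OF v])
  have "card {v, x, y, z} = 4" using xyz by simp
  then have "card (V - {v, x, y, z}) = 3" using V v xyz by (subst card_Diff_subset) auto
  then obtain p q r where pqr: "V - {v, x, y, z} = {p, q, r}" "p \<noteq> q" "p \<noteq> r" "q \<noteq> r"
    by (auto simp: card_3_iff)
  have ds: "distinct [v, x, y, z, p, q, r]" using pqr xyz by auto
  have Veq: "V = {v, x, y, z, p, q, r}" using pqr(1) xyz v by blast
  have two: "{a, x', y'} \<notin> D"
    if d: "distinct [v, x', y', z', a, b, c]" and Ve: "V = {v, x', y', z', a, b, c}"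
      and t: "{v, x', z'} \<in> U" "{v, y', z'} \<in> U" for x' y' z' a b c
  proof
    assume a: "{a, x', y'} \<in> D"
    have no1: "{i, j, x'} \<notin> D" "{i, j, y'} \<notin> D" if "i \<in> {a, b, c}" "j \<in> {a, b, c}" for i j
      using meet[OF _ t(2), of "{i, j, x'}"] meet[OF _ t(1), of "{i, j, y'}"] d that by auto
    have b: "{i, x', y'} \<in> D" if i: "i \<in> {b, c}" for i
    proof -
      have "distinct [a, i, x', y']" "{a, i, x', y'} \<subseteq> V" using d i Ve by auto
      from four[OF this] show ?thesis using no1[of a i] i a by auto
    qed
    have "x' \<in> V" "y' \<in> V" "x' \<noteq> y'" using Ve d by auto
    then obtain u where u: "u \<in> U" "x' \<notin> u" "y' \<notin> u" by (rule disjoint_member)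
    have abc: "a \<in> u" "b \<in> u" "c \<in> u" using meet[OF a u(1)] meet[OF b u(1)] u(2,3) by auto
    have "card {a, b, c} = 3" "card u = 3" "finite u" using d u U V(1) finite_subset by auto
    then have "u = {a, b, c}" using card_subset_eq[of u "{a, b, c}"] abc by auto
    then have "{v, a, b} \<in> U \<or> {v, a, c} \<in> U \<or> {v, b, c} \<in> U"
      using second[OF v, of a b c] u d by auto
    then show False
      using meet[OF b[of c], of "{v, a, b}"] meet[OF b[of b], of "{v, a, c}"] meet[OF a, of "{v, b, c}"] d
      by auto
  qed
  define W where "W = {x, y, z, p, q, r}"
  have VW: "V = insert v W" "v \<notin> W" using Veq ds by (auto simp: W_def)
  have through: "v \<in> t" if t: "t \<in> D" for t
  proof (rule ccontr)
    assume "v \<notin> t"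
    have t3: "t \<subseteq> V" "card t = 3" using t D by auto
    have hit: "x \<in> t \<or> y \<in> t" "x \<in> t \<or> z \<in> t" "y \<in> t \<or> z \<in> t"
      using meet[OF t tri(1)] meet[OF t tri(2)] meet[OF t tri(3)] \<open>v \<notin> t\<close> by blast+
    have no2: "{a, x, y} \<notin> D \<and> {a, x, z} \<notin> D \<and> {a, y, z} \<notin> D" if a: "a \<in> {p, q, r}" for a
    proof -
      obtain b c where bc: "{a, b, c} = {p, q, r}" "distinct [a, b, c]"
        using a ds by (cases "a = p"; cases "a = q") (auto 4 4 simp: insert_commute)
      have notin: "v \<notin> {a, b, c}" "x \<notin> {a, b, c}" "y \<notin> {a, b, c}" "z \<notin> {a, b, c}"
        unfolding bc(1) using ds by auto
      have Vb: "V = {v, x, y, z} \<union> {a, b, c}" unfolding bc(1) Veq by auto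
      show ?thesis
        using two[of x y z a b c] two[of x z y a b c] two[of y z x a b c] notin bc(2) Vb xyz(1) tri
        by (auto simp: insert_commute)
    qed
    have "{x, y, z} \<notin> D"
    proof -
      have "distinct [p, x, y, z]" "{p, x, y, z} \<subseteq> V" using ds Veq by auto
      from four[OF this] show ?thesis using no2[of p] by auto
    qed
    moreover have "\<exists>i j. i \<noteq> j \<and> i \<in> {x, y, z} \<and> j \<in> {x, y, z} \<and> i \<in> t \<and> j \<in> t"
      using hit xyz(1) by auto
    then obtain i j where ij: "i \<noteq> j" "i \<in> {x, y, z}" "j \<in> {x, y, z}" "i \<in> t" "j \<in> t" by blast
    have "finite t" using t3 V(1) finite_subset by blast
    then have "card (t - {i, j}) = 1" using ij t3 by (simp add: card_Diff_subset)
    then obtain a where "t - {i, j} = {a}" by (auto simp: card_1_singleton_iff)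
    then have ta: "t = {a, i, j}" "a \<noteq> i" "a \<noteq> j" using ij by blast+
    have "a \<in> {x, y, z} \<or> a \<in> {p, q, r}" using ta t3 \<open>v \<notin> t\<close> Veq by auto
    moreover have "a \<notin> {p, q, r}" using no2[of a] ij ta t by (auto simp: insert_commute)
    ultimately have "t = {x, y, z}" using ta ij by (auto simp: insert_commute)
    then show False using t \<open>{x, y, z} \<notin> D\<close> by simp
  qed
  obtain t where t: "t \<in> D" using D by auto
  then have "card (t - {v}) = 2" using through[OF t] D(1) V(1) finite_subset by auto
  then obtain a b where ab: "t - {v} = {a, b}" "a \<noteq> b" by (auto simp: card_2_iff)
  then have tab: "{v, a, b} \<in> D" "a \<in> W" "b \<in> W"
    using t through[OF t] D(1) VW insert_Diff[of v t] by auto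
  define A where "A = {y \<in> W. {v, a, y} \<notin> D}"
  have "{v, a, a} \<notin> D"
  proof -
    have "v \<noteq> a" using tab VW by auto
    then have "card {v, a, a} \<noteq> 3" by simp
    then show ?thesis using D(1) by blast
  qed
  then have "a \<in> A" using tab by (simp add: A_def)
  have "b \<in> W - A" using tab by (simp add: A_def)
  have cut: "{v, s, s'} \<in> D" if "s \<in> A" "s' \<in> W - A" for s s'
  proof (cases "s = a")
    case True then show ?thesis using that by (auto simp: A_def)
  next
    case False
    have "a \<noteq> s'" "s \<noteq> s'" "s \<in> W" using that \<open>a \<in> A\<close> by (auto simp: A_def)
    then have ds': "distinct [v, a, s, s']" and sub: "{v, a, s, s'} \<subseteq> V" using that VW tab False by auto
    have "{a, s, s'} \<notin> D" using through[of "{a, s, s'}"] ds' by auto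
    then show ?thesis using four[OF ds' sub] that by (auto simp: A_def)
  qed
  have small: False
    if SR: "S \<union> R = W" "S \<inter> R = {}" "S \<noteq> {}" "card S \<le> 3" and c: "\<And>s r. s \<in> S \<Longrightarrow> r \<in> R \<Longrightarrow> {v, s, r} \<in> D" for S R
  proof -
    have finS: "finite S" "finite R" using SR(1) V(1) VW finite_subset[of _ V] by blast+
    have "card S + card R = 6" using card_Un_disjoint[OF finS SR(2)] SR(1) V VW by simp
    obtain s where s: "s \<in> S" using SR by auto
    have "s \<in> V" "v \<noteq> s" using s SR VW by auto
    then obtain u where u: "u \<in> U" "v \<notin> u" "s \<notin> u" using disjoint_member[OF v] by metis
    have "R \<subseteq> u"
    proof
      fix r assume "r \<in> R"
      from meet[OF c[OF s this] u(1)] u(2,3) show "r \<in> u" by blast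
    qed
    have u3: "card u = 3" "finite u" using u U V(1) finite_subset by auto
    then have "card R = 3" "card S = 3"
      using card_mono[OF u3(2) \<open>R \<subseteq> u\<close>] \<open>card S + card R = 6\<close> SR(4) by auto
    then have "R = u" using card_subset_eq[OF u3(2) \<open>R \<subseteq> u\<close>] u3 by simp
    obtain i j k where ijk: "R = {i, j, k}" "i \<noteq> j" "i \<noteq> k" "j \<noteq> k"
      using \<open>card R = 3\<close> by (auto simp: card_3_iff)
    have nR: "s \<notin> R" using s SR(2) by blast
    have "card (S - {s}) = 2" using s \<open>card S = 3\<close> finS by simp
    then obtain s' where s': "s' \<in> S" "s' \<noteq> s" by (metis DiffE card_2_iff' insertI1)
    have "s' \<notin> R" using s' SR(2) by blast
    have vR: "v \<notin> R" "v \<notin> S" using SR(1) VW by auto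
    have "{s, i, j} \<in> U \<or> {s, i, k} \<in> U \<or> {s, j, k} \<in> U"
      using second[OF \<open>s \<in> V\<close>, of i j k] ijk nR \<open>R = u\<close> u by auto
    then show False
      using meet[OF c[OF s'(1), of k], of "{s, i, j}"] meet[OF c[OF s'(1), of j], of "{s, i, k}"]
        meet[OF c[OF s'(1), of i], of "{s, j, k}"] ijk s' \<open>s' \<notin> R\<close> vR s nR by auto
  qed
  have "A \<subseteq> W" by (auto simp: A_def)
  then have "card A + card (W - A) = 6"
    using V VW card_Diff_subset[of A W] card_mono[of W A] finite_subset[of A W] by simp
  then consider "card A \<le> 3" | "card (W - A) \<le> 3" by linarith
  then show False
  proof cases
    case 1
    show False by (rule small[of A "W - A"]) (use 1 cut \<open>a \<in> A\<close> \<open>A \<subseteq> W\<close> in auto)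
  next
    case 2
    have "{v, s, s'} \<in> D" if "s \<in> W - A" "s' \<in> A" for s s'
      using cut[OF that(2,1)] by (simp add: insert_commute)
    then show False by (intro small[of "W - A" A]) (use 2 \<open>b \<in> W - A\<close> \<open>A \<subseteq> W\<close> in auto)
  qed
qed

text \<open>Both sides count the ordered pairs of distinct triples of \<open>N\<close> with two points in common, by their
  union and by their intersection.\<close>

lemma sum_pairs:
  fixes N :: "'a set set"
  assumes N: "N \<subseteq> ksubsets V 3"
  shows "(\<Sum>Q\<in>ksubsets V 4. card (opposite N Q) * (card (opposite N Q) - 1))
    = (\<Sum>e\<in>ksubsets V 2. card (apexes N e) * (card (apexes N e) - 1))"
proof -
  let ?off = "\<lambda>X. {(v, w). v \<in> X \<and> w \<in> X \<and> v \<noteq> (w::'a)}"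
  have off: "finite (?off X)" "card (?off X) = card X * (card X - 1)" if "finite X" for X
  proof -
    have eq: "?off X = (SIGMA v:X. X - {v})" by auto
    show "finite (?off X)" unfolding eq using that by simp
    show "card (?off X) = card X * (card X - 1)" unfolding eq using that by simp
  qed
  have fN: "finite N" using finite_subset[OF N] V by simp
  have fQ: "finite (opposite N Q)" if "Q \<in> ksubsets V 4" for Q
    using that V finite_subset[of Q V] by (auto simp: opposite_def)
  have "bij_betw (\<lambda>(e, v, w). (insert v (insert w e), v, w))
    (SIGMA e:ksubsets V 2. ?off (apexes N e)) (SIGMA Q:ksubsets V 4. ?off (opposite N Q))"
  proof (rule bij_betwI[where g = "\<lambda>(Q, v, w). (Q - {v, w}, v, w)"])
    show "(\<lambda>(e, v, w). (insert v (insert w e), v, w)) \<in>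
      (SIGMA e:ksubsets V 2. ?off (apexes N e)) \<rightarrow> (SIGMA Q:ksubsets V 4. ?off (opposite N Q))"
    proof clarsimp
      fix e v w assume e: "e \<subseteq> V" "card e = 2" "v \<in> apexes N e" "w \<in> apexes N e" "v \<noteq> w"
      then have *: "v \<notin> e" "w \<notin> e" "insert v e \<in> N" "insert w e \<in> N" by (auto simp: apexes_def)
      have "finite e" using e V(1) finite_subset by blast
      moreover have "insert v (insert w e) - {v} = insert w e" "insert v (insert w e) - {w} = insert v e"
        using * e by blast+
      moreover have "v \<in> V" "w \<in> V" using * N by blast+
      ultimately show "v \<in> V \<and> w \<in> V \<and> card (insert v (insert w e)) = 4 \<and>
          v \<in> opposite N (insert v (insert w e)) \<and> w \<in> opposite N (insert v (insert w e))"
        using * e by (simp add: opposite_def)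
    qed
    show "(\<lambda>(Q, v, w). (Q - {v, w}, v, w)) \<in>
      (SIGMA Q:ksubsets V 4. ?off (opposite N Q)) \<rightarrow> (SIGMA e:ksubsets V 2. ?off (apexes N e))"
    proof clarsimp
      fix Q v w assume Q: "Q \<subseteq> V" "card Q = 4" "v \<in> opposite N Q" "w \<in> opposite N Q" "v \<noteq> w"
      then have *: "v \<in> Q" "w \<in> Q" "Q - {v} \<in> N" "Q - {w} \<in> N" by (auto simp: opposite_def)
      have "finite Q" using Q V(1) finite_subset by blast
      moreover have "insert v (Q - {v, w}) = Q - {w}" "insert w (Q - {v, w}) = Q - {v}"
        using * Q by blast+
      ultimately show "Q - {v, w} \<subseteq> V \<and> card (Q - {v, w}) = 2 \<and>
          v \<in> apexes N (Q - {v, w}) \<and> w \<in> apexes N (Q - {v, w})"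
        using * Q by (auto simp: apexes_def card_Diff_subset)
    qed
  next
    fix q assume "q \<in> (SIGMA e:ksubsets V 2. ?off (apexes N e))"
    then obtain e v w where q: "q = (e, v, w)" "v \<in> apexes N e" "w \<in> apexes N e" by auto
    then have "insert v (insert w e) - {v, w} = e" unfolding apexes_def by blast
    then show "(case case q of (e, v, w) \<Rightarrow> (insert v (insert w e), v, w) of
        (Q, v, w) \<Rightarrow> (Q - {v, w}, v, w)) = q" by (simp add: q)
  next
    fix q assume "q \<in> (SIGMA Q:ksubsets V 4. ?off (opposite N Q))"
    then obtain Q v w where q: "q = (Q, v, w)" "v \<in> opposite N Q" "w \<in> opposite N Q" by auto
    then have "insert v (insert w (Q - {v, w})) = Q" unfolding opposite_def by blast
    then show "(case case q of (Q, v, w) \<Rightarrow> (Q - {v, w}, v, w) of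
        (e, v, w) \<Rightarrow> (insert v (insert w e), v, w)) = q" by (simp add: q)
  qed
  then have "card (SIGMA e:ksubsets V 2. ?off (apexes N e)) = card (SIGMA Q:ksubsets V 4. ?off (opposite N Q))"
    by (rule bij_betw_same_card)
  then show ?thesis
    using off(1)[OF finite_apexes[OF fN]] off(1)[OF fQ] off(2)[OF finite_apexes[OF fN]] off(2)[OF fQ] V
    by (simp add: card_SigmaI)
qed

text \<open>Let a four-set \<open>Q\<close> contain \<open>i\<close> triples of \<open>U\<close> and \<open>n = 4 - i\<close> other triples. As \<open>i \<noteq> 1\<close>, the number
  \<open>4 - i - n (n - 1) + 8 [i = 0]\<close> is 1 if \<open>i = 3\<close> and 0 otherwise. Summed over all 35 four-sets it
  counts those with \<open>i = 3\<close>. The sum of the \<open>i\<close> is \<open>4 |U|\<close>; the sum of the \<open>n (n - 1)\<close> counts adjacent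
  pairs among the \<open>35 - |U|\<close> other triples and is at least \<open>12 (35 - |U|) - 126\<close>; and the rank
  inequality bounds \<open>|U|\<close> plus the number of four-sets with \<open>i = 0\<close> by 20. So at most six four-sets
  have \<open>i = 3\<close>, while the tripods provide seven.\<close>

lemma contradiction: False
proof -
  define X where "X = {Q \<in> ksubsets V 4. opposite U Q = {}}"
  define N where "N = ksubsets V 3 - U"
  have finU: "finite U" using finite_subset[OF U(1)] V by simp
  obtain v0 where v0: "v0 \<in> V" using V by fastforce
  have "card X + card U \<le> (card V - 1) choose 3"
  proof (rule card_cycle_free_add_card_cocycle_free_le[OF V(1) v0])
    fix Z assume Z: "Z \<subseteq> X" "Z \<noteq> {}"
    show "bd Z \<noteq> {}"
    proof
      assume "bd Z = {}"
      have ZV: "Z \<subseteq> Pow V" using Z by (auto simp: X_def)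
      have "bd (compl V (compl V Z)) = {}" using \<open>bd Z = {}\<close> compl_compl[OF ZV] by simp
      then have co: "cocycle V (compl V Z)" using bd_compl_eq_empty_iff[of "compl V Z" V] by auto
      show False
      proof (rule no_transversal_cocycle[OF _ _ co])
        show "compl V Z \<subseteq> ksubsets V 3"
        proof
          fix t assume "t \<in> compl V Z"
          then obtain Q where "t = V - Q" "Q \<subseteq> V" "card Q = 4" using Z by (auto simp: X_def)
          then show "t \<in> ksubsets V 3" using V finite_subset[of Q V] by (simp add: card_Diff_subset)
        qed
        show "compl V Z \<noteq> {}" using Z by simp
        fix t u assume t: "t \<in> compl V Z" and u: "u \<in> U"
        then obtain Q where Q: "t = V - Q" "Q \<in> X" using Z by auto
        then have Q': "Q \<subseteq> V" "card Q = 4" "opposite U Q = {}" by (auto simp: X_def)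
        have u': "u \<subseteq> V" "card u = 3" using u U by auto
        show "t \<inter> u \<noteq> {}"
        proof
          assume "t \<inter> u = {}"
          then have "u \<subseteq> Q" using Q u' by blast
          then have "card (Q - u) = 1" using Q' u' V(1) finite_subset[of u V] by (simp add: card_Diff_subset)
          then obtain w where "Q - u = {w}" by (auto simp: card_1_singleton_iff)
          then have "w \<in> Q" "Q - {w} = u" using \<open>u \<subseteq> Q\<close> by blast+
          then show False using Q'(3) u by (auto simp: opposite_def)
        qed
      qed
    qed
  next
    fix \<tau> assume \<tau>: "\<tau> \<in> U"
    show "apexes X \<tau> = {}"
    proof (rule ccontr)
      assume "\<not> ?thesis"
      then obtain w where w: "w \<notin> \<tau>" "insert w \<tau> \<in> X" by (auto simp: apexes_def)
      then have "w \<in> opposite U (insert w \<tau>)" using \<tau> by (simp add: opposite_def)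
      then show False using w by (auto simp: X_def)
    qed
  qed (use U no_co in \<open>auto simp: X_def\<close>)
  then have rank: "card X + card U \<le> 20" using V by (simp add: eval_nat_numeral)
  \<comment> \<open>A four-set spanned by a tripod determines the apex, so the seven tripods give seven four-sets.\<close>
  have "\<exists>Q. Q \<in> ksubsets V 4 \<and> v \<in> Q \<and> opposite U Q = Q - {v}" if v: "v \<in> V" for v
  proof -
    obtain x y z where t: "distinct [v, x, y, z]" "x \<in> V" "y \<in> V" "z \<in> V"
      "{v, x, y} \<in> U" "{v, x, z} \<in> U" "{v, y, z} \<in> U" "{x, y, z} \<notin> U"
      by (rule tripod[OF v])
    then have "opposite U {v, x, y, z} = {v, x, y, z} - {v}" by (subst opposite_4) auto
    moreover have "{v, x, y, z} \<in> ksubsets V 4" using t v by simp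
    ultimately show ?thesis by blast
  qed
  then obtain f where f: "\<And>v. v \<in> V \<Longrightarrow> f v \<in> ksubsets V 4 \<and> v \<in> f v \<and> opposite U (f v) = f v - {v}"
    by metis
  define X3 where "X3 = {Q \<in> ksubsets V 4. card (opposite U Q) = 3}"
  have "inj_on f V"
  proof (rule inj_onI)
    fix v w assume vw: "v \<in> V" "w \<in> V" "f v = f w"
    then have "f v - {v} = f v - {w}" "v \<in> f v" "w \<in> f v" using f by metis+
    then show "v = w" by blast
  qed
  moreover have "f ` V \<subseteq> X3" using f V(1) finite_subset by (auto simp: X3_def)
  moreover have "finite X3" using V by (simp add: X3_def)
  ultimately have m3: "7 \<le> card X3" using card_inj_on_le[of f V X3] V by simp
  have fP: "finite (ksubsets V m)" for m using V by simp
  have cP: "card (ksubsets V m) = 7 choose m" for m using n_subsets[OF V(1), of m] V by simp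
  have cP4: "card (ksubsets V 4) = 35" and cP3: "card (ksubsets V 3) = 35" and cP2: "card (ksubsets V 2) = 21"
    unfolding cP by (simp_all add: eval_nat_numeral)
  have cN: "card N + card U = 35"
    using cP3 card_Diff_subset[OF finU U(1)] card_mono[OF fP U(1)] by (simp add: N_def)
  have finP4: "finite Q" if "Q \<in> ksubsets V 4" for Q using that V(1) finite_subset by blast
  have oppN: "card (opposite N Q) + card (opposite U Q) = 4" if Q: "Q \<in> ksubsets V 4" for Q
  proof -
    have N: "opposite N Q = Q - opposite U Q" using Q by (auto simp: opposite_def N_def)
    have sub: "opposite U Q \<subseteq> Q" by (auto simp: opposite_def)
    have "card (Q - opposite U Q) = card Q - card (opposite U Q)"
      by (rule card_Diff_subset[OF finite_subset[OF sub finP4[OF Q]] sub])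
    moreover have "card (opposite U Q) \<le> card Q" by (rule card_mono[OF finP4[OF Q] sub])
    moreover have "card Q = 4" using Q by simp
    ultimately show ?thesis unfolding N by linarith
  qed
  have sumU: "(\<Sum>Q\<in>ksubsets V 4. card (opposite U Q)) = 4 * card U"
  proof -
    have "(\<Sum>Q\<in>ksubsets V 4. card (opposite U Q)) = (\<Sum>u\<in>U. card (apexes (ksubsets V 4) u))"
      by (rule sum_apexes_eq_sum_opposite[OF fP finU finP4, symmetric])
    also have "\<dots> = (\<Sum>u\<in>U. 4)"
    proof (rule sum.cong)
      fix u assume u: "u \<in> U"
      then have u': "u \<subseteq> V" "card u = 3" using U by auto
      have fu: "finite u" by (rule finite_subset[OF u'(1) V(1)])
      have "apexes (ksubsets V 4) u = V - u"
        unfolding apexes_def using u' fu by auto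
      then show "card (apexes (ksubsets V 4) u) = 4"
        using card_Diff_subset[OF fu u'(1)] u'(2) V(2) by simp
    qed simp
    finally show ?thesis by simp
  qed
  have NV: "N \<subseteq> ksubsets V 3" by (auto simp: N_def)
  have sumN: "(\<Sum>e\<in>ksubsets V 2. card (apexes N e)) = 3 * card N"
    using sum_card_apexes[OF V(1), of N 2] NV by simp
  let ?i = "\<lambda>Q. int (card (opposite U Q))" and ?n = "\<lambda>Q. int (card (opposite N Q))"
    and ?d = "\<lambda>e. int (card (apexes N e))"
  have off: "int (k * (k - 1)) = int k * (int k - 1)" for k by (cases k) (auto simp: algebra_simps)
  have "(\<Sum>Q\<in>ksubsets V 4. ?n Q * (?n Q - 1)) = (\<Sum>e\<in>ksubsets V 2. ?d e * (?d e - 1))"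
    using arg_cong[OF sum_pairs[OF NV], of int] by (simp only: of_nat_sum off)
  also have "\<dots> \<ge> (\<Sum>e\<in>ksubsets V 2. 4 * ?d e - 6)"
  proof (rule sum_mono)
    fix e
    have "0 \<le> (?d e - 2) * (?d e - 3)"
      by (cases "?d e \<le> 2") (auto intro: mult_nonneg_nonneg mult_nonpos_nonpos)
    then show "4 * ?d e - 6 \<le> ?d e * (?d e - 1)" by (simp add: algebra_simps)
  qed
  also have "(\<Sum>e\<in>ksubsets V 2. 4 * ?d e - 6) = 4 * int (\<Sum>e\<in>ksubsets V 2. card (apexes N e)) - 126"
    using cP2 by (simp add: sum_subtractf sum_distrib_left)
  finally have conv: "12 * int (card N) - 126 \<le> (\<Sum>Q\<in>ksubsets V 4. ?n Q * (?n Q - 1))"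
    unfolding sumN by simp
  have pt: "(if Q \<in> X3 then 1 else 0) = 4 - ?i Q - ?n Q * (?n Q - 1) + (if Q \<in> X then 8 else 0)"
    if Q: "Q \<in> ksubsets V 4" for Q
  proof -
    have n: "?n Q = 4 - ?i Q" using oppN[OF Q] by simp
    have "opposite U Q \<subseteq> Q" by (auto simp: opposite_def)
    then have "finite (opposite U Q)" by (rule finite_subset[OF _ finP4[OF Q]])
    then have "card (opposite U Q) = 0 \<longleftrightarrow> Q \<in> X" using Q by (simp add: X_def)
    moreover have "card (opposite U Q) = 3 \<longleftrightarrow> Q \<in> X3" using Q by (auto simp: X3_def)
    moreover have "card (opposite U Q) \<noteq> 1" using one Q by blast
    moreover have "card (opposite U Q) \<le> 4" using oppN[OF Q] by simp
    ultimately consider "Q \<in> X" "Q \<notin> X3" "?i Q = 0" | "Q \<notin> X" "Q \<notin> X3" "?i Q = 2" | "Q \<notin> X" "Q \<in> X3" "?i Q = 3"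
      | "Q \<notin> X" "Q \<notin> X3" "?i Q = 4" by fastforce
    then show ?thesis by cases (simp_all add: n)
  qed
  have "int (card X3) = (\<Sum>Q\<in>ksubsets V 4. if Q \<in> X3 then 1 else 0)"
    using fP by (simp add: sum.If_cases X3_def Int_def)
  also have "\<dots> = (\<Sum>Q\<in>ksubsets V 4. 4 - ?i Q - ?n Q * (?n Q - 1) + (if Q \<in> X then 8 else 0))"
    by (rule sum.cong[OF refl pt])
  also have "\<dots> = 140 - int (\<Sum>Q\<in>ksubsets V 4. card (opposite U Q)) - (\<Sum>Q\<in>ksubsets V 4. ?n Q * (?n Q - 1))
      + (\<Sum>Q\<in>ksubsets V 4. if Q \<in> X then 8 else 0)"
    using cP4 by (simp add: sum.distrib sum_subtractf)
  also have "(\<Sum>Q\<in>ksubsets V 4. if Q \<in> X then 8 else 0 :: int) = 8 * int (card X)"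
    using fP by (simp add: sum.If_cases X_def Int_def)
  finally show False unfolding sumU using conv m3 rank cN by linarith
qed

end

section \<open>From singular to simplicial acyclicity\<close>

abbreviation lookup :: "('b \<Rightarrow>\<^sub>0 'c::zero) \<Rightarrow> 'b \<Rightarrow> 'c" where
  "lookup \<equiv> Poly_Mapping.lookup"

text \<open>The empty set belongs to the boundary of an odd number of vertices, so the case \<open>p = 1\<close> is
  reduced homology in degree 0.\<close>

definition simplicially_acyclic :: "'v set set \<Rightarrow> bool" where
  "simplicially_acyclic K \<longleftrightarrow>
     (\<forall>p>0. \<forall>Z. Z \<subseteq> {\<sigma> \<in> K. card \<sigma> = p} \<and> bd Z = {} \<longrightarrow>
        (\<exists>W. W \<subseteq> {\<sigma> \<in> K. card \<sigma> = Suc p} \<and> bd W = Z))"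

lemma trivial_homology_imp_boundary:
  assumes "trivial_group (z2_reduced_homology_group q X)" "c \<in> z2_reduced_cycles q X"
  shows "c \<in> z2_boundaries q X"
proof -
  let ?G = "subgroup_generated (z2_chain_group q X) (z2_reduced_cycles q X)"
  have "c \<in> carrier (z2_chain_group q X)" using assms(2) by (simp add: z2_reduced_cycles_def)
  then have "c \<in> carrier ?G"
    using assms(2) by (simp add: carrier_subgroup_generated generate.incl)
  then have "z2_boundaries q X #>\<^bsub>?G\<^esub> c \<in> carrier (z2_reduced_homology_group q X)"
    by (auto simp: z2_reduced_homology_group_def FactGroup_def RCOSETS_def)
  also have "\<dots> = {z2_boundaries q X}"
    using assms(1) by (simp add: trivial_group_def z2_reduced_homology_group_def FactGroup_def)
  finally have eq: "z2_boundaries q X #>\<^bsub>?G\<^esub> c = z2_boundaries q X" by simp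
  have "z2_boundary (Suc q) 0 = (0 :: 'a z2_chain)" by (simp add: z2_boundary_def)
  then have "0 \<in> z2_boundaries q X"
    by (force simp: z2_boundaries_def z2_chain_group_def)
  then have "0 \<otimes>\<^bsub>?G\<^esub> c \<in> z2_boundaries q X #>\<^bsub>?G\<^esub> c" unfolding r_coset_def by blast
  moreover have "0 \<otimes>\<^bsub>?G\<^esub> c = c" by (simp add: z2_chain_group_def)
  ultimately show ?thesis using eq by simp
qed

text \<open>The form with a witness \<open>w\<close> makes it evident that additive maps preserve the relation.\<close>

definition cong2 :: "('b \<Rightarrow>\<^sub>0 int) \<Rightarrow> ('b \<Rightarrow>\<^sub>0 int) \<Rightarrow> bool" where
  "cong2 a b \<longleftrightarrow> (\<exists>w. a = b + (w + w))"

lemma cong2_iff: "cong2 a b \<longleftrightarrow> (\<forall>x. even (lookup a x) \<longleftrightarrow> even (lookup b x))"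
proof
  assume "cong2 a b"
  then show "\<forall>x. even (lookup a x) \<longleftrightarrow> even (lookup b x)"
    by (auto simp: cong2_def lookup_add)
next
  assume R: "\<forall>x. even (lookup a x) \<longleftrightarrow> even (lookup b x)"
  let ?w = "Poly_Mapping.map (\<lambda>n. n div 2) (a - b)"
  have "lookup a x = lookup (b + (?w + ?w)) x" for x
  proof -
    have "even (lookup (a - b) x)" using R by (simp add: lookup_minus)
    then have "lookup ?w x + lookup ?w x = lookup (a - b) x"
      by (simp add: Poly_Mapping.map.rep_eq when_def)
    then show ?thesis by (simp add: lookup_add lookup_minus)
  qed
  then have "a = b + (?w + ?w)" by (rule poly_mapping_eqI)
  then show "cong2 a b" unfolding cong2_def by blast
qed

lemma cong2_refl: "cong2 a a" by (simp add: cong2_iff)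
lemma cong2_sym: "cong2 a b \<Longrightarrow> cong2 b a" by (simp add: cong2_iff)
lemma cong2_trans: "cong2 a b \<Longrightarrow> cong2 b c \<Longrightarrow> cong2 a c" by (simp add: cong2_iff)

lemma cong2_diff: "cong2 a b \<Longrightarrow> cong2 c d \<Longrightarrow> cong2 (a - c) (b - d)"
  by (simp add: cong2_iff lookup_minus)

lemma cong2_sum:
  assumes "\<And>i. i \<in> I \<Longrightarrow> cong2 (f i) (g i)"
  shows "cong2 (sum f I) (sum g I)"
  using assms
proof (induction I rule: infinite_finite_induct)
  case (insert i I)
  then have "cong2 (f i) (g i)" "cong2 (sum f I) (sum g I)" by auto
  then show ?case using insert by (simp add: cong2_iff lookup_add)
qed (auto simp: cong2_refl)

lemma cong2_sign: "cong2 (frag_cmul ((- 1) ^ k) a) a"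
  unfolding cong2_iff by simp

lemma additive_cong2:
  assumes "\<And>a b. F (a + b) = F a + F b" "cong2 a b"
  shows "cong2 (F a) (F b)"
proof -
  obtain w where "a = b + (w + w)" using assms(2) by (auto simp: cong2_def)
  then have "F a = F b + (F w + F w)" using assms(1) by simp
  then show ?thesis unfolding cong2_def by blast
qed

definition face_boundary :: "('v set \<Rightarrow>\<^sub>0 int) \<Rightarrow> ('v set \<Rightarrow>\<^sub>0 int)" where
  "face_boundary = frag_extend (\<lambda>\<sigma>. \<Sum>v\<in>\<sigma>. frag_of (\<sigma> - {v}))"

text \<open>The reduction mod 2 of an integral chain, as a family of faces.\<close>

definition odd_support :: "('b \<Rightarrow>\<^sub>0 int) \<Rightarrow> 'b set" where
  "odd_support B = {x. odd (lookup B x)}"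

lemma odd_support_subset_keys: "odd_support B \<subseteq> Poly_Mapping.keys B"
  by (auto simp: odd_support_def in_keys_iff)

lemma cong2_imp_odd_support: "cong2 a b \<Longrightarrow> odd_support a = odd_support b"
  by (auto simp: cong2_iff odd_support_def)

lemma lookup_face_sum:
  assumes "finite \<sigma>"
  shows "lookup (\<Sum>v\<in>\<sigma>. frag_of (\<sigma> - {v})) \<tau> = (if \<exists>v. v \<notin> \<tau> \<and> insert v \<tau> = \<sigma> then 1 else 0)"
proof -
  have "lookup (\<Sum>v\<in>\<sigma>. frag_of (\<sigma> - {v})) \<tau> = (\<Sum>v\<in>\<sigma>. if \<tau> = \<sigma> - {v} then 1 else 0)"
    by (simp add: lookup_sum)
  also have "\<dots> = int (card {v \<in> \<sigma>. \<tau> = \<sigma> - {v}})"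
    using assms by (simp add: sum.If_cases Int_def)
  also have "\<dots> = (if \<exists>v. v \<notin> \<tau> \<and> insert v \<tau> = \<sigma> then 1 else 0)"
  proof (cases "\<exists>v. v \<notin> \<tau> \<and> insert v \<tau> = \<sigma>")
    case True
    then obtain v where v: "v \<notin> \<tau>" "insert v \<tau> = \<sigma>" by blast
    then have "{v \<in> \<sigma>. \<tau> = \<sigma> - {v}} = {v}" by blast
    then show ?thesis using True by simp
  next
    case False
    then have "{v \<in> \<sigma>. \<tau> = \<sigma> - {v}} = {}" by blast
    then have "card {v \<in> \<sigma>. \<tau> = \<sigma> - {v}} = 0" by (simp only: card.empty)
    then show ?thesis using False by (simp only: if_False)
  qed
  finally show ?thesis .
qed

lemma odd_support_face_boundary:
  assumes "\<And>\<sigma>. \<sigma> \<in> Poly_Mapping.keys B \<Longrightarrow> finite \<sigma>"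
  shows "odd_support (face_boundary B) = bd (odd_support B)"
proof -
  have "odd (lookup (face_boundary B) \<tau>) \<longleftrightarrow> odd (card (apexes (odd_support B) \<tau>))" for \<tau>
  proof -
    let ?e = "\<lambda>\<sigma>. \<exists>v. v \<notin> \<tau> \<and> insert v \<tau> = \<sigma>"
    have "lookup (face_boundary B) \<tau> = (\<Sum>\<sigma>\<in>Poly_Mapping.keys B. lookup B \<sigma> * (if ?e \<sigma> then 1 else 0))"
    proof -
      define g where "g = (\<lambda>\<sigma>::'a set. \<Sum>v\<in>\<sigma>. frag_of (\<sigma> - {v}))"
      have "lookup (face_boundary B) \<tau> = (\<Sum>\<sigma>\<in>Poly_Mapping.keys B. lookup B \<sigma> * lookup (g \<sigma>) \<tau>)"
        unfolding face_boundary_def frag_extend_def g_def[symmetric] by (simp add: lookup_sum)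
      also have "\<dots> = (\<Sum>\<sigma>\<in>Poly_Mapping.keys B. lookup B \<sigma> * (if ?e \<sigma> then 1 else 0))"
        unfolding g_def by (intro sum.cong refl) (simp only: lookup_face_sum assms)
      finally show ?thesis .
    qed
    then have "even (lookup (face_boundary B) \<tau>) \<longleftrightarrow>
        even (card {\<sigma> \<in> Poly_Mapping.keys B. odd (lookup B \<sigma> * (if ?e \<sigma> then 1 else 0))})"
      by (simp add: even_sum_iff)
    also have "{\<sigma> \<in> Poly_Mapping.keys B. odd (lookup B \<sigma> * (if ?e \<sigma> then 1 else 0))} =
        (\<lambda>v. insert v \<tau>) ` apexes (odd_support B) \<tau>"
      by (auto simp: apexes_def odd_support_def in_keys_iff)
    also have "card \<dots> = card (apexes (odd_support B) \<tau>)"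
      by (rule card_image) (auto simp: inj_on_def apexes_def)
    finally show ?thesis by simp
  qed
  then show ?thesis by (auto simp: odd_support_def bd_def)
qed

lemma iterated_subdivision_add:
  "(singular_subdivision p ^^ n) (a + b) = (singular_subdivision p ^^ n) a + (singular_subdivision p ^^ n) b"
  by (induction n) (auto simp: singular_subdivision_add)

lemma iterated_subdivision_sum:
  "(singular_subdivision p ^^ n) (sum f I) = (\<Sum>i\<in>I. (singular_subdivision p ^^ n) (f i))"
  by (induction I rule: infinite_finite_induct) (auto simp: iterated_subdivision_add)

lemma singular_chain_iterated_subdivision:
  "singular_chain p X c \<Longrightarrow> singular_chain p X ((singular_subdivision p ^^ n) c)"
  by (induction n) (auto intro: singular_chain_singular_subdivision)

lemma chain_boundary_iterated_subdivision:
  assumes "singular_chain (Suc p) X c"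
  shows "chain_boundary (Suc p) ((singular_subdivision (Suc p) ^^ n) c) =
    (singular_subdivision p ^^ n) (chain_boundary (Suc p) c)"
proof (induction n)
  case (Suc n)
  then show ?case
    using chain_boundary_singular_subdivision[OF singular_chain_iterated_subdivision[OF assms, of n]] by simp
qed simp

text \<open>If the corners of a simplex are rounded to repeated vertices, a face can keep \<open>p + 1\<close> distinct
  vertices only when it omits one of the two corners rounded alike. Omitting either of them leaves
  the same set, so these faces cancel in pairs.\<close>

lemma even_card_repeated_faces:
  assumes "\<not> inj_on u {..Suc p}"
  shows "even (card {k. k \<le> Suc p \<and> u ` ({..Suc p} - {k}) = \<tau> \<and> card \<tau> = Suc p})"
proof -
  let ?K = "{k. k \<le> Suc p \<and> u ` ({..Suc p} - {k}) = \<tau> \<and> card \<tau> = Suc p}"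
  obtain a b where ab: "a \<le> Suc p" "b \<le> Suc p" "a \<noteq> b" "u a = u b"
    using assms by (auto simp: inj_on_def)
  have "k \<in> {a, b}" if k: "k \<in> ?K" for k
  proof (rule ccontr)
    assume "k \<notin> {a, b}"
    have "card (u ` ({..Suc p} - {k})) = card ({..Suc p} - {k})" using k by auto
    then have "inj_on u ({..Suc p} - {k})" by (intro eq_card_imp_inj_on) auto
    then show False using ab \<open>k \<notin> {a, b}\<close> by (auto dest: inj_onD)
  qed
  moreover have "u ` ({..Suc p} - {a}) = u ` ({..Suc p} - {b})"
  proof -
    have "u ` ({..Suc p} - {a}) = u ` {..Suc p}" "u ` ({..Suc p} - {b}) = u ` {..Suc p}"
      using ab by (auto 0 4 simp: image_iff Bex_def) (metis)+
    then show ?thesis by simp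
  qed
  then have "a \<in> ?K \<longleftrightarrow> b \<in> ?K" using ab by simp
  ultimately have "?K = {} \<or> ?K = {a, b}" by blast
  then have "card ?K = 0 \<or> card ?K = 2"
  proof
    assume "?K = {a, b}"
    then show ?thesis using ab(3) by simp
  qed (simp only: card.empty simp_thms)
  then show ?thesis by presburger
qed

text \<open>The numbering \<open>r\<close> serves to list the vertices of each face in increasing order.\<close>

locale numbered_complex =
  fixes K :: "'v set set" and r :: "'v \<Rightarrow> nat"
  assumes K: "finite_complex K" and r: "inj_on r (vertices K)"
begin

abbreviation "V \<equiv> vertices K"

lemma face: "\<sigma> \<in> K \<Longrightarrow> finite \<sigma>" "\<sigma> \<in> K \<Longrightarrow> \<sigma> \<noteq> {}" "\<sigma> \<in> K \<Longrightarrow> \<sigma> \<subseteq> V"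
  using K unfolding finite_complex_def vertices_def by blast+

lemma finite_V: "finite V"
proof -
  have "finite K" using K by (simp add: finite_complex_def)
  then show ?thesis unfolding vertices_def using face(1) by (rule finite_Union)
qed

lemma face_subset: "\<sigma> \<in> K \<Longrightarrow> \<tau> \<subseteq> \<sigma> \<Longrightarrow> \<tau> \<noteq> {} \<Longrightarrow> \<tau> \<in> K"
  using K unfolding finite_complex_def by blast

definition support :: "('v \<Rightarrow> real) \<Rightarrow> 'v set" where
  "support x = {v. x v \<noteq> 0}"

lemma carrier_pointsD:
  assumes "x \<in> carrier_points K"
  shows "support x \<in> K" "(\<Sum>v\<in>V. x v) = 1" "0 \<le> x v"
proof -
  show S: "support x \<in> K" and "0 \<le> x v" using assms by (auto simp: carrier_points_def support_def)
  have "(\<Sum>v\<in>support x. x v) = 1" using assms by (simp add: carrier_points_def support_def)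
  moreover have "(\<Sum>v\<in>support x. x v) = (\<Sum>v\<in>V. x v)"
    by (rule sum.mono_neutral_left[OF finite_V face(3)[OF S]]) (simp add: support_def)
  ultimately show "(\<Sum>v\<in>V. x v) = 1" by simp
qed

text \<open>The bound by the number of vertices is what survives a small perturbation: a nearby point may
  have a smaller support, but it still has a positive coordinate at this vertex.\<close>

definition round_to :: "('v \<Rightarrow> real) \<Rightarrow> 'v" where
  "round_to x = (SOME v. v \<in> V \<and> 1 \<le> real (card V) * x v)"

lemma round_to:
  assumes x: "x \<in> carrier_points K"
  shows "1 \<le> real (card V) * x (round_to x)" "round_to x \<in> support x"
proof -
  have "\<exists>v. v \<in> V \<and> 1 \<le> real (card V) * x v"
  proof (rule ccontr)
    assume "\<not> ?thesis"
    then have less: "real (card V) * x v < 1" if "v \<in> V" for v using that by force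
    have "V \<noteq> {}" using carrier_pointsD(2)[OF x] by auto
    then have "(\<Sum>v\<in>V. real (card V) * x v) < (\<Sum>v\<in>V. 1)"
      by (intro sum_strict_mono finite_V less)
    then show False using carrier_pointsD(2)[OF x] by (simp add: sum_distrib_left[symmetric])
  qed
  from someI_ex[OF this] show 1: "1 \<le> real (card V) * x (round_to x)" by (simp add: round_to_def)
  then have "x (round_to x) \<noteq> 0" by auto
  then show "round_to x \<in> support x" by (simp add: support_def)
qed

abbreviation corner :: "nat \<Rightarrow> nat \<Rightarrow> real" where
  "corner i \<equiv> (\<lambda>j. if j = i then 1 else 0)"

definition rounded :: "nat \<Rightarrow> ((nat \<Rightarrow> real) \<Rightarrow> 'v \<Rightarrow> real) \<Rightarrow> 'v set" where
  "rounded p f = (\<lambda>i. round_to (f (corner i))) ` {..p}"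

text \<open>Only the corners of a singular simplex matter. If two of them are rounded alike, the simplex
  degenerates and is mapped to 0. The map is defined on arbitrary singular simplices, with values
  in the full simplex on the vertices; the result is a face of the complex when the simplex is small.\<close>

definition round_simplex :: "nat \<Rightarrow> ((nat \<Rightarrow> real) \<Rightarrow> 'v \<Rightarrow> real) \<Rightarrow> ('v set \<Rightarrow>\<^sub>0 int)" where
  "round_simplex p f = (if card (rounded p f) = Suc p then frag_of (rounded p f) else 0)"

definition round_chain :: "nat \<Rightarrow> ('v \<Rightarrow> real) chain \<Rightarrow> ('v set \<Rightarrow>\<^sub>0 int)" where
  "round_chain p = frag_extend (round_simplex p)"

lemma rounded_face:
  assumes "k \<le> Suc p"
  shows "rounded p (singular_face (Suc p) k f) = (\<lambda>i. round_to (f (corner i))) ` ({..Suc p} - {k})"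
proof -
  let ?s = "\<lambda>i. if i < k then i else Suc i"
  have "singular_face (Suc p) k f (corner i) = f (corner (?s i))" if "i \<le> p" for i
  proof -
    have "simplical_face k (corner i) = corner (?s i)" by (auto simp: simplical_face_def fun_eq_iff)
    then show ?thesis using that by (simp add: singular_face_def)
  qed
  then have "rounded p (singular_face (Suc p) k f) = (\<lambda>i. round_to (f (corner (?s i)))) ` {..p}"
    unfolding rounded_def by (intro image_cong) auto
  also have "\<dots> = (\<lambda>i. round_to (f (corner i))) ` (?s ` {..p})" by (simp only: image_image)
  also have "?s ` {..p} = {..Suc p} - {k}"
  proof -
    have "i \<in> ?s ` {..p}" if "i \<le> Suc p" "i \<noteq> k" for i
      using that assms by (intro image_eqI[where x = "if i < k then i else i - 1"]) auto
    then show ?thesis using assms by auto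
  qed
  finally show ?thesis .
qed

text \<open>On a simplex whose corners round to distinct vertices the two sides have the same faces;
  on a degenerate one the right-hand side is 0 and the faces on the left cancel.\<close>

lemma round_chain_boundary:
  "cong2 (round_chain p (chain_boundary (Suc p) C)) (face_boundary (round_chain (Suc p) C))"
proof (induction C rule: frag_induction[OF subset_UNIV])
  case 1
  then show ?case by (simp add: round_chain_def face_boundary_def cong2_refl)
next
  case (2 f)
  let ?u = "\<lambda>i. round_to (f (corner i))"
  let ?S = "\<Sum>k\<le>Suc p. round_simplex p (singular_face (Suc p) k f)"
  have "round_chain p (chain_boundary (Suc p) (frag_of f)) =
      (\<Sum>k\<le>Suc p. frag_cmul ((-1) ^ k) (round_simplex p (singular_face (Suc p) k f)))"
    by (simp add: chain_boundary_of round_chain_def frag_extend_sum frag_extend_cmul o_def frag_extend_add del: sum.atMost_Suc)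
  also have "cong2 \<dots> ?S" by (rule cong2_sum) (rule cong2_sign)
  finally have 1: "cong2 (round_chain p (chain_boundary (Suc p) (frag_of f))) ?S" .
  have R: "round_chain (Suc p) (frag_of f) = round_simplex (Suc p) f" by (simp add: round_chain_def)
  have 2: "cong2 ?S (face_boundary (round_simplex (Suc p) f))"
  proof (cases "inj_on ?u {..Suc p}")
    case True
    then have c: "card (rounded (Suc p) f) = Suc (Suc p)" by (simp add: rounded_def card_image)
    have face: "rounded p (singular_face (Suc p) k f) = rounded (Suc p) f - {?u k}" if "k \<le> Suc p" for k
      using rounded_face[OF that, of f] inj_on_image_set_diff[OF True, of "{..Suc p}" "{k}"] that
      by (simp add: rounded_def)
    have "?S = (\<Sum>k\<le>Suc p. frag_of (rounded (Suc p) f - {?u k}))"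
    proof (rule sum.cong[OF refl])
      fix k assume "k \<in> {..Suc p}"
      then have k: "k \<le> Suc p" by simp
      then have "?u k \<in> rounded (Suc p) f" unfolding rounded_def by (intro imageI) simp
      then have "card (rounded (Suc p) f - {?u k}) = Suc p" using c by simp
      then show "round_simplex p (singular_face (Suc p) k f) = frag_of (rounded (Suc p) f - {?u k})"
        by (simp add: round_simplex_def face[OF k])
    qed
    also have "\<dots> = (\<Sum>v\<in>rounded (Suc p) f. frag_of (rounded (Suc p) f - {v}))"
      unfolding rounded_def using sum.reindex[OF True, of "\<lambda>v. frag_of (?u ` {..Suc p} - {v})"]
      by (simp add: o_def del: sum.atMost_Suc)
    also have "\<dots> = face_boundary (round_simplex (Suc p) f)"
      using c by (simp add: round_simplex_def face_boundary_def)
    finally show ?thesis by (simp add: cong2_refl del: sum.atMost_Suc)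
  next
    case False
    then have "card (rounded (Suc p) f) \<noteq> Suc (Suc p)"
      using eq_card_imp_inj_on[of "{..Suc p}" ?u] by (auto simp: rounded_def)
    then have 0: "face_boundary (round_simplex (Suc p) f) = 0" by (simp add: round_simplex_def face_boundary_def)
    have "even (lookup ?S \<tau>)" for \<tau>
    proof -
      have "lookup (round_simplex p (singular_face (Suc p) k f)) \<tau> =
          (if ?u ` ({..Suc p} - {k}) = \<tau> \<and> card \<tau> = Suc p then 1 else 0)" if "k \<le> Suc p" for k
        using rounded_face[OF that, of f] by (auto simp: round_simplex_def)
      then have "lookup ?S \<tau> = (\<Sum>k\<le>Suc p. if ?u ` ({..Suc p} - {k}) = \<tau> \<and> card \<tau> = Suc p then 1 else 0)"
        by (simp add: lookup_sum del: sum.atMost_Suc)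
      also have "\<dots> = int (card {k. k \<le> Suc p \<and> ?u ` ({..Suc p} - {k}) = \<tau> \<and> card \<tau> = Suc p})"
        by (simp add: sum.If_cases Int_def del: sum.atMost_Suc)
      finally show ?thesis using even_card_repeated_faces[OF False, of \<tau>] by simp
    qed
    then show ?thesis by (simp add: 0 cong2_iff del: sum.atMost_Suc)
  qed
  show ?case unfolding R by (rule cong2_trans[OF 1 2])
next
  case (3 a b)
  then show ?case
    by (simp add: chain_boundary_diff round_chain_def face_boundary_def frag_extend_diff cong2_diff)
qed

text \<open>The position of \<open>v\<close> in the increasing enumeration of \<open>\<sigma>\<close>, starting from 0.\<close>

definition idx :: "'v set \<Rightarrow> 'v \<Rightarrow> nat" where
  "idx \<sigma> v = card {w \<in> \<sigma>. r w < r v}"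

lemma idx_less:
  assumes "\<sigma> \<in> K" "v \<in> \<sigma>" "r v < r w"
  shows "idx \<sigma> v < idx \<sigma> w"
  unfolding idx_def
proof (rule psubset_card_mono)
  show "finite {x \<in> \<sigma>. r x < r w}" using face(1)[OF assms(1)] by simp
  show "{x \<in> \<sigma>. r x < r v} \<subset> {x \<in> \<sigma>. r x < r w}" using assms(2,3) by auto
qed

lemma r_neq:
  assumes "\<sigma> \<in> K" "v \<in> \<sigma>" "w \<in> \<sigma>" "v \<noteq> w"
  shows "r v < r w \<or> r w < r v"
proof -
  have "v \<in> V" "w \<in> V" using assms face(3) by blast+
  then have "r v \<noteq> r w" using r assms(4) by (auto dest: inj_onD)
  then show ?thesis by linarith
qed

lemma idx_bij:
  assumes \<sigma>: "\<sigma> \<in> K"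
  shows "bij_betw (idx \<sigma>) \<sigma> {..<card \<sigma>}"
proof -
  have inj: "inj_on (idx \<sigma>) \<sigma>"
  proof (rule inj_onI, rule ccontr)
    fix v w assume vw: "v \<in> \<sigma>" "w \<in> \<sigma>" "idx \<sigma> v = idx \<sigma> w" "v \<noteq> w"
    then show False
      using r_neq[OF \<sigma> vw(1,2,4)] idx_less[OF \<sigma> vw(1), of w] idx_less[OF \<sigma> vw(2), of v] by auto
  qed
  have "idx \<sigma> v < card \<sigma>" if "v \<in> \<sigma>" for v
    unfolding idx_def by (rule psubset_card_mono[OF face(1)[OF \<sigma>]]) (use that in auto)
  then have "idx \<sigma> ` \<sigma> \<subseteq> {..<card \<sigma>}" by auto
  moreover have "card (idx \<sigma> ` \<sigma>) = card {..<card \<sigma>}" using card_image[OF inj] by simp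
  ultimately have "idx \<sigma> ` \<sigma> = {..<card \<sigma>}" by (intro card_subset_eq) auto
  then show ?thesis using inj by (simp add: bij_betw_def)
qed

lemma idx_remove:
  assumes \<sigma>: "\<sigma> \<in> K" and x: "x \<in> \<sigma>" and v: "v \<in> \<sigma>" "v \<noteq> x"
  shows "idx (\<sigma> - {x}) v = (if idx \<sigma> v < idx \<sigma> x then idx \<sigma> v else idx \<sigma> v - 1)"
proof (cases "r v < r x")
  case True
  then have "{w \<in> \<sigma> - {x}. r w < r v} = {w \<in> \<sigma>. r w < r v}" by auto
  then show ?thesis using idx_less[OF \<sigma> v(1) True] by (simp add: idx_def)
next
  case False
  then have rx: "r x < r v" using r_neq[OF \<sigma> x v(1)] v(2) by auto
  have "{w \<in> \<sigma> - {x}. r w < r v} = {w \<in> \<sigma>. r w < r v} - {x}" by auto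
  moreover have "x \<in> {w \<in> \<sigma>. r w < r v}" using rx x by simp
  ultimately have "idx (\<sigma> - {x}) v = idx \<sigma> v - 1"
    using face(1)[OF \<sigma>] by (simp add: idx_def)
  then show ?thesis using idx_less[OF \<sigma> x rx] by simp
qed

text \<open>The affine parametrisation of the closed face \<open>\<sigma>\<close> by the standard simplex, with the vertices in
  increasing order. Because the order is global, its singular faces are again of this form.\<close>

definition simplex_of :: "'v set \<Rightarrow> (nat \<Rightarrow> real) \<Rightarrow> 'v \<Rightarrow> real" where
  "simplex_of \<sigma> = restrict (\<lambda>t v. if v \<in> \<sigma> then t (idx \<sigma> v) else 0) (standard_simplex (card \<sigma> - 1))"

lemma simplex_of_in:
  assumes \<sigma>: "\<sigma> \<in> K" and t: "t \<in> standard_simplex (card \<sigma> - 1)"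
  shows "simplex_of \<sigma> t \<in> carrier_points K" "support (simplex_of \<sigma> t) \<subseteq> \<sigma>"
proof -
  let ?x = "simplex_of \<sigma> t"
  have x: "?x v = (if v \<in> \<sigma> then t (idx \<sigma> v) else 0)" for v using t by (simp add: simplex_of_def)
  show sub: "support ?x \<subseteq> \<sigma>" by (auto simp: support_def x)
  have card: "{..<card \<sigma>} = {..card \<sigma> - 1}"
  proof -
    have "card \<sigma> \<noteq> 0" using face(1,2)[OF \<sigma>] by simp
    then show ?thesis by auto
  qed
  have "(\<Sum>v\<in>support ?x. ?x v) = (\<Sum>v\<in>\<sigma>. ?x v)"
    by (rule sum.mono_neutral_left[OF face(1)[OF \<sigma>] sub]) (simp add: support_def)
  also have "\<dots> = (\<Sum>v\<in>\<sigma>. t (idx \<sigma> v))" by (simp add: x)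
  also have "\<dots> = (\<Sum>i<card \<sigma>. t i)" by (rule sum.reindex_bij_betw[OF idx_bij[OF \<sigma>]])
  also have "\<dots> = 1" using t by (simp add: card standard_simplex_def)
  finally have sum: "(\<Sum>v\<in>support ?x. ?x v) = 1" .
  then have "support ?x \<noteq> {}" by auto
  then have "support ?x \<in> K" using face_subset[OF \<sigma> sub] by blast
  moreover have "0 \<le> ?x v" for v using t by (simp add: x standard_simplex_def)
  ultimately show "?x \<in> carrier_points K" using sum by (simp add: carrier_points_def support_def)
qed

abbreviation closed_face :: "'v set \<Rightarrow> ('v \<Rightarrow> real) topology" where
  "closed_face \<sigma> \<equiv> subtopology (geometric_carrier K) {x. support x \<subseteq> \<sigma>}"

lemma topspace_carrier: "topspace (geometric_carrier K) = carrier_points K"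
  by (simp add: geometric_carrier_def)

lemma singular_simplex_simplex_of:
  assumes \<sigma>: "\<sigma> \<in> K" and p: "card \<sigma> = Suc p"
  shows "singular_simplex p (closed_face \<sigma>) (simplex_of \<sigma>)"
proof -
  let ?S = "subtopology (powertop_real UNIV) (standard_simplex p)"
  have "continuous_map ?S (powertop_real UNIV) (simplex_of \<sigma>)"
    unfolding continuous_map_componentwise_UNIV
  proof
    fix v
    have "continuous_map ?S euclideanreal (\<lambda>t. if v \<in> \<sigma> then t (idx \<sigma> v) else 0)"
      by (cases "v \<in> \<sigma>") (auto intro!: continuous_map_from_subtopology continuous_map_product_projection)
    then show "continuous_map ?S euclideanreal (\<lambda>t. simplex_of \<sigma> t v)"
      by (rule continuous_map_eq) (simp add: simplex_of_def p)
  qed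
  moreover have "simplex_of \<sigma> t \<in> carrier_points K \<inter> {x. support x \<subseteq> \<sigma>}" if "t \<in> standard_simplex p" for t
    using simplex_of_in[OF \<sigma>, of t] that p by simp
  ultimately have "continuous_map ?S (closed_face \<sigma>) (simplex_of \<sigma>)"
    by (auto simp: geometric_carrier_def subtopology_subtopology continuous_map_in_subtopology)
  moreover have "simplex_of \<sigma> \<in> extensional (standard_simplex p)" by (simp add: simplex_of_def p)
  ultimately show ?thesis by (simp add: singular_simplex_def)
qed

lemma singular_simplex_carrier:
  "singular_simplex p (closed_face \<sigma>) f \<Longrightarrow> singular_simplex p (geometric_carrier K) f"
  by (simp add: singular_simplex_subtopology)

lemma rounded_simplex_of:
  assumes \<sigma>: "\<sigma> \<in> K" and p: "card \<sigma> = Suc p"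
  shows "rounded p (simplex_of \<sigma>) = \<sigma>"
proof -
  have val: "round_to (simplex_of \<sigma> (corner i)) \<in> \<sigma> \<and> idx \<sigma> (round_to (simplex_of \<sigma> (corner i))) = i"
    if i: "i \<le> p" for i
  proof -
    let ?x = "simplex_of \<sigma> (corner i)"
    have "corner i \<in> standard_simplex p" using i by simp
    then have c: "?x \<in> carrier_points K" and x: "\<And>v. ?x v = (if v \<in> \<sigma> \<and> idx \<sigma> v = i then 1 else 0)"
      using simplex_of_in(1)[OF \<sigma>, of "corner i"] p by (simp_all add: simplex_of_def)
    have "?x (round_to ?x) \<noteq> 0" using round_to(2)[OF c] by (simp add: support_def)
    then show ?thesis using x[of "round_to ?x"] by presburger
  qed
  have "v \<in> rounded p (simplex_of \<sigma>)" if v: "v \<in> \<sigma>" for v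
  proof -
    have "idx \<sigma> v < card \<sigma>" using idx_bij[OF \<sigma>] v by (auto simp: bij_betw_def)
    then have i: "idx \<sigma> v \<le> p" using p by simp
    have "round_to (simplex_of \<sigma> (corner (idx \<sigma> v))) = v"
      using val[OF i] v idx_bij[OF \<sigma>] unfolding bij_betw_def by (blast dest: inj_onD)
    then show ?thesis using i unfolding rounded_def by (intro image_eqI[where x = "idx \<sigma> v"]) simp_all
  qed
  then show ?thesis using val unfolding rounded_def by blast
qed

lemma singular_face_simplex_of:
  assumes \<sigma>: "\<sigma> \<in> K" and p: "card \<sigma> = Suc (Suc p)" and x: "x \<in> \<sigma>"
  shows "singular_face (Suc p) (idx \<sigma> x) (simplex_of \<sigma>) = simplex_of (\<sigma> - {x})"
proof
  fix t
  let ?k = "idx \<sigma> x"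
  have c: "card (\<sigma> - {x}) - 1 = p" using p x face(1)[OF \<sigma>] by simp
  have "?k < card \<sigma>" using idx_bij[OF \<sigma>] x unfolding bij_betw_def by blast
  then have k: "?k \<le> Suc p" using p by simp
  show "singular_face (Suc p) ?k (simplex_of \<sigma>) t = simplex_of (\<sigma> - {x}) t"
  proof (cases "t \<in> standard_simplex p")
    case True
    then have s: "simplical_face ?k t \<in> standard_simplex (Suc p)"
      using simplical_face_in_standard_simplex[of "Suc p" ?k t] k by simp
    have "(if v \<in> \<sigma> then simplical_face ?k t (idx \<sigma> v) else 0) = (if v \<in> \<sigma> - {x} then t (idx (\<sigma> - {x}) v) else 0)" for v
    proof (cases "v \<in> \<sigma> - {x}")
      case v: True
      then have "idx \<sigma> v \<noteq> ?k" using idx_bij[OF \<sigma>] x by (auto simp: bij_betw_def dest: inj_onD)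
      then show ?thesis using idx_remove[OF \<sigma> x, of v] v by (auto simp: simplical_face_def)
    next
      case False
      then have "v \<notin> \<sigma> \<or> v = x" by blast
      then show ?thesis by (auto simp: simplical_face_def)
    qed
    then show ?thesis using True s c p by (simp add: singular_face_def simplex_of_def fun_eq_iff)
  next
    case False
    then show ?thesis using c by (simp add: singular_face_def simplex_of_def)
  qed
qed

lemma sum_faces_simplex_of:
  assumes \<sigma>: "\<sigma> \<in> K" and p: "card \<sigma> = Suc (Suc p)"
  shows "(\<Sum>k\<le>Suc p. F (singular_face (Suc p) k (simplex_of \<sigma>))) = (\<Sum>v\<in>\<sigma>. F (simplex_of (\<sigma> - {v})))"
proof -
  have "bij_betw (idx \<sigma>) \<sigma> {..Suc p}" using idx_bij[OF \<sigma>] p by (simp only: lessThan_Suc_atMost)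
  then have "(\<Sum>k\<le>Suc p. F (singular_face (Suc p) k (simplex_of \<sigma>))) =
      (\<Sum>v\<in>\<sigma>. F (singular_face (Suc p) (idx \<sigma> v) (simplex_of \<sigma>)))"
    by (rule sum.reindex_bij_betw[symmetric])
  also have "\<dots> = (\<Sum>v\<in>\<sigma>. F (simplex_of (\<sigma> - {v})))"
    by (rule sum.cong) (simp_all add: singular_face_simplex_of[OF \<sigma> p])
  finally show ?thesis .
qed

text \<open>The open sets \<open>N x\<close> of points all of whose coordinates off the support of \<open>x\<close> are less than \<open>1/n\<close>
  cover the carrier. Rounding sends every point of \<open>N x\<close> to a vertex in the support of \<open>x\<close>, so a
  singular simplex inside \<open>N x\<close> is rounded to a subset of that face.\<close>

lemma subdivision_rounds_into_complex:
  assumes C: "singular_chain p (geometric_carrier K) C"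
  obtains n where "Poly_Mapping.keys (round_chain p ((singular_subdivision p ^^ n) C)) \<subseteq> {\<sigma> \<in> K. card \<sigma> = Suc p}"
proof -
  define N where "N = (\<lambda>x. carrier_points K \<inter> (\<Inter>v\<in>V - support x. {y. real (card V) * y v < 1}))"
  have op: "openin (geometric_carrier K) (N x)" for x
  proof -
    have "open (\<Inter>v\<in>V - support x. {y :: 'v \<Rightarrow> real. real (card V) * y v < 1})"
      by (intro open_INT finite_Diff finite_V ballI open_Collect_less continuous_intros
          continuous_on_product_coordinates)
    then have "openin (powertop_real UNIV) (\<Inter>v\<in>V - support x. {y :: 'v \<Rightarrow> real. real (card V) * y v < 1})"
      by (simp add: euclidean_product_topology)
    then show ?thesis unfolding geometric_carrier_def N_def by (rule openin_subtopology_Int2)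
  qed
  obtain n where n: "\<And>m f. \<lbrakk>n \<le> m; f \<in> Poly_Mapping.keys ((singular_subdivision p ^^ m) C)\<rbrakk>
      \<Longrightarrow> \<exists>U \<in> N ` carrier_points K. f \<in> standard_simplex p \<rightarrow> U"
  proof (rule sufficient_iterated_singular_subdivision_exists[OF _ _ C])
    show "openin (geometric_carrier K) U" if "U \<in> N ` carrier_points K" for U using op that by blast
    show "topspace (geometric_carrier K) \<subseteq> \<Union> (N ` carrier_points K)"
      unfolding topspace_carrier by (auto simp: N_def support_def)
  qed blast
  have "rounded p f \<in> K" if f: "f \<in> Poly_Mapping.keys ((singular_subdivision p ^^ n) C)" for f
  proof -
    obtain x where x: "x \<in> carrier_points K" "f \<in> standard_simplex p \<rightarrow> N x" using n[OF order_refl f] by blast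
    have "rounded p f \<subseteq> support x"
    proof
      fix v assume "v \<in> rounded p f"
      then obtain i where i: "i \<le> p" "v = round_to (f (corner i))" by (auto simp: rounded_def)
      let ?y = "f (corner i)"
      have y: "?y \<in> N x" using x(2) i(1) by (auto simp: Pi_iff)
      then have yc: "?y \<in> carrier_points K" by (simp add: N_def)
      have "v \<in> V" using round_to(2)[OF yc] face(3)[OF carrier_pointsD(1)[OF yc]] i(2) by blast
      then show "v \<in> support x" using y round_to(1)[OF yc] i(2) by (force simp: N_def)
    qed
    moreover have "rounded p f \<noteq> {}" by (auto simp: rounded_def)
    ultimately show ?thesis using face_subset carrier_pointsD(1)[OF x(1)] by blast
  qed
  moreover have "Poly_Mapping.keys (round_chain p ((singular_subdivision p ^^ n) C)) \<subseteq>
      (\<Union>f \<in> Poly_Mapping.keys ((singular_subdivision p ^^ n) C). Poly_Mapping.keys (round_simplex p f))"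
    unfolding round_chain_def by (rule keys_frag_extend)
  ultimately show thesis
    by (intro that) (force simp: round_simplex_def split: if_splits)
qed

lemma round_chain_add: "round_chain p (a + b) = round_chain p a + round_chain p b"
  by (simp add: round_chain_def frag_extend_add)

lemma round_chain_sum: "round_chain p (sum f I) = (\<Sum>i\<in>I. round_chain p (f i))"
  by (induction I rule: infinite_finite_induct) (simp_all add: round_chain_add, simp_all add: round_chain_def)

lemma cong2_round_subdivision:
  assumes "cong2 a b"
  shows "cong2 (round_chain p ((singular_subdivision p ^^ n) a)) (round_chain p ((singular_subdivision p ^^ n) b))"
  by (rule additive_cong2[OF _ assms]) (simp add: iterated_subdivision_add round_chain_add)

lemma cong2_boundary_simplex_of:
  assumes "\<sigma> \<in> K" "card \<sigma> = Suc (Suc p)"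
  shows "cong2 (chain_boundary (Suc p) (frag_of (simplex_of \<sigma>))) (\<Sum>v\<in>\<sigma>. frag_of (simplex_of (\<sigma> - {v})))"
proof -
  have "cong2 (chain_boundary (Suc p) (frag_of (simplex_of \<sigma>)))
      (\<Sum>k\<le>Suc p. frag_of (singular_face (Suc p) k (simplex_of \<sigma>)))"
    unfolding chain_boundary_of by (simp del: sum.atMost_Suc) (rule cong2_sum, rule cong2_sign)
  then show ?thesis using sum_faces_simplex_of[OF assms, of frag_of] by simp
qed

text \<open>Sperner's lemma. The carrier of \<open>\<sigma>\<close> is preserved by subdivision and its points round to vertices
  of \<open>\<sigma>\<close>, so the left-hand side is a multiple of \<open>\<sigma>\<close>. Its boundary is, by induction, the boundary of
  \<open>\<sigma>\<close>, so the multiple is odd.\<close>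

lemma round_subdivided_face:
  assumes "\<sigma> \<in> K" "card \<sigma> = Suc p"
  shows "cong2 (round_chain p ((singular_subdivision p ^^ n) (frag_of (simplex_of \<sigma>)))) (frag_of \<sigma>)"
  using assms
proof (induction p arbitrary: \<sigma>)
  case 0
  have ch: "singular_chain 0 (closed_face \<sigma>) (frag_of (simplex_of \<sigma>))"
    using singular_simplex_simplex_of[OF 0] by (simp add: singular_chain_of)
  have "(singular_subdivision 0 ^^ n) (frag_of (simplex_of \<sigma>)) = frag_of (simplex_of \<sigma>)"
    by (induction n) (simp_all add: singular_subdivision_zero[OF ch])
  then show ?case
    using rounded_simplex_of[OF 0] 0 by (simp add: round_chain_def round_simplex_def cong2_refl)
next
  case (Suc p)
  let ?c = "(singular_subdivision (Suc p) ^^ n) (frag_of (simplex_of \<sigma>))"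
  let ?A = "round_chain (Suc p) ?c"
  have fin: "finite \<sigma>" using face(1) Suc.prems by blast
  have ch: "singular_chain (Suc p) (closed_face \<sigma>) (frag_of (simplex_of \<sigma>))"
    using singular_simplex_simplex_of[OF Suc.prems] by (simp add: singular_chain_of)
  have "rounded (Suc p) f \<subseteq> \<sigma>" if "f \<in> Poly_Mapping.keys ?c" for f
  proof
    fix v assume "v \<in> rounded (Suc p) f"
    then obtain i where i: "i \<le> Suc p" "v = round_to (f (corner i))" by (auto simp: rounded_def)
    have "singular_simplex (Suc p) (closed_face \<sigma>) f"
      using singular_chain_iterated_subdivision[OF ch] that by (auto simp: singular_chain_def)
    then have "f ` standard_simplex (Suc p) \<subseteq> topspace (closed_face \<sigma>)"
      by (auto simp: singular_simplex_def continuous_map_def Pi_iff)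
    moreover have "corner i \<in> standard_simplex (Suc p)" using i by simp
    ultimately have "f (corner i) \<in> topspace (closed_face \<sigma>)" by blast
    then have "f (corner i) \<in> carrier_points K" "support (f (corner i)) \<subseteq> \<sigma>"
      by (auto simp: topspace_carrier)
    then show "v \<in> \<sigma>" using round_to(2) i(2) by blast
  qed
  then have "Poly_Mapping.keys (round_simplex (Suc p) f) \<subseteq> {\<sigma>}" if "f \<in> Poly_Mapping.keys ?c" for f
    using that card_subset_eq[OF fin] Suc.prems(2) by (auto simp: round_simplex_def split: if_splits)
  then have keys: "Poly_Mapping.keys ?A \<subseteq> {\<sigma>}"
    unfolding round_chain_def using keys_frag_extend[of "round_simplex (Suc p)" ?c] by blast
  \<comment> \<open>If the multiple were even, no facet of \<open>\<sigma>\<close> would survive in the boundary.\<close>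
  obtain v where v: "v \<in> \<sigma>" using face(2) Suc.prems by blast
  have facet: "\<sigma> - {w} \<in> K" "card (\<sigma> - {w}) = Suc p" if "w \<in> \<sigma>" for w
  proof -
    show c: "card (\<sigma> - {w}) = Suc p" using Suc.prems fin that by simp
    then have "\<sigma> - {w} \<noteq> {}" by (metis card.empty nat.distinct(1))
    then show "\<sigma> - {w} \<in> K" by (rule face_subset[OF Suc.prems(1) Diff_subset])
  qed
  have "cong2 (face_boundary ?A) (round_chain p (chain_boundary (Suc p) ?c))"
    by (rule cong2_sym[OF round_chain_boundary])
  also have "chain_boundary (Suc p) ?c = (singular_subdivision p ^^ n) (chain_boundary (Suc p) (frag_of (simplex_of \<sigma>)))"
    by (rule chain_boundary_iterated_subdivision[OF ch])
  finally have 1: "cong2 (face_boundary ?A)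
    (round_chain p ((singular_subdivision p ^^ n) (chain_boundary (Suc p) (frag_of (simplex_of \<sigma>)))))" .
  have 2: "cong2 (round_chain p ((singular_subdivision p ^^ n) (chain_boundary (Suc p) (frag_of (simplex_of \<sigma>)))))
    (round_chain p ((singular_subdivision p ^^ n) (\<Sum>v\<in>\<sigma>. frag_of (simplex_of (\<sigma> - {v})))))"
    by (rule cong2_round_subdivision[OF cong2_boundary_simplex_of[OF Suc.prems]])
  have 3: "cong2 (round_chain p ((singular_subdivision p ^^ n) (\<Sum>v\<in>\<sigma>. frag_of (simplex_of (\<sigma> - {v})))))
    (\<Sum>v\<in>\<sigma>. frag_of (\<sigma> - {v}))"
    unfolding iterated_subdivision_sum round_chain_sum by (intro cong2_sum Suc.IH facet)
  have "cong2 (face_boundary ?A) (\<Sum>v\<in>\<sigma>. frag_of (\<sigma> - {v}))"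
    using cong2_trans[OF 1 cong2_trans[OF 2 3]] .
  then have "odd_support (face_boundary ?A) = odd_support (\<Sum>v\<in>\<sigma>. frag_of (\<sigma> - {v}))"
    by (rule cong2_imp_odd_support)
  moreover have "\<sigma> - {v} \<in> odd_support (\<Sum>v\<in>\<sigma>. frag_of (\<sigma> - {v}))"
    using v by (auto simp: odd_support_def lookup_face_sum[OF fin])
  ultimately have "\<sigma> - {v} \<in> bd (odd_support ?A)"
    using odd_support_face_boundary[of ?A] keys fin by blast
  then obtain w where "insert w (\<sigma> - {v}) \<in> odd_support ?A" by (rule bd_face)
  moreover have "odd_support ?A \<subseteq> {\<sigma>}" using odd_support_subset_keys keys by (rule subset_trans)
  ultimately have "odd (lookup ?A \<sigma>)" by (auto simp: odd_support_def)
  moreover have "lookup ?A \<tau> = 0" if "\<tau> \<noteq> \<sigma>" for \<tau> using keys that by (auto simp: in_keys_iff)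
  ultimately show ?case unfolding cong2_iff by (metis even_zero lookup_frag_of odd_one)
qed

lemma bit_of_int_eq_iff: "(of_int m :: bit) = of_int n \<longleftrightarrow> (even m \<longleftrightarrow> even n)"
proof -
  have "(of_int k :: bit) = (if even k then 0 else 1)" for k
    by (cases "even k") (auto elim!: evenE oddE)
  then show ?thesis by simp
qed

lemma sum_constant_even_card:
  fixes g :: "'b \<Rightarrow>\<^sub>0 bit"
  assumes "even (card A)"
  shows "(\<Sum>v\<in>A. g) = 0"
proof (rule poly_mapping_eqI)
  fix x
  have "(of_nat (card A) :: bit) = 0" using assms by (auto elim!: evenE)
  then show "lookup (\<Sum>v\<in>A. g) x = lookup 0 x" by (simp add: lookup_sum)
qed

text \<open>The realisation \<open>c0\<close> of \<open>Z\<close> is a singular cycle, hence the boundary of some \<open>c\<close>. Let \<open>C\<close> be its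
  integral lift. The boundary of the rounded subdivision of \<open>C\<close> is mod 2 the rounded subdivision of
  the realisation, and this is \<open>Z\<close>.\<close>

lemma simplicial_cycle_bounds:
  assumes ac: "z2_acyclic K" and Z: "Z \<subseteq> {\<sigma> \<in> K. card \<sigma> = Suc q}" and "bd Z = {}"
  shows "\<exists>W. W \<subseteq> {\<sigma> \<in> K. card \<sigma> = Suc (Suc q)} \<and> bd W = Z"
proof -
  let ?X = "geometric_carrier K"
  define c0 where "c0 = (\<Sum>\<sigma>\<in>Z. Poly_Mapping.single (simplex_of \<sigma>) (1::bit))"
  have "finite K" using K by (simp add: finite_complex_def)
  then have finZ: "finite Z" by (rule rev_finite_subset) (use Z in blast)
  have Zface: "\<sigma> \<in> K" "card \<sigma> = Suc q" if "\<sigma> \<in> Z" for \<sigma> using Z that by auto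
  have inj: "inj_on simplex_of Z"
    by (rule inj_onI) (metis Zface rounded_simplex_of)
  have look: "lookup c0 x = (if x \<in> simplex_of ` Z then 1 else 0)" for x
  proof -
    have "c0 = (\<Sum>f\<in>simplex_of ` Z. Poly_Mapping.single f 1)"
      unfolding c0_def using sum.reindex[OF inj, of "\<lambda>f. Poly_Mapping.single f (1::bit)"] by (simp add: o_def)
    then show ?thesis using finZ by (simp add: lookup_sum lookup_single when_def)
  qed
  have keys: "Poly_Mapping.keys c0 = simplex_of ` Z" by (auto simp: in_keys_iff look split: if_splits)
  have "c0 \<in> carrier (z2_chain_group q ?X)"
  proof -
    have "singular_simplex q ?X (simplex_of \<sigma>)" if "\<sigma> \<in> Z" for \<sigma>
      by (rule singular_simplex_carrier[OF singular_simplex_simplex_of[OF Zface[OF that]]])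
    then show ?thesis by (simp add: z2_chain_group_def keys image_subset_iff)
  qed
  moreover have "if q = 0 then z2_augmentation c0 = 0 else z2_boundary q c0 = 0"
  proof (cases q)
    case 0
    have "Z = (\<lambda>v. {v}) ` apexes Z {}"
    proof -
      have "\<sigma> \<in> (\<lambda>v. {v}) ` apexes Z {}" if "\<sigma> \<in> Z" for \<sigma>
        using Zface[OF that] that 0 by (auto simp: card_1_singleton_iff apexes_def)
      then show ?thesis by (auto simp: apexes_def)
    qed
    then have "card Z = card (apexes Z {})" by (metis card_image inj_singleton inj_on_subset subset_UNIV)
    then have "even (card Z)" using \<open>bd Z = {}\<close> by (auto simp: bd_def)
    have "z2_augmentation c0 = (\<Sum>f\<in>simplex_of ` Z. 1)"
      unfolding z2_augmentation_def keys by (rule sum.cong) (simp_all add: look)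
    also have "\<dots> = of_nat (card Z)" using card_image[OF inj] by simp
    also have "\<dots> = 0" using \<open>even (card Z)\<close> by (auto elim!: evenE)
    finally show ?thesis using 0 by simp
  next
    case (Suc p)
    define G where "G = (\<lambda>\<tau>. Poly_Mapping.single (simplex_of \<tau>) (1::bit))"
    have "z2_boundary q c0 = (\<Sum>f\<in>simplex_of ` Z. \<Sum>k\<le>q. Poly_Mapping.single (singular_face q k f) 1)"
      using Suc by (simp add: z2_boundary_def keys del: sum.atMost_Suc)
    also have "\<dots> = (\<Sum>\<sigma>\<in>Z. \<Sum>k\<le>q. Poly_Mapping.single (singular_face q k (simplex_of \<sigma>)) 1)"
      using sum.reindex[OF inj] by (simp add: o_def)
    also have "\<dots> = (\<Sum>\<sigma>\<in>Z. \<Sum>v\<in>\<sigma>. G (\<sigma> - {v}))"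
    proof (rule sum.cong[OF refl])
      fix \<sigma> assume "\<sigma> \<in> Z"
      then show "(\<Sum>k\<le>q. Poly_Mapping.single (singular_face q k (simplex_of \<sigma>)) 1) = (\<Sum>v\<in>\<sigma>. G (\<sigma> - {v}))"
        using sum_faces_simplex_of[of \<sigma> p "\<lambda>f. Poly_Mapping.single f 1"] Zface Suc by (simp add: G_def del: sum.atMost_Suc)
    qed
    also have "\<dots> = (\<Sum>(\<sigma>, v)\<in>(SIGMA \<sigma>:Z. \<sigma>). G (\<sigma> - {v}))"
      using finZ Zface face(1) by (intro sum.Sigma) auto
    also have "\<dots> = (\<Sum>(\<tau>, v)\<in>(SIGMA \<tau>:Pow V. apexes Z \<tau>). G \<tau>)"
    proof (rule sum.reindex_bij_witness[where i = "\<lambda>(\<tau>, v). (insert v \<tau>, v)" and j = "\<lambda>(\<sigma>, v). (\<sigma> - {v}, v)"])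
      fix a assume "a \<in> (SIGMA \<sigma>:Z. \<sigma>)"
      then obtain \<sigma> v where a: "a = (\<sigma>, v)" "\<sigma> \<in> Z" "v \<in> \<sigma>" by auto
      have "insert v (\<sigma> - {v}) = \<sigma>" "\<sigma> \<subseteq> V" using a Zface face(3) by auto
      then show "(case case a of (\<sigma>, v) \<Rightarrow> (\<sigma> - {v}, v) of (\<tau>, v) \<Rightarrow> (insert v \<tau>, v)) = a"
        "(case a of (\<sigma>, v) \<Rightarrow> (\<sigma> - {v}, v)) \<in> (SIGMA \<tau>:Pow V. apexes Z \<tau>)"
        using a by (auto simp: apexes_def)
    qed (auto simp: apexes_def)
    also have "\<dots> = (\<Sum>\<tau>\<in>Pow V. \<Sum>v\<in>apexes Z \<tau>. G \<tau>)"
      using finZ finite_V finite_apexes by (intro sum.Sigma[symmetric]) auto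
    also have "\<dots> = 0"
      using \<open>bd Z = {}\<close> by (intro sum.neutral ballI sum_constant_even_card) (auto simp: bd_def)
    finally show ?thesis using Suc by simp
  qed
  ultimately have "c0 \<in> z2_reduced_cycles q ?X" by (simp add: z2_reduced_cycles_def)
  then have "c0 \<in> z2_boundaries q ?X"
    using trivial_homology_imp_boundary ac by (auto simp: z2_acyclic_def)
  then obtain c where c: "Poly_Mapping.keys c \<subseteq> singular_simplex_set (Suc q) ?X" "c0 = z2_boundary (Suc q) c"
    by (auto simp: z2_boundaries_def z2_chain_group_def)
  define C where "C = (\<Sum>f\<in>Poly_Mapping.keys c. frag_of f)"
  have C: "singular_chain (Suc q) ?X C"
    unfolding C_def using c(1) by (intro singular_chain_sum) (auto simp: singular_chain_of)
  define R where "R = (\<Sum>\<sigma>\<in>Z. frag_of (simplex_of \<sigma>))"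
  have bdC: "cong2 (chain_boundary (Suc q) C) R"
  proof -
    define B where "B = (\<Sum>f\<in>Poly_Mapping.keys c. \<Sum>k\<le>Suc q. frag_of (singular_face (Suc q) k f))"
    have "chain_boundary (Suc q) C = (\<Sum>f\<in>Poly_Mapping.keys c. \<Sum>k\<le>Suc q. frag_cmul ((-1) ^ k) (frag_of (singular_face (Suc q) k f)))"
      unfolding C_def chain_boundary_sum o_def chain_boundary_of by simp
    also have "cong2 \<dots> B" unfolding B_def by (intro cong2_sum cong2_sign)
    finally have 1: "cong2 (chain_boundary (Suc q) C) B" .
    have "(of_int (lookup B x) :: bit) = of_int (lookup R x)" for x
    proof -
      have "(of_int (lookup B x) :: bit) =
          (\<Sum>f\<in>Poly_Mapping.keys c. \<Sum>k\<le>Suc q. lookup (Poly_Mapping.single (singular_face (Suc q) k f) 1) x)"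
        by (simp add: B_def lookup_sum lookup_single when_def of_int_sum eq_commute[of x] if_distrib[of of_int]
            del: sum.atMost_Suc cong: if_cong)
      also have "\<dots> = lookup c0 x" by (simp add: c(2) z2_boundary_def lookup_sum del: sum.atMost_Suc)
      also have "\<dots> = of_int (lookup R x)"
        by (simp add: c0_def R_def lookup_sum lookup_single when_def of_int_sum eq_commute[of x] if_distrib[of of_int]
            cong: if_cong)
      finally show ?thesis .
    qed
    then have "cong2 B R" unfolding cong2_iff bit_of_int_eq_iff by blast
    with 1 show ?thesis by (rule cong2_trans)
  qed
  obtain n where n: "Poly_Mapping.keys (round_chain (Suc q) ((singular_subdivision (Suc q) ^^ n) C))
      \<subseteq> {\<sigma> \<in> K. card \<sigma> = Suc (Suc q)}"
    by (rule subdivision_rounds_into_complex[OF C])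
  let ?A = "round_chain (Suc q) ((singular_subdivision (Suc q) ^^ n) C)"
  have "cong2 (face_boundary ?A) (round_chain q (chain_boundary (Suc q) ((singular_subdivision (Suc q) ^^ n) C)))"
    by (rule cong2_sym[OF round_chain_boundary])
  also have "chain_boundary (Suc q) ((singular_subdivision (Suc q) ^^ n) C) =
      (singular_subdivision q ^^ n) (chain_boundary (Suc q) C)"
    by (rule chain_boundary_iterated_subdivision[OF C])
  finally have 1: "cong2 (face_boundary ?A) (round_chain q ((singular_subdivision q ^^ n) (chain_boundary (Suc q) C)))" .
  have 2: "cong2 (round_chain q ((singular_subdivision q ^^ n) (chain_boundary (Suc q) C)))
      (round_chain q ((singular_subdivision q ^^ n) R))"
    by (rule cong2_round_subdivision[OF bdC])
  have 3: "cong2 (round_chain q ((singular_subdivision q ^^ n) R)) (\<Sum>\<sigma>\<in>Z. frag_of \<sigma>)"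
    unfolding R_def iterated_subdivision_sum round_chain_sum
    by (intro cong2_sum round_subdivided_face Zface)
  have "odd_support (face_boundary ?A) = odd_support (\<Sum>\<sigma>\<in>Z. frag_of \<sigma>)"
    by (rule cong2_imp_odd_support[OF cong2_trans[OF 1 cong2_trans[OF 2 3]]])
  also have "\<dots> = Z" using finZ by (auto simp: odd_support_def lookup_sum)
  finally have "bd (odd_support ?A) = Z"
    using odd_support_face_boundary[of ?A] n face(1) by blast
  moreover have "odd_support ?A \<subseteq> {\<sigma> \<in> K. card \<sigma> = Suc (Suc q)}"
    using odd_support_subset_keys n by (rule subset_trans)
  ultimately show ?thesis by blast
qed

end

theorem z2_acyclic_imp_simplicially_acyclic:
  assumes "finite_complex K" "z2_acyclic K"
  shows "simplicially_acyclic K"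
proof -
  have "finite (vertices K)"
    unfolding vertices_def using assms(1) by (intro finite_Union) (simp_all add: finite_complex_def)
  from finite_imp_inj_to_nat_seg[OF this] obtain r :: "'a \<Rightarrow> nat" where "inj_on r (vertices K)" by blast
  then interpret numbered_complex K r by unfold_locales (rule assms)
  show ?thesis unfolding simplicially_acyclic_def
  proof (intro allI impI)
    fix p :: nat and Z assume "0 < p" "Z \<subseteq> {\<sigma> \<in> K. card \<sigma> = p} \<and> bd Z = {}"
    then show "\<exists>W. W \<subseteq> {\<sigma> \<in> K. card \<sigma> = Suc p} \<and> bd W = Z"
      using simplicial_cycle_bounds[OF assms(2), of Z "p - 1"] by simp
  qed
qed

section \<open>Collapsing\<close>

lemma complex_finite: "finite_complex K \<Longrightarrow> finite K"
  unfolding finite_complex_def by (elim conjE)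

lemma complex_member:
  assumes "finite_complex K" "\<sigma> \<in> K"
  shows "finite \<sigma>" "\<sigma> \<noteq> {}"
  using assms unfolding finite_complex_def by blast+

lemma complex_face:
  assumes "finite_complex K" "\<sigma> \<in> K" "\<tau> \<subseteq> \<sigma>" "\<tau> \<noteq> {}"
  shows "\<tau> \<in> K"
  using assms unfolding finite_complex_def by blast

text \<open>A free face has a single coface, which has one vertex more, and this vertex is the only possible
  apex in any family of faces.\<close>

lemma free_face_apexes:
  assumes K: "finite_complex K" and free: "free_face_of K \<tau> \<sigma>"
  obtains v where "v \<notin> \<tau>" "\<sigma> = insert v \<tau>"
    "\<forall>W\<subseteq>K. apexes W \<tau> = (if \<sigma> \<in> W then {v} else {})"
proof -
  have f: "\<tau> \<in> K" "\<sigma> \<in> K" "\<tau> \<subset> \<sigma>" "\<And>\<rho>. \<rho> \<in> K \<Longrightarrow> \<tau> \<subset> \<rho> \<Longrightarrow> \<rho> = \<sigma>"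
    using free by (auto simp: free_face_of_def)
  obtain v where v: "v \<in> \<sigma>" "v \<notin> \<tau>" using f(3) by blast
  have "insert v \<tau> \<subseteq> \<sigma>" using v f(3) by blast
  then have "insert v \<tau> \<in> K" by (rule complex_face[OF K f(2)]) simp
  then have \<sigma>: "\<sigma> = insert v \<tau>" using f(4)[of "insert v \<tau>"] v(2) by blast
  have "apexes W \<tau> = (if \<sigma> \<in> W then {v} else {})" if W: "W \<subseteq> K" for W
  proof -
    have "u = v" if u: "u \<notin> \<tau>" "insert u \<tau> \<in> W" for u
    proof -
      have "insert u \<tau> = \<sigma>" using u W by (intro f(4)) blast+
      then show ?thesis using \<sigma> u(1) v(2) by blast
    qed
    then have "x \<in> apexes W \<tau> \<longleftrightarrow> x = v \<and> \<sigma> \<in> W" for x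
      unfolding apexes_def \<sigma> using v(2) by blast
    then show ?thesis by auto
  qed
  then have "\<forall>W\<subseteq>K. apexes W \<tau> = (if \<sigma> \<in> W then {v} else {})" by blast
  then show thesis by (rule that[OF v(2) \<sigma>])
qed

lemma finite_complex_collapse:
  assumes K: "finite_complex K" and free: "free_face_of K \<tau> \<sigma>"
  shows "finite_complex (K - {\<tau>, \<sigma>})"
proof -
  have f: "\<tau> \<subset> \<sigma>" "\<And>\<rho>. \<rho> \<in> K \<Longrightarrow> \<tau> \<subset> \<rho> \<Longrightarrow> \<rho> = \<sigma>"
    using free by (auto simp: free_face_of_def)
  have closed: "\<tau>' \<in> K - {\<tau>, \<sigma>}" if \<rho>: "\<rho> \<in> K - {\<tau>, \<sigma>}" and \<tau>': "\<tau>' \<subseteq> \<rho>" "\<tau>' \<noteq> {}" for \<rho> \<tau>'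
  proof -
    have "\<tau>' \<in> K" using complex_face[OF K _ \<tau>'] \<rho> by blast
    moreover have "\<not> \<tau> \<subseteq> \<rho>" using f(2)[of \<rho>] \<rho> by blast
    ultimately show ?thesis using \<tau>'(1) f(1) by blast
  qed
  show ?thesis
    unfolding finite_complex_def
  proof (intro conjI ballI allI impI)
    show "finite (K - {\<tau>, \<sigma>})" using complex_finite[OF K] by simp
    fix \<rho> assume \<rho>: "\<rho> \<in> K - {\<tau>, \<sigma>}"
    show "finite \<rho>" "\<rho> \<noteq> {}" using \<rho> complex_member[OF K] by simp_all
    show "\<tau>' \<in> K - {\<tau>, \<sigma>}" if "\<tau>' \<subseteq> \<rho> \<and> \<tau>' \<noteq> {}" for \<tau>'
      by (rule closed[OF \<rho>]) (use that in simp_all)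
  qed
qed

lemma simplicially_acyclicD:
  assumes "simplicially_acyclic K" "0 < p" "Z \<subseteq> {\<sigma> \<in> K. card \<sigma> = p}" "bd Z = {}"
  obtains W where "W \<subseteq> {\<sigma> \<in> K. card \<sigma> = Suc p}" "bd W = Z"
proof -
  have "\<exists>W. W \<subseteq> {\<sigma> \<in> K. card \<sigma> = Suc p} \<and> bd W = Z"
    using assms by (simp add: simplicially_acyclic_def)
  then show thesis using that by blast
qed

text \<open>Let a cycle of the smaller complex bound \<open>W\<close> in \<open>K\<close>. Then \<open>\<sigma>\<close> is not in \<open>W\<close>, as otherwise \<open>\<tau>\<close> would
  be in the boundary. If \<open>\<tau>\<close> is in \<open>W\<close>, adding the boundary of \<open>\<sigma>\<close> to \<open>W\<close> removes it.\<close>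

lemma simplicially_acyclic_collapse:
  assumes K: "finite_complex K" and ac: "simplicially_acyclic K" and free: "free_face_of K \<tau> \<sigma>"
  shows "simplicially_acyclic (K - {\<tau>, \<sigma>})"
  unfolding simplicially_acyclic_def
proof (intro allI impI, elim conjE)
  fix p :: nat and Z assume p: "0 < p" and Z: "Z \<subseteq> {\<rho> \<in> K - {\<tau>, \<sigma>}. card \<rho> = p}" and "bd Z = {}"
  have "Z \<subseteq> {\<rho> \<in> K. card \<rho> = p}" using Z by blast
  then obtain W where W: "W \<subseteq> {\<rho> \<in> K. card \<rho> = Suc p}" "bd W = Z"
    by (rule simplicially_acyclicD[OF ac p _ \<open>bd Z = {}\<close>])
  obtain v where v: "v \<notin> \<tau>" "\<sigma> = insert v \<tau>"
    and ap: "\<forall>W\<subseteq>K. apexes W \<tau> = (if \<sigma> \<in> W then {v} else {})"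
    by (rule free_face_apexes[OF K free])
  have "\<sigma> \<in> K" using free by (simp add: free_face_of_def)
  have "\<tau> \<notin> bd W" using W(2) Z by blast
  moreover have "W \<subseteq> K" using W by blast
  ultimately have "\<sigma> \<notin> W" using ap by (auto simp: bd_def)
  show "\<exists>W. W \<subseteq> {\<rho> \<in> K - {\<tau>, \<sigma>}. card \<rho> = Suc p} \<and> bd W = Z"
  proof (cases "\<tau> \<in> W")
    case False
    then show ?thesis using W \<open>\<sigma> \<notin> W\<close> by (intro exI[of _ W]) blast
  next
    case True
    note fin\<sigma> = complex_member(1)[OF K \<open>\<sigma> \<in> K\<close>] and finK = complex_finite[OF K]
    have card\<sigma>: "card \<sigma> = Suc (Suc p)" using True W(1) v fin\<sigma> by auto
    have finW: "finite W" using \<open>W \<subseteq> K\<close> finK by (rule finite_subset)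
    let ?W = "sym_diff W (bd {\<sigma>})"
    have bd\<sigma>: "bd {\<sigma>} \<subseteq> {\<rho> \<in> K. card \<rho> = Suc p}"
    proof
      fix \<rho> assume "\<rho> \<in> bd {\<sigma>}"
      then obtain x where "x \<in> \<sigma>" "\<rho> = \<sigma> - {x}" unfolding bd_singleton by blast
      then have c: "card \<rho> = Suc p" "\<rho> \<subseteq> \<sigma>" using card\<sigma> fin\<sigma> by auto
      then have "\<rho> \<noteq> {}" by (metis card.empty nat.distinct(1))
      then have "\<rho> \<in> K" by (rule complex_face[OF K \<open>\<sigma> \<in> K\<close> c(2)])
      then show "\<rho> \<in> {\<rho> \<in> K. card \<rho> = Suc p}" using c by simp
    qed
    have "\<tau> = \<sigma> - {v}" using v by blast
    then have "\<tau> \<in> bd {\<sigma>}" unfolding bd_singleton v(2) by blast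
    have "\<sigma> \<notin> ?W" using \<open>\<sigma> \<notin> W\<close> bd\<sigma> card\<sigma> by auto
    then have "?W \<subseteq> {\<rho> \<in> K - {\<tau>, \<sigma>}. card \<rho> = Suc p}"
      using W(1) bd\<sigma> True \<open>\<tau> \<in> bd {\<sigma>}\<close> by blast
    moreover have "bd ?W = Z"
    proof -
      have "bd ?W = sym_diff (bd W) (bd (bd {\<sigma>}))"
        by (rule bd_sym_diff[OF finW finite_bd]) (use fin\<sigma> in auto)
      moreover have "bd (bd {\<sigma>}) = {}" by (rule bd_bd) (use fin\<sigma> in auto)
      ultimately show ?thesis using W(2) by simp
    qed
    ultimately show ?thesis by blast
  qed
qed

text \<open>The faces of top dimension satisfy \<open>no_free\<close> and contain no nonempty cycle, so by the preceding
  results their dimension is 0; two vertices would form a cycle that bounds nothing.\<close>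

lemma acyclic_without_free_face:
  assumes K: "finite_complex K" "K \<noteq> {}" and ac: "simplicially_acyclic K" and seven: "card (vertices K) \<le> 7"
    and no: "\<And>\<tau> \<sigma>. \<not> free_face_of K \<tau> \<sigma>"
  obtains v where "K = {{v}}"
proof -
  let ?V = "vertices K"
  have finK: "finite K" and face: "\<And>\<sigma>. \<sigma> \<in> K \<Longrightarrow> finite \<sigma> \<and> \<sigma> \<noteq> {}"
    using complex_finite[OF K(1)] complex_member[OF K(1)] by simp_all
  note down = complex_face[OF K(1)]
  have V: "finite ?V" unfolding vertices_def using finK face by (intro finite_Union) simp_all
  have KV: "\<sigma> \<subseteq> ?V" if "\<sigma> \<in> K" for \<sigma> using that unfolding vertices_def by blast
  define m where "m = Max (card ` K)"
  have le: "card \<sigma> \<le> m" if "\<sigma> \<in> K" for \<sigma> unfolding m_def using finK that by simp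
  have "m \<in> card ` K" unfolding m_def using finK K(2) by (intro Max_in) auto
  then obtain \<sigma>0 where \<sigma>0: "\<sigma>0 \<in> K" "card \<sigma>0 = m" by blast
  have "0 < m" using face[OF \<sigma>0(1)] \<sigma>0(2) by (auto simp: card_gt_0_iff)
  define T where "T = {\<sigma> \<in> K. card \<sigma> = m}"
  have "T \<noteq> {}" using \<sigma>0 by (auto simp: T_def)
  have TV: "T \<subseteq> ksubsets ?V m" using KV by (auto simp: T_def)
  have X0: "Z = {}" if Z: "Z \<subseteq> T" "bd Z = {}" for Z
  proof -
    have "Z \<subseteq> {\<sigma> \<in> K. card \<sigma> = m}" using Z by (simp add: T_def)
    then obtain W where W: "W \<subseteq> {\<sigma> \<in> K. card \<sigma> = Suc m}" "bd W = Z"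
      by (rule simplicially_acyclicD[OF ac \<open>0 < m\<close> _ Z(2)])
    have "W = {}" using W(1) le by fastforce
    then show ?thesis using W(2) by simp
  qed
  show thesis
  proof (cases "m = 1")
    case True
    obtain v where v: "\<sigma>0 = {v}" using \<sigma>0(2) True by (auto simp: card_1_singleton_iff)
    have "\<sigma> = {v}" if \<sigma>: "\<sigma> \<in> K" for \<sigma>
    proof (rule ccontr)
      assume ne: "\<sigma> \<noteq> {v}"
      have "card \<sigma> \<noteq> 0" using face[OF \<sigma>] by simp
      then have "card \<sigma> = 1" using le[OF \<sigma>] True by simp
      then obtain u where u: "\<sigma> = {u}" by (auto simp: card_1_singleton_iff)
      have "u \<noteq> v" using u ne by blast
      have "apexes {{u}, {v}} \<tau> = (if \<tau> = {} then {u, v} else {})" for \<tau>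
        by (auto simp: apexes_def)
      then have "bd {{u}, {v}} = {}" using \<open>u \<noteq> v\<close> by (auto simp: bd_def)
      moreover have "{{u}, {v}} \<subseteq> T" using \<sigma> u \<sigma>0 v True by (simp add: T_def)
      ultimately have "{{u}, {v}} = {}" by (rule X0[rotated])
      then show False by simp
    qed
    then have "K = {{v}}" using K(2) by blast
    then show thesis by (rule that)
  next
    case False
    then have m2: "2 \<le> m" using \<open>0 < m\<close> by simp
    have nf: "no_free T"
      unfolding no_free_def
    proof (intro allI notI)
      fix \<tau> assume "card (apexes T \<tau>) = 1"
      then obtain v where ap: "apexes T \<tau> = {v}" by (auto simp: card_1_singleton_iff)
      then have v: "v \<notin> \<tau>" "insert v \<tau> \<in> T" unfolding apexes_def by blast+
      then have vK: "insert v \<tau> \<in> K" "card (insert v \<tau>) = m" by (auto simp: T_def)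
      have fin: "finite \<tau>" using face[OF vK(1)] by simp
      then have c: "Suc (card \<tau>) = m" using vK(2) v(1) by simp
      then have "\<tau> \<noteq> {}" using m2 by auto
      then have "\<tau> \<in> K" using down[OF vK(1)] by blast
      have "\<rho> = insert v \<tau>" if \<rho>: "\<rho> \<in> K" "\<tau> \<subset> \<rho>" for \<rho>
      proof -
        obtain w where w: "w \<in> \<rho>" "w \<notin> \<tau>" using \<rho>(2) by blast
        have "insert w \<tau> \<subseteq> \<rho>" using w \<rho>(2) by blast
        moreover have "card \<rho> \<le> card (insert w \<tau>)" using le[OF \<rho>(1)] c fin w(2) by simp
        ultimately have "insert w \<tau> = \<rho>" using face[OF \<rho>(1)] by (intro card_seteq) auto
        then have "card \<rho> = m" using c fin w(2) by auto
        then have "w \<in> apexes T \<tau>" using \<open>insert w \<tau> = \<rho>\<close> \<rho>(1) w(2) by (simp add: apexes_def T_def)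
        then show ?thesis using ap \<open>insert w \<tau> = \<rho>\<close> by simp
      qed
      then have "free_face_of K \<tau> (insert v \<tau>)"
        using \<open>\<tau> \<in> K\<close> vK(1) v(1) unfolding free_face_of_def by blast
      then show False using no by blast
    qed
    have "m \<le> card ?V" using card_mono[OF V KV[OF \<sigma>0(1)]] \<sigma>0(2) by simp
    have "\<exists>Z\<subseteq>T. Z \<noteq> {} \<and> bd Z = {}"
    proof (cases "card ?V \<le> m + 2")
      case True
      have "Suc (m - 1) = m" using m2 by simp
      then have "T \<subseteq> ksubsets ?V (Suc (m - 1))" "card ?V \<le> (m - 1) + 3" using TV True by auto
      then show ?thesis by (rule_tac cycle_if_few_vertices[OF V _ \<open>T \<noteq> {}\<close> nf, of "m - 1"]) blast+
    next
      case False
      then consider "m = 2" | "m = 3" "card ?V \<le> 6" | "m = 3" "card ?V = 7" | "m = 4" "card ?V = 7"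
        using m2 seven by linarith
      then show ?thesis
      proof cases
        case 1
        then show ?thesis by (intro cycle_in_graph[OF V _ \<open>T \<noteq> {}\<close> nf]) (use TV in simp)
      next
        case 2
        then show ?thesis by (intro cycle_in_dim_2_six_vertices[OF V _ \<open>T \<noteq> {}\<close> nf]) (use TV in simp_all)
      next
        case 3
        show ?thesis
        proof (rule cycle_in_dim_2_seven_vertices[OF V 3(2) _ \<open>T \<noteq> {}\<close> nf])
          show "T \<subseteq> ksubsets ?V 3" using TV 3(1) by simp
          fix x y z
          assume d: "x \<noteq> y" "x \<noteq> z" "y \<noteq> z"
            and ne: "apexes T {x, y} \<noteq> {}" "apexes T {x, z} \<noteq> {}" "apexes T {y, z} \<noteq> {}"
          have edge: "{i, j} \<in> K" if "apexes T {i, j} \<noteq> {}" for i j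
          proof -
            obtain k where "insert k {i, j} \<in> K" using \<open>apexes T {i, j} \<noteq> {}\<close> unfolding apexes_def T_def by blast
            then show ?thesis by (rule down) auto
          qed
          let ?Z = "{{x, y}, {x, z}, {y, z}}"
          have "?Z = bd {{x, y, z}}" using d by (auto simp: bd_singleton insert_Diff_if insert_commute)
          moreover have "bd (bd {{x, y, z}}) = {}" by (rule bd_bd) auto
          ultimately have "bd ?Z = {}" by simp
          moreover have "?Z \<subseteq> {\<sigma> \<in> K. card \<sigma> = 2}" using edge ne d by simp
          ultimately obtain W where "W \<subseteq> {\<sigma> \<in> K. card \<sigma> = Suc 2}" "bd W = ?Z"
            using simplicially_acyclicD[OF ac, of 2 ?Z] by auto
          moreover then have "W \<subseteq> T" using 3(1) by (simp add: T_def)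
          ultimately show "\<exists>W\<subseteq>T. bd W = ?Z" by blast
        qed
      next
        case 4
        show ?thesis
        proof (rule ccontr)
          assume none: "\<not> ?thesis"
          have TP: "T \<subseteq> Pow ?V" using TV by blast
          have "triples_on_seven_points ?V (compl ?V T)"
          proof
            show "compl ?V T \<subseteq> ksubsets ?V 3"
            proof
              fix u assume "u \<in> compl ?V T"
              then obtain t where t: "u = ?V - t" "t \<in> T" by blast
              then have "t \<subseteq> ?V" "card t = 4" using TV 4(1) by auto
              then show "u \<in> ksubsets ?V 3"
                using t(1) 4(2) card_Diff_subset[OF finite_subset[OF \<open>t \<subseteq> ?V\<close> V]] by auto
            qed
            show "\<not> cocycle ?V D" if D: "D \<subseteq> compl ?V T" "D \<noteq> {}" for D
            proof
              assume "cocycle ?V D"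
              then obtain Z where "Z \<subseteq> T" "Z \<noteq> {}" "bd Z = {}"
                by (rule cycle_of_cocycle_in_compl[OF TP D])
              then show False using none by blast
            qed
            show "card (opposite (compl ?V T) Q) \<noteq> 1" if "Q \<subseteq> ?V" for Q
              by (rule no_free_compl[OF nf TP that])
            show "compl ?V T \<noteq> {}" using \<open>T \<noteq> {}\<close> by simp
          qed (rule V 4(2))+
          then show False by (rule triples_on_seven_points.contradiction)
        qed
      qed
    qed
    then obtain Z where "Z \<subseteq> T" "Z \<noteq> {}" "bd Z = {}" by blast
    then have False using X0[of Z] by blast
    then show thesis ..
  qed
qed

lemma simplicially_acyclic_imp_collapsible:
  "finite_complex K \<Longrightarrow> K \<noteq> {} \<Longrightarrow> card (vertices K) \<le> 7 \<Longrightarrow> simplicially_acyclic K \<Longrightarrow> collapsible K"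
proof (induction "card K" arbitrary: K rule: less_induct)
  case less
  note K = less.prems
  note finK = complex_finite[OF K(1)]
  show ?case
  proof (cases "\<exists>\<tau> \<sigma>. free_face_of K \<tau> \<sigma>")
    case False
    then obtain v where "K = {{v}}" using acyclic_without_free_face[OF K(1,2,4,3)] by blast
    then show ?thesis by (auto simp: collapsible_def)
  next
    case True
    then obtain \<tau> \<sigma> where free: "free_face_of K \<tau> \<sigma>" by blast
    let ?K' = "K - {\<tau>, \<sigma>}"
    have "\<tau> \<in> K" "\<sigma> \<in> K" "\<tau> \<subset> \<sigma>" using free by (auto simp: free_face_of_def)
    have "\<tau> \<noteq> {}" by (rule complex_member(2)[OF K(1) \<open>\<tau> \<in> K\<close>])
    obtain b where b: "b \<in> \<sigma>" "b \<notin> \<tau>" using \<open>\<tau> \<subset> \<sigma>\<close> by blast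
    have "{b} \<in> K" using complex_face[OF K(1) \<open>\<sigma> \<in> K\<close>, of "{b}"] b by simp
    moreover have "{b} \<noteq> \<tau>" "{b} \<noteq> \<sigma>" using b \<open>\<tau> \<subset> \<sigma>\<close> \<open>\<tau> \<noteq> {}\<close> by blast+
    ultimately have ne: "?K' \<noteq> {}" by blast
    have "card ?K' < card K" using finK \<open>\<tau> \<in> K\<close> by (intro psubset_card_mono) auto
    moreover have "card (vertices ?K') \<le> 7"
    proof -
      have "finite (vertices K)" unfolding vertices_def
        using finK complex_member(1)[OF K(1)] by (rule finite_Union)
      then have "card (vertices ?K') \<le> card (vertices K)" by (rule card_mono) (auto simp: vertices_def)
      then show ?thesis using K(3) by simp
    qed
    ultimately have "collapsible ?K'"
      using less.hyps[of ?K'] ne finite_complex_collapse[OF K(1) free]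
        simplicially_acyclic_collapse[OF K(1,4) free] by blast
    moreover have "elementary_collapse K ?K'" using free by (auto simp: elementary_collapse_def)
    ultimately show ?thesis unfolding collapsible_def by (meson converse_rtranclp_into_rtranclp)
  qed
qed

theorem theorem1:
  fixes K :: "'v set set"
  assumes "finite_complex K"
    and "K \<noteq> {}"
    and "card (vertices K) \<le> 7"
    and "z2_acyclic K"
  shows "collapsible K"
  using simplicially_acyclic_imp_collapsible[OF assms(1-3)]
    z2_acyclic_imp_simplicially_acyclic[OF assms(1,4)] .

end
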